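(* Let $\mathrm U_q(\mathfrak l)$ be a reductive quantum sub-superalgebra of $\mathrm U_q(\mathfrak g)$, $\mathfrak g=\mathfrak{gl}_{m|n}$, and let $\mathrm U_q(\mathfrak p)\supseteq\mathrm U_q(\bar{\mathfrak b})$ be the parabolic quantum sub-superalgebra with Levi factor $\mathrm U_q(\mathfrak l)$. Then $\Gamma(\Xi)=\mathrm I_{\mathfrak p,\mathfrak l}^{\mathfrak g,\mathfrak g}(\Xi)$ on $\mathcal C(\mathfrak p,\mathfrak l)$ (where $\Xi\otimes\mathcal A(\mathfrak g)$ is identified with a subspace of the space of linear maps $\mathrm U_q(\mathfrak g)\to\Xi$ by $\langle\xi\otimes f,x\rangle=\langle f,x\rangle\xi$).
   Context: **Algebra.** Let $m,n$ be positive integers, $\mathbf I=\{1,\dots,m+n\}$, $\mathbf I'=\{1,\dots,m+n-1\}$, $\mathfrak g=\mathfrak{gl}_{m|n}$ (complex), $\mathfrak h$ the diagonal Cartan subalgebra, $\{\epsilon_a\}$ the basis of $\mathfrak h^*$ dual to the diagonal matrix units, with $(\epsilon_a,\epsilon_b)=\delta_{ab}$ for $a\le m$ and $-\delta_{ab}$ for $a>m$; $\mathfrak h^*_{\mathbb Z}=\bigoplus_a\mathbb Z\epsilon_a$. Let $q$ be an indeterminate, $q_a=q$ for $a\le m$, $q_a=q^{-1}$ for $a>m$. $[x]\in\mathbb Z_2$ denotes parity. $\mathrm U_q(\mathfrak g)$ is the unital associative superalgebra over $\mathbb C(q)$ generated by $E_{a,a+1},E_{a+1,a}$ ($a\in\mathbf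 I'$), $K_b^{\pm1}$ ($b\in\mathbf I$), with $E_{m,m+1},E_{m+1,m}$ odd and the other generators even, and relations (whenever indices make sense): $K_aK_a^{-1}=1$, the $K_a^{\pm1}$ commute; $K_aE_{b,b\pm1}K_a^{-1}=q^{(\epsilon_a,\epsilon_b-\epsilon_{b\pm1})}E_{b,b\pm1}$; $E_{a,a+1}E_{b+1,b}-(-1)^{\delta_{am}\delta_{bm}}E_{b+1,b}E_{a,a+1}=\delta_{ab}\frac{K_aK_{a+1}^{-1}-K_a^{-1}K_{a+1}}{q_a-q_a^{-1}}$; $E_{m,m+1}^2=E_{m+1,m}^2=0$; $E_{a,a+1}E_{b,b+1}=E_{b,b+1}E_{a,a+1}$ and $E_{a+1,a}E_{b+1,b}=E_{b+1,b}E_{a+1,a}$ for $|a-b|\ge2$; for $a\ne m$, $x^2y-(q+q^{-1})xyx+yx^2=0$ for $(x,y)=(E_{a,a+1},E_{a\pm1,a+1\pm1})$ and $(E_{a+1,a},E_{a+1\pm1,a\pm1})$; $E_{m-1,m+2}E_{m,m+1}+E_{m,m+1}E_{m-1,m+2}=0=E_{m+2,m-1}E_{m+1,m}+E_{m+1,m}E_{m+2,m-1}$, where for $a<c<b$ $E_{ab}=E_{ac}E_{cb}-q_c^{-1}E_{cb}E_{ac}$, $E_{ba}=E_{bc}E_{ca}-q_cE_{ca}E_{bc}$ (independent of $c$). It is a Hopf superalgebra with $\Delta(E_{a,a+1})=E_{a,a+1}\otimes K_aK_{a+1}^{-1}+1\otimes E_{a,a+1}$, $\Delta(E_{a+1,a})=E_{a+1,a}\otimes1+K_a^{-1}K_{a+1}\otimes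 E_{a+1,a}$, $\Delta(K_a^{\pm1})=K_a^{\pm1}\otimes K_a^{\pm1}$ and the corresponding counit $\epsilon$ and antipode $S$. **Sub-superalgebras.** For $\Theta_\pm\subseteq\mathbf I'$ one has the quantum sub-superalgebra generated by all $K_b^{\pm1}$, the $E_{a,a+1}$ with $a\in\Theta_+$ and the $E_{a+1,a}$ with $a\in\Theta_-$. It is reductive if $\Theta_+=\Theta_-$, parabolic if $\Theta_+=\mathbf I'$ or $\Theta_-=\mathbf I'$; the Levi factor of a parabolic is the reductive one given by $\Theta_+\cap\Theta_-$. $\mathrm U_q(\bar{\mathfrak b})$: $\Theta_+=\emptyset,\Theta_-=\mathbf I'$. **Modules and functors.** All modules are $\mathbb Z_2$-graded. $\mathrm{Hom}_{\mathrm U}(V,W)$ is the $\mathbb Z_2$-graded space of linear maps with $\phi(xv)=(-1)^{[x][\phi]}x\phi(v)$. An integral weight vector of weight $\mu\in\mathfrak h^*_{\mathbb Z}$ is $v$ with $K_av=q^{(\mu,\epsilon_a)}v$ for all $a$. For reductive $\mathrm U_q(\mathfrak k)\subseteq\mathrm U_q(\mathfrak r)$, $\mathcal C(\mathfrak r,\mathfrak k)$ is the category, with even morphisms, of $\mathrm U_q(\mathfrak r)$-modules spanned by integral weight vectors $v$ with $\dim\mathrm U_q(\mathfrak k)v<\infty$ (called $\mathrm U_q(\mathfrak k)$-finite). The induction functor $\mathrm I_{\mathfrak p,\mathfrak l}^{\mathfrak g,\mathfrak g}:\mathcal C(\mathfrak p,\mathfrak l)\to\mathcal C(\mathfrak g,\mathfrak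 g)$ sends $V$ to the sum of all $\mathrm U_q(\mathfrak g)$-finite graded $\mathrm U_q(\mathfrak g)$-submodules of $\mathrm{Hom}_{\mathrm U_q(\mathfrak p)}(\mathrm U_q(\mathfrak g),V)$, where $\langle y\zeta,x\rangle=(-1)^{[y]([x]+[\zeta])}\langle\zeta,xy\rangle$, and acts on morphisms by post-composition. **The functor $\Gamma$.** $\mathcal A(\mathfrak g)\subset\mathrm U_q(\mathfrak g)^*$ is the span of the matrix elements of all finite dimensional objects of $\mathcal C(\mathfrak g,\mathfrak g)$. It carries the left $\mathrm U_q(\mathfrak g)$-actions $\langle dL_x(f),y\rangle=(-1)^{[x][f]}\langle f,S(x)y\rangle$, $\langle dR_x(f),y\rangle=(-1)^{[x]}\langle f,yx\rangle$. For an object $\Xi$ of $\mathcal C(\mathfrak p,\mathfrak l)$, $\Gamma(\Xi)=\{\zeta\in\Xi\otimes\mathcal A(\mathfrak g)\mid(\mathrm{id}\otimes dL_x)\zeta=(S(x)\otimes\mathrm{id})\zeta\ \forall x\in\mathrm U_q(\mathfrak p)\}$, a $\mathrm U_q(\mathfrak g)$-module via $x\mapsto\mathrm{id}\otimes dR_x$ (with $(\mathrm{id}\otimes T)(\xi\otimes f)=(-1)^{[T][\xi]}\xi\otimes T(f)$); on morphisms $\Gamma(\phi)=\phi\otimes\mathrm{id}$. *)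

theory Defs
  imports
    Complex_Main
    "HOL-Library.Poly_Mapping"
    "HOL-Library.Function_Algebras"
    "HOL-Library.FuncSet"
    "HOL-Library.Cardinality"
    "HOL-Library.Z2"
    "HOL-Computational_Algebra.Polynomial"
    "HOL-Computational_Algebra.Fraction_Field"
begin

text \<open>
  Conventions. The positive integers \<open>m\<close>, \<open>n\<close> are the cardinalities \<open>CARD('m)\<close>, \<open>CARD('n)\<close> of
  two finite index types. Parities live in the two-element field \<^typ>\<open>bit\<close>. A formula containing a
  parity \<open>[x]\<close> is meant for homogeneous \<open>x\<close> and extended linearly; the definitions below make
  this extension explicit by splitting arguments into homogeneous components.
\<close>

section \<open>The ground field and the weight lattice\<close>

type_synonym Cq = "complex poly fract"

definition qq :: Cq where
  "qq = Fract [:0, 1:] 1"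

definition qi :: "nat \<Rightarrow> nat \<Rightarrow> Cq" where
  "qi m a = (if a \<le> m then qq else inverse qq)"

abbreviation idxI :: "nat \<Rightarrow> nat \<Rightarrow> nat set" where
  "idxI m n \<equiv> {1..m + n}"

abbreviation idxJ :: "nat \<Rightarrow> nat \<Rightarrow> nat set" where
  "idxJ m n \<equiv> {1..m + n - 1}"

text \<open>A weight is represented by its coordinates in the basis \<open>\<epsilon>\<^sub>a\<close>; only those in \<open>idxI m n\<close> count.\<close>

definition wform :: "nat \<Rightarrow> nat \<Rightarrow> (nat \<Rightarrow> int) \<Rightarrow> (nat \<Rightarrow> int) \<Rightarrow> int" where
  "wform m n \<mu> \<nu> = (\<Sum>a\<in>idxI m n. (if a \<le> m then 1 else -1) * \<mu> a * \<nu> a)"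

definition eps :: "nat \<Rightarrow> nat \<Rightarrow> int" where
  "eps a b = (if a = b then 1 else 0)"

definition ksign :: "bit \<Rightarrow> 'a::ab_group_add \<Rightarrow> 'a" where
  "ksign s v = (if s = 0 then v else - v)"

section \<open>The free superalgebra on the generators\<close>

text \<open>\<open>Up a\<close>, \<open>Dn a\<close>, \<open>Kp b\<close>, \<open>Km b\<close> stand for \<open>E\<^sub>a\<^sub>,\<^sub>a\<^sub>+\<^sub>1\<close>, \<open>E\<^sub>a\<^sub>+\<^sub>1\<^sub>,\<^sub>a\<close>, \<open>K\<^sub>b\<close> and the inverse of \<open>K\<^sub>b\<close>.\<close>

datatype rawgen = Up nat | Dn nat | Kp nat | Km nat

typedef (overloaded) ('m::finite, 'n::finite) gen =
  "Up ` idxJ CARD('m) CARD('n) \<union> Dn ` idxJ CARD('m) CARD('n) \<union>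
   Kp ` idxI CARD('m) CARD('n) \<union> Km ` idxI CARD('m) CARD('n)"
proof -
  have "0 < CARD('m)" by simp
  then have "1 \<in> idxI CARD('m) CARD('n)" by (simp only: atLeastAtMost_iff) linarith
  then show ?thesis by blast
qed

instantiation list :: (type) monoid_add
begin
definition zero_list_def: "(0 :: 'a list) = []"
definition plus_list_def: "(xs :: 'a list) + ys = xs @ ys"
instance by intro_classes (simp_all add: zero_list_def plus_list_def)
end

text \<open>
  The free algebra is the monoid algebra of the monoid of words; its multiplication is the
  convolution product of \<^theory>\<open>HOL-Library.Poly_Mapping\<close>.
\<close>

type_synonym ('m, 'n) fa = "('m, 'n) gen list \<Rightarrow>\<^sub>0 Cq"

definition fgen :: "rawgen \<Rightarrow> ('m::finite, 'n::finite) fa" where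
  "fgen g = Poly_Mapping.single [Abs_gen g] 1"

definition fscal :: "Cq \<Rightarrow> ('m::finite, 'n::finite) fa" where
  "fscal c = Poly_Mapping.single [] c"

definition gen_par :: "('m::finite, 'n::finite) gen \<Rightarrow> bit" where
  "gen_par g = (if Rep_gen g \<in> {Up CARD('m), Dn CARD('m)} then 1 else 0)"

definition word_par :: "('m::finite, 'n::finite) gen list \<Rightarrow> bit" where
  "word_par w = sum_list (map gen_par w)"

section \<open>The quantum superalgebra\<close>

text \<open>
  \<open>root_up a d\<close> and \<open>root_dn a d\<close> are \<open>E\<^sub>a\<^sub>b\<close> and \<open>E\<^sub>b\<^sub>a\<close> for \<open>b = a + d + 1\<close>, computed with the
  intermediate index \<open>c = b - 1\<close>.
\<close>

fun root_up :: "nat \<Rightarrow> nat \<Rightarrow> ('m::finite, 'n::finite) fa" where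
  "root_up a 0 = fgen (Up a)"
| "root_up a (Suc d) =
     root_up a d * fgen (Up (a + d + 1)) -
     fscal (inverse (qi CARD('m) (a + d + 1))) * (fgen (Up (a + d + 1)) * root_up a d)"

fun root_dn :: "nat \<Rightarrow> nat \<Rightarrow> ('m::finite, 'n::finite) fa" where
  "root_dn a 0 = fgen (Dn a)"
| "root_dn a (Suc d) =
     fgen (Dn (a + d + 1)) * root_dn a d -
     fscal (qi CARD('m) (a + d + 1)) * (root_dn a d * fgen (Dn (a + d + 1)))"

text \<open>The relations, each written as an element of the free algebra that is to vanish.\<close>

inductive_set uq_rels :: "('m::finite, 'n::finite) fa set" where
  K_inv: "a \<in> idxI CARD('m) CARD('n) \<Longrightarrow> fgen (Kp a) * fgen (Km a) - 1 \<in> uq_rels"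
| K_comm: "a \<in> idxI CARD('m) CARD('n) \<Longrightarrow> b \<in> idxI CARD('m) CARD('n) \<Longrightarrow>
    x \<in> {Kp a, Km a} \<Longrightarrow> y \<in> {Kp b, Km b} \<Longrightarrow>
    fgen x * fgen y - fgen y * fgen x \<in> uq_rels"
| K_up: "a \<in> idxI CARD('m) CARD('n) \<Longrightarrow> b \<in> idxJ CARD('m) CARD('n) \<Longrightarrow>
    fgen (Kp a) * fgen (Up b) * fgen (Km a) -
    fscal (qq powi wform CARD('m) CARD('n) (eps a) (eps b - eps (b + 1))) * fgen (Up b) \<in> uq_rels"
| K_dn: "a \<in> idxI CARD('m) CARD('n) \<Longrightarrow> b \<in> idxJ CARD('m) CARD('n) \<Longrightarrow>
    fgen (Kp a) * fgen (Dn b) * fgen (Km a) -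
    fscal (qq powi wform CARD('m) CARD('n) (eps a) (eps (b + 1) - eps b)) * fgen (Dn b) \<in> uq_rels"
| up_dn: "a \<in> idxJ CARD('m) CARD('n) \<Longrightarrow> b \<in> idxJ CARD('m) CARD('n) \<Longrightarrow>
    fgen (Up a) * fgen (Dn b) -
    ksign (if a = CARD('m) \<and> b = CARD('m) then 1 else 0) (fgen (Dn b) * fgen (Up a)) -
    (if a = b then
       fscal (inverse (qi CARD('m) a - inverse (qi CARD('m) a))) *
       (fgen (Kp a) * fgen (Km (a + 1)) - fgen (Km a) * fgen (Kp (a + 1)))
     else 0) \<in> uq_rels"
| up_sq: "fgen (Up CARD('m)) * fgen (Up CARD('m)) \<in> uq_rels"
| dn_sq: "fgen (Dn CARD('m)) * fgen (Dn CARD('m)) \<in> uq_rels"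
| up_far: "a \<in> idxJ CARD('m) CARD('n) \<Longrightarrow> b \<in> idxJ CARD('m) CARD('n) \<Longrightarrow>
    \<bar>int a - int b\<bar> \<ge> 2 \<Longrightarrow>
    fgen (Up a) * fgen (Up b) - fgen (Up b) * fgen (Up a) \<in> uq_rels"
| dn_far: "a \<in> idxJ CARD('m) CARD('n) \<Longrightarrow> b \<in> idxJ CARD('m) CARD('n) \<Longrightarrow>
    \<bar>int a - int b\<bar> \<ge> 2 \<Longrightarrow>
    fgen (Dn a) * fgen (Dn b) - fgen (Dn b) * fgen (Dn a) \<in> uq_rels"
| serre: "a \<in> idxJ CARD('m) CARD('n) \<Longrightarrow> b \<in> idxJ CARD('m) CARD('n) \<Longrightarrow>
    a \<noteq> CARD('m) \<Longrightarrow> \<bar>int a - int b\<bar> = 1 \<Longrightarrow>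
    (x, y) \<in> {(Up a, Up b), (Dn a, Dn b)} \<Longrightarrow>
    fgen x * fgen x * fgen y - fscal (qq + inverse qq) * (fgen x * fgen y * fgen x) +
    fgen y * fgen x * fgen x \<in> uq_rels"
| super_serre_up: "CARD('m) \<ge> 2 \<Longrightarrow> CARD('n) \<ge> 2 \<Longrightarrow>
    root_up (CARD('m) - 1) 2 * fgen (Up CARD('m)) +
    fgen (Up CARD('m)) * root_up (CARD('m) - 1) 2 \<in> uq_rels"
| super_serre_dn: "CARD('m) \<ge> 2 \<Longrightarrow> CARD('n) \<ge> 2 \<Longrightarrow>
    root_dn (CARD('m) - 1) 2 * fgen (Dn CARD('m)) +
    fgen (Dn CARD('m)) * root_dn (CARD('m) - 1) 2 \<in> uq_rels"

inductive_set uq_ideal :: "('m::finite, 'n::finite) fa set" where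
  zero: "0 \<in> uq_ideal"
| rel: "r \<in> uq_rels \<Longrightarrow> x * r * y \<in> uq_ideal"
| add: "x \<in> uq_ideal \<Longrightarrow> y \<in> uq_ideal \<Longrightarrow> x + y \<in> uq_ideal"

lemma uq_ideal_lmult: "x \<in> uq_ideal \<Longrightarrow> z * x \<in> uq_ideal"
proof (induction rule: uq_ideal.induct)
  case (rel r x y)
  then show ?case using uq_ideal.rel[of r "z * x" y] by (simp add: mult.assoc)
qed (auto simp: distrib_left intro: uq_ideal.intros)

lemma uq_ideal_rmult: "x \<in> uq_ideal \<Longrightarrow> x * z \<in> uq_ideal"
proof (induction rule: uq_ideal.induct)
  case (rel r x y)
  then show ?case using uq_ideal.rel[of r x "y * z"] by (simp add: mult.assoc)
qed (auto simp: distrib_right intro: uq_ideal.intros)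

lemma uq_ideal_uminus: "x \<in> uq_ideal \<Longrightarrow> - x \<in> uq_ideal"
  using uq_ideal_lmult[of x "- 1"] by simp

lemma uq_ideal_diff: "x \<in> uq_ideal \<Longrightarrow> y \<in> uq_ideal \<Longrightarrow> x - y \<in> uq_ideal"
  using uq_ideal.add[OF _ uq_ideal_uminus, of x y] by simp

definition uq_cong :: "('m::finite, 'n::finite) fa \<Rightarrow> ('m, 'n) fa \<Rightarrow> bool" where
  "uq_cong x y \<longleftrightarrow> x - y \<in> uq_ideal"

lemma uq_cong_equivp: "equivp (uq_cong :: ('m::finite, 'n::finite) fa \<Rightarrow> _)"
proof (rule equivpI)
  show "reflp (uq_cong :: ('m, 'n) fa \<Rightarrow> _)" by (rule reflpI) (simp add: uq_cong_def uq_ideal.zero)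
  show "symp (uq_cong :: ('m, 'n) fa \<Rightarrow> _)"
  proof (rule sympI)
    fix x y :: "('m, 'n) fa" assume "uq_cong x y"
    then show "uq_cong y x" using uq_ideal_uminus[of "x - y"] by (simp add: uq_cong_def)
  qed
  show "transp (uq_cong :: ('m, 'n) fa \<Rightarrow> _)"
  proof (rule transpI)
    fix x y z :: "('m, 'n) fa" assume "uq_cong x y" "uq_cong y z"
    then show "uq_cong x z" using uq_ideal.add[of "x - y" "y - z"] by (simp add: uq_cong_def)
  qed
qed

subsection \<open>The counit\<close>

definition counit_word :: "('m::finite, 'n::finite) gen list \<Rightarrow> Cq" where
  "counit_word w = (if \<forall>g\<in>set w. Rep_gen g \<in> range Kp \<union> range Km then 1 else 0)"

definition counit_fa :: "('m::finite, 'n::finite) fa \<Rightarrow> Cq" where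
  "counit_fa x = (\<Sum>w\<in>Poly_Mapping.keys x. Poly_Mapping.lookup x w * counit_word w)"

lemma counit_fa_superset:
  assumes "finite A" "Poly_Mapping.keys x \<subseteq> A"
  shows "counit_fa x = (\<Sum>w\<in>A. Poly_Mapping.lookup x w * counit_word w)"
  unfolding counit_fa_def
  by (rule sum.mono_neutral_left) (use assms in \<open>auto simp: in_keys_iff\<close>)

lemma counit_fa_add: "counit_fa (x + y) = counit_fa x + counit_fa y"
proof -
  let ?A = "Poly_Mapping.keys x \<union> Poly_Mapping.keys y"
  have "Poly_Mapping.keys (x + y) \<subseteq> ?A" by (rule Poly_Mapping.keys_add)
  then show ?thesis
    by (simp add: counit_fa_superset[of ?A] lookup_add distrib_right sum.distrib)
qed

lemma counit_fa_0 [simp]: "counit_fa 0 = 0"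
  by (simp add: counit_fa_def)

lemma counit_fa_uminus: "counit_fa (- x) = - counit_fa x"
  using counit_fa_add[of x "- x"] by (simp add: eq_neg_iff_add_eq_0 add.commute)

lemma counit_fa_diff: "counit_fa (x - y) = counit_fa x - counit_fa y"
  using counit_fa_add[of x "- y"] by (simp add: counit_fa_uminus)

lemma counit_fa_single: "counit_fa (Poly_Mapping.single w c) = c * counit_word w"
  by (cases "c = 0") (simp_all add: counit_fa_def)

lemma counit_word_append: "counit_word (u @ v) = counit_word u * counit_word v"
  by (auto simp: counit_word_def)

lemma fa_induct [case_names single add]:
  fixes x :: "('m::finite, 'n::finite) fa"
  assumes "\<And>w c. P (Poly_Mapping.single w c)" "\<And>x y. P x \<Longrightarrow> P y \<Longrightarrow> P (x + y)"
  shows "P x"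
proof (induction x rule: update_induct)
  case const
  then show ?case using assms(1)[of undefined 0] by simp
next
  case (update x w c)
  have "Poly_Mapping.update w c x = x + Poly_Mapping.single w c"
    using update by (intro poly_mapping_eqI)
      (auto simp: lookup_update lookup_add lookup_single when_def in_keys_iff)
  then show ?case using assms update by simp
qed

lemma counit_fa_mult: "counit_fa (x * y) = counit_fa x * counit_fa y"
proof (induction x rule: fa_induct)
  case (single w c)
  show ?case
  proof (induction y rule: fa_induct)
    case (single w' c')
    show ?case
      by (simp add: mult_single counit_fa_single plus_list_def counit_word_append)
  qed (simp add: distrib_left counit_fa_add)
qed (simp add: distrib_right counit_fa_add)

lemma counit_fa_1: "counit_fa 1 = 1"
  by (simp add: single_one[symmetric] counit_fa_single zero_list_def counit_word_def
      del: single_one)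

lemma counit_fa_fscal: "counit_fa (fscal c) = c"
  by (simp add: fscal_def counit_fa_single counit_word_def)

lemma counit_fa_up: "a \<in> idxJ CARD('m) CARD('n) \<Longrightarrow> counit_fa (fgen (Up a) :: ('m::finite, 'n::finite) fa) = 0"
  by (auto simp: fgen_def counit_fa_single counit_word_def Abs_gen_inverse)

lemma counit_fa_dn: "a \<in> idxJ CARD('m) CARD('n) \<Longrightarrow> counit_fa (fgen (Dn a) :: ('m::finite, 'n::finite) fa) = 0"
  by (auto simp: fgen_def counit_fa_single counit_word_def Abs_gen_inverse)

lemma counit_fa_K: "a \<in> idxI CARD('m) CARD('n) \<Longrightarrow> counit_fa (fgen (Kp a) :: ('m::finite, 'n::finite) fa) = 1"
  "a \<in> idxI CARD('m) CARD('n) \<Longrightarrow> counit_fa (fgen (Km a) :: ('m::finite, 'n::finite) fa) = 1"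
  by (auto simp: fgen_def counit_fa_single counit_word_def Abs_gen_inverse)

lemma CARD_idxJ: "CARD('m::finite) \<in> idxJ CARD('m) CARD('n::finite)"
proof -
  have "0 < CARD('m)" "0 < CARD('n)" by simp_all
  then show ?thesis by (simp only: atLeastAtMost_iff) linarith
qed

lemma counit_fa_rels: "r \<in> uq_rels \<Longrightarrow> counit_fa (r :: ('m::finite, 'n::finite) fa) = 0"
proof (induction rule: uq_rels.induct)
  case (up_dn a b)
  then have K: "a + 1 \<in> idxI CARD('m) CARD('n)" "a \<in> idxI CARD('m) CARD('n)" by auto
  let ?d = "fgen (Kp a) * fgen (Km (a + 1)) - fgen (Km a) * fgen (Kp (a + 1)) :: ('m, 'n) fa"
  have "counit_fa ?d = 0"
    by (simp only: counit_fa_diff counit_fa_mult counit_fa_K[OF K(1)] counit_fa_K[OF K(2)]) simp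
  moreover have "counit_fa (fgen (Up a) * fgen (Dn b) :: ('m, 'n) fa) = 0"
    "counit_fa (fgen (Dn b) * fgen (Up a) :: ('m, 'n) fa) = 0"
    by (simp_all only: counit_fa_mult counit_fa_up[OF up_dn(1)] mult_zero_left mult_zero_right)
  ultimately show ?case
    by (simp only: counit_fa_diff counit_fa_mult[of "fscal _"] ksign_def counit_fa_uminus split: if_split) simp
qed (use CARD_idxJ[where 'm = 'm and 'n = 'n] in
    \<open>auto simp: counit_fa_diff counit_fa_mult counit_fa_up counit_fa_dn counit_fa_K counit_fa_1
      counit_fa_add simp del: atLeastAtMost_iff\<close>)

lemma one_notin_uq_ideal: "(1 :: ('m::finite, 'n::finite) fa) \<notin> uq_ideal"
proof -
  have "counit_fa x = 0" if "x \<in> uq_ideal" for x :: "('m, 'n) fa"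
    using that by induction (simp_all add: counit_fa_add counit_fa_mult counit_fa_rels)
  from this[of 1] show ?thesis by (auto simp: counit_fa_1)
qed

subsection \<open>The quotient\<close>

quotient_type (overloaded) ('m, 'n) uq = "('m::finite, 'n::finite) fa" / uq_cong
  by (rule uq_cong_equivp)

instantiation uq :: (finite, finite) ring_1
begin

lift_definition zero_uq :: "('a, 'b) uq" is 0 .
lift_definition one_uq :: "('a, 'b) uq" is 1 .
lift_definition plus_uq :: "('a, 'b) uq \<Rightarrow> ('a, 'b) uq \<Rightarrow> ('a, 'b) uq" is "(+)"
  unfolding uq_cong_def by (metis add_diff_add uq_ideal.add)
lift_definition uminus_uq :: "('a, 'b) uq \<Rightarrow> ('a, 'b) uq" is uminus
  unfolding uq_cong_def by (metis minus_diff_minus uq_ideal_uminus)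
lift_definition minus_uq :: "('a, 'b) uq \<Rightarrow> ('a, 'b) uq \<Rightarrow> ('a, 'b) uq" is "(-)"
proof -
  fix x x' y y' :: "('a, 'b) fa"
  assume "uq_cong x x'" "uq_cong y y'"
  then show "uq_cong (x - y) (x' - y')"
    using uq_ideal_diff[of "x - x'" "y - y'"] by (simp add: uq_cong_def algebra_simps)
qed
lift_definition times_uq :: "('a, 'b) uq \<Rightarrow> ('a, 'b) uq \<Rightarrow> ('a, 'b) uq" is "(*)"
proof -
  fix x x' y y' :: "('a, 'b) fa"
  assume "uq_cong x x'" "uq_cong y y'"
  then have "(x - x') * y + x' * (y - y') \<in> uq_ideal"
    unfolding uq_cong_def by (intro uq_ideal.add uq_ideal_lmult uq_ideal_rmult)
  then show "uq_cong (x * y) (x' * y')"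
    by (simp add: uq_cong_def algebra_simps)
qed

instance
proof
  fix a b c :: "('a, 'b) uq"
  have eq: "uq_cong x y" if "x = y" for x y :: "('a, 'b) fa"
    using that by (simp add: uq_cong_def uq_ideal.zero)
  show "a * b * c = a * (b * c)" by transfer (rule eq, simp add: mult.assoc)
  show "1 * a = a" "a * 1 = a" by (transfer, rule eq, simp)+
  show "(a + b) * c = a * c + b * c" by transfer (rule eq, simp add: distrib_right)
  show "a * (b + c) = a * b + a * c" by transfer (rule eq, simp add: distrib_left)
  show "a + b + c = a + (b + c)" by transfer (rule eq, simp add: add.assoc)
  show "a + b = b + a" by transfer (rule eq, simp add: add.commute)
  show "0 + a = a" by transfer (rule eq, simp)
  show "- a + a = 0" by transfer (rule eq, simp)
  show "a - b = a + - b" by transfer (rule eq, simp)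
  show "(0 :: ('a, 'b) uq) \<noteq> 1"
    by transfer (use uq_ideal_uminus[of "- 1"] one_notin_uq_ideal in \<open>auto simp: uq_cong_def\<close>)
qed

end

definition uq_scale :: "Cq \<Rightarrow> ('m::finite, 'n::finite) uq \<Rightarrow> ('m, 'n) uq" where
  "uq_scale c x = abs_uq (fscal c) * x"

definition uq_gen :: "rawgen \<Rightarrow> ('m::finite, 'n::finite) uq" where
  "uq_gen g = abs_uq (fgen g)"

definition uq_word :: "('m::finite, 'n::finite) gen list \<Rightarrow> ('m, 'n) uq" where
  "uq_word w = abs_uq (Poly_Mapping.single w 1)"

definition uq_gr :: "bit \<Rightarrow> ('m::finite, 'n::finite) uq set" where
  "uq_gr s = {abs_uq x | x. \<forall>w\<in>Poly_Mapping.keys x. word_par w = s}"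

text \<open>
  The comultiplication of a word, as the list of its terms: \<open>(s, u, v)\<close> stands for
  \<open>(-1)\<^sup>s u \<otimes> v\<close>. It is multiplicative for the product
  \<open>(a \<otimes> b) (u \<otimes> v) = (-1)\<^bsup>[b][u]\<^esup> a u \<otimes> b v\<close>.
\<close>

definition coprod_gen :: "('m::finite, 'n::finite) gen \<Rightarrow> (('m, 'n) gen list \<times> ('m, 'n) gen list) list" where
  "coprod_gen g = (case Rep_gen g of
      Up a \<Rightarrow> [([g], [Abs_gen (Kp a), Abs_gen (Km (a + 1))]), ([], [g])]
    | Dn a \<Rightarrow> [([g], []), ([Abs_gen (Km a), Abs_gen (Kp (a + 1))], [g])]
    | Kp a \<Rightarrow> [([g], [g])]
    | Km a \<Rightarrow> [([g], [g])])"

fun coprod_word :: "('m::finite, 'n::finite) gen list \<Rightarrow> (bit \<times> ('m, 'n) gen list \<times> ('m, 'n) gen list) list" where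
  "coprod_word [] = [(0, [], [])]"
| "coprod_word (g # w) =
     [(word_par b * word_par u + s, a @ u, b @ v). (a, b) \<leftarrow> coprod_gen g, (s, u, v) \<leftarrow> coprod_word w]"

text \<open>
  The antipode is the two-sided convolution inverse of the identity. It is the super
  anti-automorphism that inverts every \<open>K\<^sub>b\<close> and, with \<open>k = K\<^sub>a K\<^sub>a\<^sub>+\<^sub>1\<^sup>-\<^sup>1\<close>, sends
  \<open>E\<^sub>a\<^sub>,\<^sub>a\<^sub>+\<^sub>1\<close> to \<open>- E\<^sub>a\<^sub>,\<^sub>a\<^sub>+\<^sub>1 k\<^sup>-\<^sup>1\<close> and \<open>E\<^sub>a\<^sub>+\<^sub>1\<^sub>,\<^sub>a\<close> to \<open>- k E\<^sub>a\<^sub>+\<^sub>1\<^sub>,\<^sub>a\<close>.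
\<close>

definition antipode :: "('m::finite, 'n::finite) uq \<Rightarrow> ('m, 'n) uq" where
  "antipode = (THE S. Vector_Spaces.linear uq_scale uq_scale S \<and>
     (\<forall>w. (\<Sum>(s, u, v)\<leftarrow>coprod_word w. ksign s (S (uq_word u) * uq_word v)) =
            uq_scale (counit_word w) 1 \<and>
          (\<Sum>(s, u, v)\<leftarrow>coprod_word w. ksign s (uq_word u * S (uq_word v))) =
            uq_scale (counit_word w) 1))"

section \<open>Quantum sub-superalgebras\<close>

inductive_set uq_sub :: "nat set \<Rightarrow> nat set \<Rightarrow> ('m::finite, 'n::finite) uq set"
  for \<Theta>p \<Theta>m :: "nat set" where
  one: "1 \<in> uq_sub \<Theta>p \<Theta>m"
| Kp: "b \<in> idxI CARD('m) CARD('n) \<Longrightarrow> uq_gen (Kp b) \<in> uq_sub \<Theta>p \<Theta>m"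
| Km: "b \<in> idxI CARD('m) CARD('n) \<Longrightarrow> uq_gen (Km b) \<in> uq_sub \<Theta>p \<Theta>m"
| Up: "a \<in> \<Theta>p \<Longrightarrow> uq_gen (Up a) \<in> uq_sub \<Theta>p \<Theta>m"
| Dn: "a \<in> \<Theta>m \<Longrightarrow> uq_gen (Dn a) \<in> uq_sub \<Theta>p \<Theta>m"
| add: "x \<in> uq_sub \<Theta>p \<Theta>m \<Longrightarrow> y \<in> uq_sub \<Theta>p \<Theta>m \<Longrightarrow> x + y \<in> uq_sub \<Theta>p \<Theta>m"
| mult: "x \<in> uq_sub \<Theta>p \<Theta>m \<Longrightarrow> y \<in> uq_sub \<Theta>p \<Theta>m \<Longrightarrow> x * y \<in> uq_sub \<Theta>p \<Theta>m"
| scale: "x \<in> uq_sub \<Theta>p \<Theta>m \<Longrightarrow> uq_scale c x \<in> uq_sub \<Theta>p \<Theta>m"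

definition reductive :: "('m::finite, 'n::finite) uq set \<Rightarrow> bool" where
  "reductive L \<longleftrightarrow> (\<exists>\<Theta> \<subseteq> idxJ CARD('m) CARD('n). L = uq_sub \<Theta> \<Theta>)"

definition parabolic_levi :: "('m::finite, 'n::finite) uq set \<Rightarrow> ('m, 'n) uq set \<Rightarrow> bool" where
  "parabolic_levi P L \<longleftrightarrow>
     (\<exists>\<Theta>p \<Theta>m. \<Theta>p \<subseteq> idxJ CARD('m) CARD('n) \<and> \<Theta>m \<subseteq> idxJ CARD('m) CARD('n) \<and>
        (\<Theta>p = idxJ CARD('m) CARD('n) \<or> \<Theta>m = idxJ CARD('m) CARD('n)) \<and>
        P = uq_sub \<Theta>p \<Theta>m \<and> L = uq_sub (\<Theta>p \<inter> \<Theta>m) (\<Theta>p \<inter> \<Theta>m))"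

definition uq_bbar :: "('m::finite, 'n::finite) uq set" where
  "uq_bbar = uq_sub {} (idxJ CARD('m) CARD('n))"

section \<open>Graded modules\<close>

text \<open>
  A module lives on a subspace \<open>mcarrier\<close> of an ambient vector space. For a module over a
  sub-superalgebra \<open>R\<close>, only the values \<open>mact M x v\<close> with \<open>x \<in> R\<close>, \<open>v \<in> mcarrier M\<close> are meaningful.
\<close>

record ('m, 'n, 'v) smod =
  mcarrier :: "'v set"
  mgrade :: "bit \<Rightarrow> 'v set"
  mscale :: "Cq \<Rightarrow> 'v \<Rightarrow> 'v"
  mact :: "('m, 'n) uq \<Rightarrow> 'v \<Rightarrow> 'v"

definition hcomp :: "(bit \<Rightarrow> 'v::ab_group_add set) \<Rightarrow> bit \<Rightarrow> 'v \<Rightarrow> 'v" where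
  "hcomp G s v = (THE u. u \<in> G s \<and> v - u \<in> G (s + 1))"

definition lin_on :: "'v::ab_group_add set \<Rightarrow> (Cq \<Rightarrow> 'v \<Rightarrow> 'v) \<Rightarrow> (Cq \<Rightarrow> 'w::ab_group_add \<Rightarrow> 'w) \<Rightarrow> ('v \<Rightarrow> 'w) \<Rightarrow> bool" where
  "lin_on V s1 s2 f \<longleftrightarrow>
     (\<forall>u\<in>V. \<forall>v\<in>V. f (u + v) = f u + f v) \<and> (\<forall>c. \<forall>v\<in>V. f (s1 c v) = s2 c (f v))"

definition super_module :: "('m::finite, 'n::finite) uq set \<Rightarrow> ('m, 'n, 'v::ab_group_add) smod \<Rightarrow> bool" where
  "super_module R M \<longleftrightarrow>
     vector_space (mscale M) \<and>
     (\<forall>s. module.subspace (mscale M) (mgrade M s)) \<and>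
     mgrade M 0 \<inter> mgrade M 1 = {0} \<and>
     mcarrier M = {u + v | u v. u \<in> mgrade M 0 \<and> v \<in> mgrade M 1} \<and>
     (\<forall>x\<in>R. mact M x ` mcarrier M \<subseteq> mcarrier M) \<and>
     (\<forall>x\<in>R. lin_on (mcarrier M) (mscale M) (mscale M) (mact M x)) \<and>
     (\<forall>v\<in>mcarrier M. lin_on R uq_scale (mscale M) (\<lambda>x. mact M x v)) \<and>
     (\<forall>v\<in>mcarrier M. mact M 1 v = v) \<and>
     (\<forall>x\<in>R. \<forall>y\<in>R. \<forall>v\<in>mcarrier M. mact M (x * y) v = mact M x (mact M y v)) \<and>
     (\<forall>s t. \<forall>x\<in>R \<inter> uq_gr s. \<forall>v\<in>mgrade M t. mact M x v \<in> mgrade M (s + t))"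

definition weight_vector :: "('m::finite, 'n::finite, 'v::ab_group_add) smod \<Rightarrow> (nat \<Rightarrow> int) \<Rightarrow> 'v \<Rightarrow> bool" where
  "weight_vector M \<mu> v \<longleftrightarrow> v \<in> mcarrier M \<and>
     (\<forall>a\<in>idxI CARD('m) CARD('n).
        mact M (uq_gen (Kp a)) v = mscale M (qq powi wform CARD('m) CARD('n) \<mu> (eps a)) v)"

definition fin_spanned :: "(Cq \<Rightarrow> 'v::ab_group_add \<Rightarrow> 'v) \<Rightarrow> 'v set \<Rightarrow> bool" where
  "fin_spanned scl V \<longleftrightarrow> (\<exists>B. finite B \<and> V \<subseteq> module.span scl B)"

text \<open>Objects and morphisms of \<open>\<C>(\<rr>, \<kk>)\<close>; the arguments are \<open>R = U\<^sub>q(\<rr>)\<close> and \<open>K = U\<^sub>q(\<kk>)\<close>.\<close>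

definition cat_obj :: "('m::finite, 'n::finite) uq set \<Rightarrow> ('m, 'n) uq set \<Rightarrow> ('m, 'n, 'v::ab_group_add) smod \<Rightarrow> bool" where
  "cat_obj R K M \<longleftrightarrow> super_module R M \<and>
     mcarrier M \<subseteq> module.span (mscale M)
       {v. (\<exists>\<mu>. weight_vector M \<mu> v) \<and> fin_spanned (mscale M) ((\<lambda>x. mact M x v) ` K)}"

definition cat_mor ::
  "('m::finite, 'n::finite) uq set \<Rightarrow> ('m, 'n, 'v::ab_group_add) smod \<Rightarrow> ('m, 'n, 'w::ab_group_add) smod \<Rightarrow> ('v \<Rightarrow> 'w) \<Rightarrow> bool" where
  "cat_mor R M N \<phi> \<longleftrightarrow>
     lin_on (mcarrier M) (mscale M) (mscale N) \<phi> \<and>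
     (\<forall>s. \<phi> ` mgrade M s \<subseteq> mgrade N s) \<and>
     (\<forall>x\<in>R. \<forall>v\<in>mcarrier M. \<phi> (mact M x v) = mact N x (\<phi> v))"

section \<open>The induction functor\<close>

text \<open>
  In \<open>ind_obj\<close>, the \<open>U\<^sub>q(\<gg>)\<close>-finite graded submodules are those that are objects of \<open>\<C>(\<gg>, \<gg>)\<close>.
  Actions and morphism maps are made undefined off the carrier by \<^const>\<open>restrict\<close>, so that
  equality of objects and of morphisms is plain equality.
\<close>

definition fscale :: "(Cq \<Rightarrow> 'v \<Rightarrow> 'v) \<Rightarrow> Cq \<Rightarrow> ('u \<Rightarrow> 'v) \<Rightarrow> 'u \<Rightarrow> 'v" where
  "fscale scl c \<zeta> = (\<lambda>x. scl c (\<zeta> x))"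

definition hom_gr ::
  "('m::finite, 'n::finite) uq set \<Rightarrow> ('m, 'n, 'v::ab_group_add) smod \<Rightarrow> bit \<Rightarrow> (('m, 'n) uq \<Rightarrow> 'v) set" where
  "hom_gr P V r = {\<zeta>. lin_on UNIV uq_scale (mscale V) \<zeta> \<and>
     (\<forall>s. \<zeta> ` uq_gr s \<subseteq> mgrade V (s + r)) \<and>
     (\<forall>s. \<forall>x\<in>P \<inter> uq_gr s. \<forall>y. \<zeta> (x * y) = ksign (s * r) (mact V x (\<zeta> y)))}"

definition hom_mod ::
  "('m::finite, 'n::finite) uq set \<Rightarrow> ('m, 'n, 'v::ab_group_add) smod \<Rightarrow> ('m, 'n, ('m, 'n) uq \<Rightarrow> 'v) smod" where
  "hom_mod P V = \<lparr>
     mcarrier = {\<zeta> + \<eta> | \<zeta> \<eta>. \<zeta> \<in> hom_gr P V 0 \<and> \<eta> \<in> hom_gr P V 1},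
     mgrade = hom_gr P V,
     mscale = fscale (mscale V),
     mact = (\<lambda>y \<zeta> x. \<Sum>s\<in>{0, 1}. \<Sum>t\<in>{0, 1}. \<Sum>r\<in>{0, 1}.
        ksign (s * (t + r)) (hcomp (hom_gr P V) r \<zeta> (hcomp uq_gr t x * hcomp uq_gr s y))) \<rparr>"

definition restrict_mod :: "('m, 'n, 'v) smod \<Rightarrow> 'v set \<Rightarrow> ('m, 'n, 'v) smod" where
  "restrict_mod M N = \<lparr> mcarrier = N, mgrade = (\<lambda>s. N \<inter> mgrade M s), mscale = mscale M,
     mact = (\<lambda>x. restrict (mact M x) N) \<rparr>"

definition ind_obj ::
  "('m::finite, 'n::finite) uq set \<Rightarrow> ('m, 'n, 'v::ab_group_add) smod \<Rightarrow> ('m, 'n, ('m, 'n) uq \<Rightarrow> 'v) smod" where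
  "ind_obj P V = restrict_mod (hom_mod P V)
     (module.span (mscale (hom_mod P V))
        (\<Union> {N. N \<subseteq> mcarrier (hom_mod P V) \<and> cat_obj UNIV UNIV (restrict_mod (hom_mod P V) N)}))"

definition ind_mor ::
  "('m::finite, 'n::finite) uq set \<Rightarrow> ('m, 'n, 'v::ab_group_add) smod \<Rightarrow> ('v \<Rightarrow> 'w) \<Rightarrow>
   (('m, 'n) uq \<Rightarrow> 'v) \<Rightarrow> (('m, 'n) uq \<Rightarrow> 'w)" where
  "ind_mor P V \<phi> = (\<lambda>\<zeta>\<in>mcarrier (ind_obj P V). \<phi> \<circ> \<zeta>)"

section \<open>The functor \<open>\<Gamma>\<close>\<close>

text \<open>
  Every finite dimensional \<open>\<complex>(q)\<close>-vector space is isomorphic to a subspace of the space of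
  finitely supported sequences, so that it is enough to let \<open>M\<close> range over modules there.
\<close>

definition coord_alg :: "(('m::finite, 'n::finite) uq \<Rightarrow> Cq) set" where
  "coord_alg = module.span (fscale (*))
     {\<lambda>x. g (mact M x v) | (M :: ('m, 'n, nat \<Rightarrow>\<^sub>0 Cq) smod) g v.
        cat_obj UNIV UNIV M \<and> fin_spanned (mscale M) (mcarrier M) \<and>
        v \<in> mcarrier M \<and> lin_on (mcarrier M) (mscale M) (*) g}"

definition dual_gr :: "bit \<Rightarrow> (('m::finite, 'n::finite) uq \<Rightarrow> Cq) set" where
  "dual_gr r = {f. lin_on UNIV uq_scale (*) f \<and> (\<forall>x\<in>uq_gr (r + 1). f x = 0)}"

definition dL :: "('m::finite, 'n::finite) uq \<Rightarrow> (('m, 'n) uq \<Rightarrow> Cq) \<Rightarrow> ('m, 'n) uq \<Rightarrow> Cq" where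
  "dL x f = (\<lambda>y. \<Sum>s\<in>{0, 1}. \<Sum>r\<in>{0, 1}.
     ksign (s * r) (hcomp dual_gr r f (antipode (hcomp uq_gr s x) * y)))"

definition dR :: "('m::finite, 'n::finite) uq \<Rightarrow> (('m, 'n) uq \<Rightarrow> Cq) \<Rightarrow> ('m, 'n) uq \<Rightarrow> Cq" where
  "dR x f = (\<lambda>y. \<Sum>s\<in>{0, 1}. ksign s (f (y * hcomp uq_gr s x)))"

text \<open>
  \<open>\<Xi> \<otimes> \<A>(\<gg>)\<close> is realised in the space of linear maps \<open>U\<^sub>q(\<gg>) \<rightarrow> \<Xi>\<close>, with
  \<open>pure_tensor scl \<xi> f\<close> as \<open>\<xi> \<otimes> f\<close>.
\<close>

definition pure_tensor :: "(Cq \<Rightarrow> 'v \<Rightarrow> 'v) \<Rightarrow> 'v \<Rightarrow> ('u \<Rightarrow> Cq) \<Rightarrow> 'u \<Rightarrow> 'v" where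
  "pure_tensor scl \<xi> f = (\<lambda>x. scl (f x) \<xi>)"

definition tensor_gr :: "('m::finite, 'n::finite, 'v::ab_group_add) smod \<Rightarrow> bit \<Rightarrow> (('m, 'n) uq \<Rightarrow> 'v) set" where
  "tensor_gr V r = module.span (fscale (mscale V))
     {pure_tensor (mscale V) \<xi> f | \<xi> f s t.
        \<xi> \<in> mgrade V s \<and> f \<in> coord_alg \<inter> dual_gr t \<and> s + t = r}"

definition tensor_space :: "('m::finite, 'n::finite, 'v::ab_group_add) smod \<Rightarrow> (('m, 'n) uq \<Rightarrow> 'v) set" where
  "tensor_space V = module.span (fscale (mscale V))
     {pure_tensor (mscale V) \<xi> f | \<xi> f. \<xi> \<in> mcarrier V \<and> f \<in> coord_alg}"

text \<open>
  \<open>tensor_map V W \<phi> d T\<close> is \<open>\<phi> \<otimes> T\<close> for an even linear map \<open>\<phi> : V \<rightarrow> W\<close> and a linear map \<open>T\<close> of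
  parity \<open>d\<close>, that is \<open>\<xi> \<otimes> f \<mapsto> (-1)\<^bsup>d [\<xi>]\<^esup> \<phi>(\<xi>) \<otimes> T(f)\<close>, evaluated through any expansion of
  the argument into pure tensors with homogeneous left factor. The sign-free \<open>S(x) \<otimes> id\<close> is
  the case \<open>d = 0\<close>, where the parity of \<open>\<phi>\<close> does not matter.
\<close>

definition tensor_map ::
  "('m::finite, 'n::finite, 'v::ab_group_add) smod \<Rightarrow> ('m, 'n, 'w::ab_group_add) smod \<Rightarrow> ('v \<Rightarrow> 'w) \<Rightarrow>
   bit \<Rightarrow> ((('m, 'n) uq \<Rightarrow> Cq) \<Rightarrow> (('m, 'n) uq \<Rightarrow> Cq)) \<Rightarrow> (('m, 'n) uq \<Rightarrow> 'v) \<Rightarrow> (('m, 'n) uq \<Rightarrow> 'w)" where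
  "tensor_map V W \<phi> d T \<zeta> = (THE \<eta>. \<exists>ts.
     (\<forall>(s, \<xi>, f)\<in>set ts. \<xi> \<in> mgrade V s \<and> f \<in> coord_alg) \<and>
     \<zeta> = (\<Sum>(s, \<xi>, f)\<leftarrow>ts. pure_tensor (mscale V) \<xi> f) \<and>
     \<eta> = (\<Sum>(s, \<xi>, f)\<leftarrow>ts. ksign (d * s) (pure_tensor (mscale W) (\<phi> \<xi>) (T f))))"

definition id_dL :: "('m::finite, 'n::finite, 'v::ab_group_add) smod \<Rightarrow> ('m, 'n) uq \<Rightarrow> (('m, 'n) uq \<Rightarrow> 'v) \<Rightarrow> (('m, 'n) uq \<Rightarrow> 'v)" where
  "id_dL V x \<zeta> = (\<Sum>s\<in>{0, 1}. tensor_map V V id s (dL (hcomp uq_gr s x)) \<zeta>)"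

definition id_dR :: "('m::finite, 'n::finite, 'v::ab_group_add) smod \<Rightarrow> ('m, 'n) uq \<Rightarrow> (('m, 'n) uq \<Rightarrow> 'v) \<Rightarrow> (('m, 'n) uq \<Rightarrow> 'v)" where
  "id_dR V x \<zeta> = (\<Sum>s\<in>{0, 1}. tensor_map V V id s (dR (hcomp uq_gr s x)) \<zeta>)"

definition gamma_obj ::
  "('m::finite, 'n::finite) uq set \<Rightarrow> ('m, 'n, 'v::ab_group_add) smod \<Rightarrow> ('m, 'n, ('m, 'n) uq \<Rightarrow> 'v) smod" where
  "gamma_obj P V = restrict_mod
     \<lparr> mcarrier = tensor_space V, mgrade = tensor_gr V, mscale = fscale (mscale V), mact = id_dR V \<rparr>
     {\<zeta> \<in> tensor_space V. \<forall>x\<in>P. id_dL V x \<zeta> = tensor_map V V (mact V (antipode x)) 0 id \<zeta>}"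

definition gamma_mor ::
  "('m::finite, 'n::finite) uq set \<Rightarrow> ('m, 'n, 'v::ab_group_add) smod \<Rightarrow> ('m, 'n, 'w::ab_group_add) smod \<Rightarrow>
   ('v \<Rightarrow> 'w) \<Rightarrow> (('m, 'n) uq \<Rightarrow> 'v) \<Rightarrow> (('m, 'n) uq \<Rightarrow> 'w)" where
  "gamma_mor P V W \<phi> = (\<lambda>\<zeta>\<in>mcarrier (gamma_obj P V). tensor_map V W \<phi> 0 id \<zeta>)"

end

theory Submission
  imports Defs
begin

text \<open>
  Since the antipode maps \<open>U\<^sub>q(\<pp>)\<close> onto itself, the defining condition
  \<open>S(x) \<zeta>(y) = (-1)\<^bsup>[x][\<zeta>]\<^esup> \<zeta>(S(x) y)\<close> of \<open>\<Gamma>(\<Xi>)\<close> says that \<open>\<zeta>\<close> is a \<open>U\<^sub>q(\<pp>)\<close>-homomorphism.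
  Hence \<open>\<Gamma>(\<Xi>)\<close> is the intersection of \<open>Hom(U\<^sub>q(\<gg>), \<Xi>)\<close> over \<open>U\<^sub>q(\<pp>)\<close> with \<open>\<Xi> \<otimes> \<A>(\<gg>)\<close>, and both actions
  are right translation up to the same sign. A tensor generates a finite dimensional weight module,
  because matrix elements do. Conversely, if \<open>\<zeta>\<close> generates a finite dimensional weight module with
  basis \<open>b\<^sub>i\<close>, write \<open>x \<zeta> = \<Sum>\<^sub>i c\<^sub>i(x) b\<^sub>i\<close> with matrix elements \<open>c\<^sub>i\<close>; evaluation at \<open>1\<close> gives
  \<open>\<zeta>(x) = \<plusminus> \<Sum>\<^sub>i c\<^sub>i(x) b\<^sub>i(1)\<close>, a tensor.

  The antipode is constructed on words as a super anti-homomorphism. It respects the relations because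
  moving all Cartan factors of a monomial to the right produces a scalar that does not depend on the
  order of the root generators.
\<close>

section \<open>Signs and scalars\<close>

text \<open>\<open>antipode\<close>, \<open>hcomp\<close> and \<open>tensor_map\<close> are definite
  descriptions, opaque until existence and uniqueness of their values are proved. For
  \<open>antipode\<close> this means checking every defining relation, for \<open>tensor_map\<close>
  finding a formula that mentions no expansion into pure tensors. The obstacle there is that signs
  depend on parities of tensor factors, which a linear map does not display. The way out: for a pure
  tensor the degree of the left factor is the degree of the values, and the parity of the functional
  is the parity of the arguments on which it does not vanish. So every sign becomes a twist of
  values or of arguments.

  The finiteness conditions become a condition of position: a graded submodule is admissible if and
  only if it lies in one fixed space, the span of the finite weight vectors \<open>WF\<close>. This
  rests on the separation of weights, and it makes the condition pass to smaller submodules, in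
  particular to cyclic ones. Since \<open>coord_alg\<close> is spanned by matrix elements of modules
  of sequences only, modules of linear maps are transported there by coordinates.\<close>

lemma bit_sum: "(\<Sum>s\<in>{0, 1::bit}. f s) = f 0 + f 1"
  by simp

lemma bit_double [simp]: "(s::bit) + s = 0"
  by (cases s) auto

lemma bit_double_left [simp]: "(s::bit) + (s + t) = t"
  by (metis add.assoc add.left_neutral bit_double)

lemma bit_neq_iff: "(s::bit) \<noteq> t \<longleftrightarrow> s = t + 1"
  by (cases s; cases t) auto

text \<open>These default rules turn sign exponents into Boolean case distinctions.\<close>

declare add_bit_eq_xor [simp del] mult_bit_eq_and [simp del]

lemma ksign_0 [simp]: "ksign 0 v = v" "ksign s 0 = 0"
  by (auto simp: ksign_def)

lemma ksign_1 [simp]: "ksign 1 v = - v"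
  by (auto simp: ksign_def)

lemma ksign_add: "ksign s (u + v) = ksign s u + ksign s v"
  by (auto simp: ksign_def)

lemma ksign_ksign: "ksign s (ksign t v) = ksign (s + t) v"
  by (cases s; cases t) auto

lemma ksign_sum: "ksign s (sum f A) = (\<Sum>x\<in>A. ksign s (f x))"
  by (auto simp: ksign_def sum_negf)

lemma ksign_mult_left: "ksign s u * v = ksign s (u * v)"
  for u v :: "'a::ring"
  by (auto simp: ksign_def)

lemma ksign_mult_right: "u * ksign s v = ksign s (u * v)"
  for u v :: "'a::ring"
  by (auto simp: ksign_def)

lemma qq_nonzero [simp]: "qq \<noteq> 0"
  by (simp add: qq_def Zero_fract_def eq_fract)

lemma fscal_1 [simp]: "fscal 1 = 1"
  by (simp add: fscal_def zero_list_def[symmetric])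

lemma fscal_mult_single: "fscal c * Poly_Mapping.single w d = Poly_Mapping.single w (c * d)"
  "Poly_Mapping.single w d * fscal c = Poly_Mapping.single w (c * d)"
  by (simp_all add: fscal_def mult_single plus_list_def mult.commute)

lemma fscal_central: "x * fscal c = fscal c * x"
  by (induction x rule: fa_induct) (simp_all add: fscal_mult_single distrib_left distrib_right)

lemma fscal_mult: "fscal c * fscal d = fscal (c * d)"
  by (simp add: fscal_def mult_single plus_list_def)

lemma fscal_add: "fscal (c + d) = fscal c + fscal d"
  by (simp add: fscal_def single_add)

lemma abs_uq_hom:
  "abs_uq (x + y) = abs_uq x + abs_uq y" "abs_uq (x - y) = abs_uq x - abs_uq y"
  "abs_uq (- x) = - abs_uq x" "abs_uq (x * y) = abs_uq x * abs_uq y"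
  "abs_uq 0 = 0" "abs_uq 1 = 1"
  by (simp_all add: plus_uq.abs_eq minus_uq.abs_eq uminus_uq.abs_eq times_uq.abs_eq
      zero_uq_def one_uq_def)

lemma abs_uq_ksign: "abs_uq (ksign s x) = ksign s (abs_uq x)"
  by (simp add: ksign_def abs_uq_hom)

lemma abs_uq_ideal: "abs_uq x = 0 \<longleftrightarrow> x \<in> uq_ideal"
  by (simp add: zero_uq_def uq.abs_eq_iff uq_cong_def)

lemma abs_uq_rel: "r \<in> uq_rels \<Longrightarrow> abs_uq r = 0"
  using uq_ideal.rel[of r 1 1] by (simp add: abs_uq_ideal)

lemma uq_scale_abs: "uq_scale c (abs_uq x) = abs_uq (fscal c * x)"
  by (simp add: uq_scale_def abs_uq_hom)

lemma uq_scale_mult_left [simp]: "uq_scale c x * y = uq_scale c (x * y)"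
  by (simp add: uq_scale_def mult.assoc)

lemma uq_scale_mult_right [simp]: "x * uq_scale c y = uq_scale c (x * y)"
proof -
  obtain a where a: "x = abs_uq a" by (metis Quotient_uq Quotient_abs_rep)
  have "x * abs_uq (fscal c) = abs_uq (fscal c) * x"
    by (simp add: a abs_uq_hom[symmetric] fscal_central)
  then show ?thesis by (simp add: uq_scale_def mult.assoc[symmetric])
qed

lemma vector_space_uq: "vector_space uq_scale"
  by unfold_locales
    (simp_all add: uq_scale_def distrib_left distrib_right fscal_add abs_uq_hom
      mult.assoc[symmetric] fscal_mult[symmetric])

interpretation uq: vector_space uq_scale
  by (rule vector_space_uq)

lemma uq_word_append: "uq_word (u @ v) = uq_word u * uq_word v"
  by (simp add: uq_word_def abs_uq_hom[symmetric] mult_single plus_list_def)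

lemma uq_word_Nil [simp]: "uq_word [] = 1"
  by (simp add: uq_word_def zero_list_def[symmetric] abs_uq_hom)

lemma uq_word_single: "uq_word [g] = uq_gen (Rep_gen g)"
  by (simp add: uq_word_def uq_gen_def fgen_def Rep_gen_inverse)

lemma uq_word_Cons: "uq_word (g # w) = uq_gen (Rep_gen g) * uq_word w"
  using uq_word_append[of "[g]" w] by (simp add: uq_word_single)

lemma uq_scale_word: "uq_scale c (uq_word w) = abs_uq (Poly_Mapping.single w c)"
  by (simp add: uq_word_def uq_scale_abs fscal_mult_single)

lemma uq_exh: obtains a where "x = abs_uq a"
  by (metis Quotient_uq Quotient_abs_rep)

lemma uq_induct [case_names word add]:
  assumes "\<And>w c. P (uq_scale c (uq_word w))" "\<And>x y. P x \<Longrightarrow> P y \<Longrightarrow> P (x + y)"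
  shows "P x"
proof -
  obtain a where x: "x = abs_uq a" by (rule uq_exh)
  show ?thesis unfolding x
    by (induction a rule: fa_induct) (use assms in \<open>simp_all add: uq_scale_word abs_uq_hom\<close>)
qed

text \<open>The carrier of the type \<open>gen\<close> as a named set: \<open>Abs_gen\<close>, and
  with it \<open>fgen\<close> and \<open>uq_gen\<close>, is meaningful only there, so membership has
  to be tracked.\<close>

definition valid :: "nat \<Rightarrow> nat \<Rightarrow> rawgen set" where
  "valid m n = Up ` idxJ m n \<union> Dn ` idxJ m n \<union> Kp ` idxI m n \<union> Km ` idxI m n"

lemma Rep_gen_valid: "Rep_gen (g :: ('m::finite, 'n::finite) gen) \<in> valid CARD('m) CARD('n)"
  using Rep_gen[of g] by (simp only: valid_def)

lemma Rep_Abs_gen: "g \<in> valid CARD('m) CARD('n) \<Longrightarrow>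
    Rep_gen (Abs_gen g :: ('m::finite, 'n::finite) gen) = g"
  by (rule Abs_gen_inverse) (simp only: valid_def)

lemma valid_iff [simp]:
  "Up a \<in> valid m n \<longleftrightarrow> a \<in> idxJ m n" "Dn a \<in> valid m n \<longleftrightarrow> a \<in> idxJ m n"
  "Kp a \<in> valid m n \<longleftrightarrow> a \<in> idxI m n" "Km a \<in> valid m n \<longleftrightarrow> a \<in> idxI m n"
  by (auto simp: valid_def)

section \<open>Parity\<close>

definition fa_gr :: "bit \<Rightarrow> ('m::finite, 'n::finite) fa set" where
  "fa_gr s = {x. \<forall>w\<in>Poly_Mapping.keys x. word_par w = s}"

lemma word_par_simps [simp]: "word_par [] = 0" "word_par (g # w) = gen_par g + word_par w"
  "word_par (u @ v) = word_par u + word_par v"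
  by (simp_all add: word_par_def)

lemma fa_gr_single: "word_par w = s \<Longrightarrow> Poly_Mapping.single w c \<in> fa_gr s"
  by (simp add: fa_gr_def)

lemma fa_gr_0: "0 \<in> fa_gr s"
  by (simp add: fa_gr_def)

lemma fa_gr_1: "1 \<in> fa_gr 0"
  unfolding single_one[symmetric] zero_list_def by (rule fa_gr_single) simp

lemma fa_gr_fscal: "fscal c \<in> fa_gr 0"
  by (simp add: fscal_def fa_gr_single)

lemma fa_gr_add: "x \<in> fa_gr s \<Longrightarrow> y \<in> fa_gr s \<Longrightarrow> x + y \<in> fa_gr s"
  using Poly_Mapping.keys_add[of x y] by (auto simp: fa_gr_def)

lemma fa_gr_uminus: "x \<in> fa_gr s \<Longrightarrow> - x \<in> fa_gr s"
  by (simp add: fa_gr_def)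

lemma fa_gr_diff: "x \<in> fa_gr s \<Longrightarrow> y \<in> fa_gr s \<Longrightarrow> x - y \<in> fa_gr s"
  using fa_gr_add[OF _ fa_gr_uminus, of x s y] by simp

lemma fa_gr_mult: "x \<in> fa_gr s \<Longrightarrow> y \<in> fa_gr t \<Longrightarrow> s + t = r \<Longrightarrow> x * y \<in> fa_gr r"
  using keys_mult[of x y] by (fastforce simp: fa_gr_def plus_list_def)

lemma fa_gr_ksign: "x \<in> fa_gr s \<Longrightarrow> ksign t x \<in> fa_gr s"
  by (simp add: ksign_def fa_gr_uminus)

text \<open>Parity before \<open>Abs_gen\<close> is applied: the relations are written with raw
  generators, whereas words consist of elements of \<open>gen\<close>.\<close>

definition rpar :: "nat \<Rightarrow> rawgen \<Rightarrow> bit" where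
  "rpar m g = (if g \<in> {Up m, Dn m} then 1 else 0)"

lemma gen_par_rpar: "gen_par (g :: ('m::finite, 'n::finite) gen) = rpar CARD('m) (Rep_gen g)"
  by (simp add: gen_par_def rpar_def)

lemma gen_par_Abs: "g \<in> valid CARD('m) CARD('n) \<Longrightarrow>
    gen_par (Abs_gen g :: ('m::finite, 'n::finite) gen) = rpar CARD('m) g"
  by (simp add: gen_par_rpar Rep_Abs_gen)

lemma fa_gr_fgen: "g \<in> valid CARD('m) CARD('n) \<Longrightarrow> rpar CARD('m) g = s \<Longrightarrow>
    (fgen g :: ('m::finite, 'n::finite) fa) \<in> fa_gr s"
  by (simp add: fgen_def gen_par_Abs fa_gr_single)

text \<open>A sign in an induction may depend on the parity only if all partial sums share it;
  adding the monomials of the support one at a time keeps them in \<open>fa_gr s\<close>.\<close>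

lemma fa_gr_induct [consumes 1, case_names single add]:
  fixes x :: "('m::finite, 'n::finite) fa"
  assumes "x \<in> fa_gr s"
    and "\<And>w c. word_par w = s \<Longrightarrow> P (Poly_Mapping.single w c)"
    and "\<And>x y. x \<in> fa_gr s \<Longrightarrow> y \<in> fa_gr s \<Longrightarrow> P x \<Longrightarrow> P y \<Longrightarrow> P (x + y)"
    and "P 0"
  shows "P x"
  using assms(1)
proof (induction x rule: update_induct)
  case const
  then show ?case using assms(4) by simp
next
  case (update x w c)
  have eq: "Poly_Mapping.update w c x = x + Poly_Mapping.single w c"
    using update by (intro poly_mapping_eqI)
      (auto simp: lookup_update lookup_add lookup_single when_def in_keys_iff)
  have k: "Poly_Mapping.keys (Poly_Mapping.update w c x) = insert w (Poly_Mapping.keys x)"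
    using update by (simp add: keys_update)
  have "word_par w = s" "x \<in> fa_gr s" using update.prems by (simp_all add: fa_gr_def k)
  then show ?case unfolding eq using assms(2,3) update fa_gr_single[of w s c] by blast
qed

lemma fa_gr_split: "\<exists>u v. x = u + v \<and> u \<in> fa_gr 0 \<and> v \<in> fa_gr 1"
proof (induction x rule: fa_induct)
  case (single w c)
  show ?case
  proof (cases "word_par w = 0")
    case True
    then show ?thesis using fa_gr_single[of w 0 c] fa_gr_0[of 1]
      by (intro exI[of _ "Poly_Mapping.single w c"] exI[of _ 0]) simp
  next
    case False
    then have "word_par w = 1" by simp
    then show ?thesis using fa_gr_single[of w 1 c] fa_gr_0[of 0]
      by (intro exI[of _ 0] exI[of _ "Poly_Mapping.single w c"]) simp
  qed
next
  case (add x y)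
  then obtain u v u' v' where "x = u + v" "u \<in> fa_gr 0" "v \<in> fa_gr 1"
    "y = u' + v'" "u' \<in> fa_gr 0" "v' \<in> fa_gr 1" by blast
  then show ?case
    by (intro exI[of _ "u + u'"] exI[of _ "v + v'"]) (simp add: fa_gr_add)
qed

lemma root_up_gr:
  assumes "a \<ge> 1" "a + d \<le> CARD('m) + CARD('n) - 1"
  shows "(root_up a d :: ('m::finite, 'n::finite) fa) \<in> fa_gr (\<Sum>i\<le>d. rpar CARD('m) (Up (a + i)))"
  using assms(2)
proof (induction d)
  case 0
  then show ?case using assms(1) by (auto intro!: fa_gr_fgen)
next
  case (Suc d)
  then have "(fgen (Up (a + d + 1)) :: ('m, 'n) fa) \<in> fa_gr (rpar CARD('m) (Up (a + d + 1)))"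
    by (intro fa_gr_fgen) auto
  then show ?case using Suc
    by (auto intro!: fa_gr_diff fa_gr_mult[OF fa_gr_fscal] intro: fa_gr_mult simp: add.commute)
qed

lemma root_dn_gr:
  assumes "a \<ge> 1" "a + d \<le> CARD('m) + CARD('n) - 1"
  shows "(root_dn a d :: ('m::finite, 'n::finite) fa) \<in> fa_gr (\<Sum>i\<le>d. rpar CARD('m) (Dn (a + i)))"
  using assms(2)
proof (induction d)
  case 0
  then show ?case using assms(1) by (auto intro!: fa_gr_fgen)
next
  case (Suc d)
  then have "(fgen (Dn (a + d + 1)) :: ('m, 'n) fa) \<in> fa_gr (rpar CARD('m) (Dn (a + d + 1)))"
    by (intro fa_gr_fgen) auto
  then show ?case using Suc
    by (auto intro!: fa_gr_diff fa_gr_mult[OF fa_gr_fscal] intro: fa_gr_mult simp: add.commute)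
qed

text \<open>Every word of a Serre relation contains \<open>x\<close> twice, which leaves the parity
  of \<open>y\<close>.\<close>

lemma bit_sandwich: "(s::bit) + s + t = t" "s + t + s = t" "t + s + s = t"
  by (metis add.assoc add.commute bit_double_left)+

text \<open>Homogeneous relations generate a graded ideal, so parity survives in the quotient. They
  also give the antipode of \<open>x * r * y\<close> one sign for all terms of
  \<open>r\<close>.\<close>

lemma uq_rels_gr: "r \<in> uq_rels \<Longrightarrow> \<exists>p. (r :: ('m::finite, 'n::finite) fa) \<in> fa_gr p"
proof (induction rule: uq_rels.induct)
  case (K_inv a)
  then show ?case by (intro exI[of _ 0] fa_gr_diff fa_gr_1 fa_gr_mult fa_gr_fgen) (auto simp: rpar_def)
next
  case (K_comm a b x y)
  then show ?case by (intro exI[of _ 0] fa_gr_diff fa_gr_mult fa_gr_fgen) (auto simp: rpar_def)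
next
  case (K_up a b)
  then show ?case
    by (intro exI[of _ "rpar CARD('m) (Up b)"] fa_gr_diff fa_gr_mult[OF fa_gr_mult[OF fa_gr_fgen[OF _ refl] fa_gr_fgen[OF _ refl]] fa_gr_fgen]
      fa_gr_mult[OF fa_gr_fscal fa_gr_fgen]) (auto simp: rpar_def)
next
  case (K_dn a b)
  then show ?case
    by (intro exI[of _ "rpar CARD('m) (Dn b)"] fa_gr_diff fa_gr_mult[OF fa_gr_mult[OF fa_gr_fgen[OF _ refl] fa_gr_fgen[OF _ refl]] fa_gr_fgen]
      fa_gr_mult[OF fa_gr_fscal fa_gr_fgen]) (auto simp: rpar_def)
next
  case (up_dn a b)
  \<comment> \<open>The Cartan term is even; it is present only for \<open>a = b\<close>, where both
    root generators have the same parity.\<close>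
  have eq: "a = b \<Longrightarrow> rpar CARD('m) (Up a) + rpar CARD('m) (Dn b) = 0"
    by (simp add: rpar_def)
  show ?case
  proof (intro exI[of _ "rpar CARD('m) (Up a) + rpar CARD('m) (Dn b)"] fa_gr_diff fa_gr_ksign)
    show "(fgen (Up a) * fgen (Dn b) :: ('m, 'n) fa) \<in> fa_gr (rpar CARD('m) (Up a) + rpar CARD('m) (Dn b))"
      using up_dn by (intro fa_gr_mult[OF fa_gr_fgen[OF _ refl] fa_gr_fgen[OF _ refl]]) auto
    show "(fgen (Dn b) * fgen (Up a) :: ('m, 'n) fa) \<in> fa_gr (rpar CARD('m) (Up a) + rpar CARD('m) (Dn b))"
      using up_dn by (intro fa_gr_mult[OF fa_gr_fgen[OF _ refl] fa_gr_fgen[OF _ refl]]) (auto simp: add.commute)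
    have K: "(fgen (Kp a) :: ('m, 'n) fa) \<in> fa_gr 0" "(fgen (Kp (a + 1)) :: ('m, 'n) fa) \<in> fa_gr 0"
      "(fgen (Km a) :: ('m, 'n) fa) \<in> fa_gr 0" "(fgen (Km (a + 1)) :: ('m, 'n) fa) \<in> fa_gr 0"
      using up_dn by (intro fa_gr_fgen; auto simp: rpar_def)+
    have "fscal (inverse (qi CARD('m) a - inverse (qi CARD('m) a))) *
          (fgen (Kp a) * fgen (Km (a + 1)) - fgen (Km a) * fgen (Kp (a + 1)) :: ('m, 'n) fa) \<in> fa_gr 0"
      by (rule fa_gr_mult[OF fa_gr_fscal fa_gr_diff[OF fa_gr_mult[OF K(1) K(4)]
        fa_gr_mult[OF K(3) K(2)]]]) simp_all
    then show "(if a = b then fscal (inverse (qi CARD('m) a - inverse (qi CARD('m) a))) *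
          (fgen (Kp a) * fgen (Km (a + 1)) - fgen (Km a) * fgen (Kp (a + 1))) else 0 :: ('m, 'n) fa)
      \<in> fa_gr (rpar CARD('m) (Up a) + rpar CARD('m) (Dn b))"
      using eq by (cases "a = b") (simp_all only: if_True if_False fa_gr_0 simp_thms)
  qed
next
  case up_sq
  show ?case using CARD_idxJ by (intro exI[of _ 0] fa_gr_mult fa_gr_fgen) auto
next
  case dn_sq
  show ?case using CARD_idxJ by (intro exI[of _ 0] fa_gr_mult fa_gr_fgen) auto
next
  case (up_far a b)
  then show ?case
    by (intro exI[of _ "rpar CARD('m) (Up a) + rpar CARD('m) (Up b)"] fa_gr_diff fa_gr_mult[OF fa_gr_fgen[OF _ refl] fa_gr_fgen[OF _ refl]])
      (auto simp: add.commute)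
next
  case (dn_far a b)
  then show ?case
    by (intro exI[of _ "rpar CARD('m) (Dn a) + rpar CARD('m) (Dn b)"] fa_gr_diff fa_gr_mult[OF fa_gr_fgen[OF _ refl] fa_gr_fgen[OF _ refl]])
      (auto simp: add.commute)
next
  case (serre a b x y)
  then have v: "x \<in> valid CARD('m) CARD('n)" "y \<in> valid CARD('m) CARD('n)" by auto
  note x = fa_gr_fgen[OF v(1) refl] and y = fa_gr_fgen[OF v(2) refl]
  show ?case
    by (intro exI[of _ "rpar CARD('m) y"] fa_gr_diff fa_gr_add fa_gr_mult[OF fa_gr_fscal]
      fa_gr_mult[OF fa_gr_mult[OF x x refl] y] fa_gr_mult[OF fa_gr_mult[OF x y refl] x]
      fa_gr_mult[OF fa_gr_mult[OF y x refl] x] bit_sandwich) (rule bit_sandwich, rule add_0_left)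
next
  case super_serre_up
  let ?s = "\<Sum>i\<le>2. rpar CARD('m) (Up (CARD('m) - 1 + i))"
  have "(root_up (CARD('m) - 1) 2 :: ('m, 'n) fa) \<in> fa_gr ?s"
    using super_serre_up by (intro root_up_gr) auto
  moreover have "(fgen (Up CARD('m)) :: ('m, 'n) fa) \<in> fa_gr (rpar CARD('m) (Up CARD('m)))"
    using CARD_idxJ by (intro fa_gr_fgen) auto
  ultimately show ?case
    by (intro exI[of _ "?s + rpar CARD('m) (Up CARD('m))"] fa_gr_add)
      (rule fa_gr_mult, assumption, assumption, (rule refl | rule add.commute))+
next
  case super_serre_dn
  let ?s = "\<Sum>i\<le>2. rpar CARD('m) (Dn (CARD('m) - 1 + i))"
  have "(root_dn (CARD('m) - 1) 2 :: ('m, 'n) fa) \<in> fa_gr ?s"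
    using super_serre_dn by (intro root_dn_gr) auto
  moreover have "(fgen (Dn CARD('m)) :: ('m, 'n) fa) \<in> fa_gr (rpar CARD('m) (Dn CARD('m)))"
    using CARD_idxJ by (intro fa_gr_fgen) auto
  ultimately show ?case
    by (intro exI[of _ "?s + rpar CARD('m) (Dn CARD('m))"] fa_gr_add)
      (rule fa_gr_mult, assumption, assumption, (rule refl | rule add.commute))+
qed

section \<open>Relations between the generators\<close>

abbreviation "eu a \<equiv> uq_gen (Up a)"
abbreviation "ed a \<equiv> uq_gen (Dn a)"
abbreviation "kp a \<equiv> uq_gen (Kp a)"
abbreviation "km a \<equiv> uq_gen (Km a)"
abbreviation "kk a \<equiv> kp a * km (a + 1)"
abbreviation "ki a \<equiv> km a * kp (a + 1)"

definition cup :: "nat \<Rightarrow> nat \<Rightarrow> nat \<Rightarrow> nat \<Rightarrow> Cq" where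
  "cup m n a b = qq powi wform m n (eps a) (eps b - eps (b + 1))"

text \<open>The scalar for moving \<open>ki a\<close> to the right of \<open>eu b\<close>. It is
  \<open>qq\<close> to the power minus the form of the simple roots with numbers \<open>a\<close>
  and \<open>b\<close>, hence symmetric, and the compatibility of the antipode with the relations
  depends on this symmetry.\<close>

definition kap :: "nat \<Rightarrow> nat \<Rightarrow> nat \<Rightarrow> nat \<Rightarrow> Cq" where
  "kap m n a b = inverse (cup m n a b) * cup m n (a + 1) b"

lemma cup_nonzero [simp]: "cup m n a b \<noteq> 0"
  by (simp add: cup_def)

lemma kap_nonzero [simp]: "kap m n a b \<noteq> 0"
  by (simp add: kap_def)

lemma wform_diff: "wform m n (x - y) z = wform m n x z - wform m n y z"
  by (simp add: wform_def sum_subtractf[symmetric] algebra_simps)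

lemma wform_commute: "wform m n x y = wform m n y x"
  by (simp add: wform_def mult_ac)

lemma kap_eq: "kap m n a b = qq powi (- wform m n (eps a - eps (a + 1)) (eps b - eps (b + 1)))"
  by (simp add: kap_def cup_def wform_diff power_int_minus[symmetric] power_int_add[symmetric])

lemma kap_commute: "kap m n a b = kap m n b a"
  by (simp add: kap_eq wform_commute[of m n "eps a - eps (a + 1)" "eps b - eps (b + 1)"] del: One_nat_def add_Suc_right)

lemma cdn_eq: "qq powi wform m n (eps a) (eps (b + 1) - eps b) = inverse (cup m n a b)"
proof -
  have "wform m n (eps a) (eps (b + 1) - eps b) = - wform m n (eps a) (eps b - eps (b + 1))"
    by (simp add: wform_commute[of m n "eps a"] wform_diff)
  then show ?thesis by (simp add: cup_def power_int_minus)
qed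

lemma uq_rel_simps:
  "abs_uq (fgen g) = uq_gen g" "abs_uq (fscal c) * x = uq_scale c x"
  by (simp_all add: uq_gen_def uq_scale_def)

lemma K_commute:
  assumes "a \<in> idxI CARD('m::finite) CARD('n::finite)" "b \<in> idxI CARD('m) CARD('n)"
  shows "kp a * kp b = (kp b * kp a :: ('m, 'n) uq)" "kp a * km b = (km b * kp a :: ('m, 'n) uq)"
    "km a * km b = (km b * km a :: ('m, 'n) uq)"
  using abs_uq_rel[OF uq_rels.K_comm[OF assms, of "Kp a" "Kp b"]]
    abs_uq_rel[OF uq_rels.K_comm[OF assms, of "Kp a" "Km b"]]
    abs_uq_rel[OF uq_rels.K_comm[OF assms, of "Km a" "Km b"]]
  by (simp_all add: abs_uq_hom uq_rel_simps)

lemma kp_km: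
  assumes "a \<in> idxI CARD('m::finite) CARD('n::finite)"
  shows "kp a * km a = (1 :: ('m, 'n) uq)"
  using abs_uq_rel[OF uq_rels.K_inv[OF assms]] by (simp add: abs_uq_hom uq_rel_simps)

lemma km_kp:
  assumes "a \<in> idxI CARD('m::finite) CARD('n::finite)"
  shows "km a * kp a = (1 :: ('m, 'n) uq)"
  using K_commute(2)[OF assms assms] kp_km[OF assms] by simp

lemma kp_eu_km:
  assumes "a \<in> idxI CARD('m::finite) CARD('n::finite)" "b \<in> idxJ CARD('m) CARD('n)"
  shows "kp a * eu b * km a = (uq_scale (cup CARD('m) CARD('n) a b) (eu b) :: ('m, 'n) uq)"
  using abs_uq_rel[OF uq_rels.K_up[OF assms]] by (simp add: abs_uq_hom uq_rel_simps cup_def)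

lemma kp_ed_km:
  assumes "a \<in> idxI CARD('m::finite) CARD('n::finite)" "b \<in> idxJ CARD('m) CARD('n)"
  shows "kp a * ed b * km a = (uq_scale (inverse (cup CARD('m) CARD('n) a b)) (ed b) :: ('m, 'n) uq)"
  using abs_uq_rel[OF uq_rels.K_dn[OF assms]] by (simp add: abs_uq_hom uq_rel_simps cdn_eq[symmetric])

text \<open>Multiply the rule for \<open>i\<close> by its inverse \<open>k\<close> on both
  sides.\<close>

lemma inverse_commute:
  assumes "k * i = 1" "i * k = 1" "i * x = uq_scale c (x * i)" "c \<noteq> 0"
  shows "k * x = uq_scale (inverse c) (x * k)"
proof -
  have "k * (i * x) * k = k * uq_scale c (x * i) * k" by (simp add: assms(3))
  then have "x * k = uq_scale c (k * x)"
    using assms(1,2) by (simp add: mult.assoc[symmetric]) (simp add: mult.assoc)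
  then show ?thesis using assms(4) by (simp add: uq.scale_scale)
qed

lemma conj_imp:
  fixes x :: "('m::finite, 'n::finite) uq"
  assumes "a \<in> idxI CARD('m) CARD('n)" "kp a * x * km a = uq_scale c x" "c \<noteq> 0"
  shows "kp a * x = uq_scale c (x * kp a)" "km a * x = uq_scale (inverse c) (x * km a)"
proof -
  have "kp a * x * km a * kp a = uq_scale c x * kp a" by (simp add: assms(2))
  then show 1: "kp a * x = uq_scale c (x * kp a)"
    using km_kp[OF assms(1)] by (simp add: mult.assoc)
  show "km a * x = uq_scale (inverse c) (x * km a)"
    by (rule inverse_commute[OF km_kp[OF assms(1)] kp_km[OF assms(1)] 1 assms(3)])
qed

lemma K_eu:
  assumes "a \<in> idxI CARD('m::finite) CARD('n::finite)" "b \<in> idxJ CARD('m) CARD('n)"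
  shows "kp a * eu b = (uq_scale (cup CARD('m) CARD('n) a b) (eu b * kp a) :: ('m, 'n) uq)"
    "km a * eu b = (uq_scale (inverse (cup CARD('m) CARD('n) a b)) (eu b * km a) :: ('m, 'n) uq)"
  using conj_imp[OF assms(1) kp_eu_km[OF assms]] by simp_all

lemma K_ed:
  assumes "a \<in> idxI CARD('m::finite) CARD('n::finite)" "b \<in> idxJ CARD('m) CARD('n)"
  shows "kp a * ed b = (uq_scale (inverse (cup CARD('m) CARD('n) a b)) (ed b * kp a) :: ('m, 'n) uq)"
    "km a * ed b = (uq_scale (cup CARD('m) CARD('n) a b) (ed b * km a) :: ('m, 'n) uq)"
  using conj_imp[OF assms(1) kp_ed_km[OF assms]] by simp_all

lemma idxJ_I: "a \<in> idxJ m n \<Longrightarrow> a \<in> idxI m n" "a \<in> idxJ m n \<Longrightarrow> a + 1 \<in> idxI m n"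
  by auto

lemma kk_ki_commute:
  assumes "a \<in> idxJ CARD('m::finite) CARD('n::finite)" "b \<in> idxJ CARD('m) CARD('n)"
  shows "kk a * kk b = (kk b * kk a :: ('m, 'n) uq)" "ki a * ki b = (ki b * ki a :: ('m, 'n) uq)"
    "kk a * ki b = (ki b * kk a :: ('m, 'n) uq)"
  using K_commute[OF idxJ_I(1)[OF assms(1)] idxJ_I(1)[OF assms(2)]]
    K_commute[OF idxJ_I(2)[OF assms(1)] idxJ_I(2)[OF assms(2)]]
    K_commute[OF idxJ_I(1)[OF assms(1)] idxJ_I(2)[OF assms(2)]]
    K_commute[OF idxJ_I(2)[OF assms(1)] idxJ_I(1)[OF assms(2)]]
    K_commute[OF idxJ_I(1)[OF assms(2)] idxJ_I(1)[OF assms(1)]]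
    K_commute[OF idxJ_I(2)[OF assms(2)] idxJ_I(2)[OF assms(1)]]
    K_commute[OF idxJ_I(1)[OF assms(2)] idxJ_I(2)[OF assms(1)]]
    K_commute[OF idxJ_I(2)[OF assms(2)] idxJ_I(1)[OF assms(1)]]
  by (metis (no_types) mult.assoc)+

lemma kk_ki:
  assumes a: "a \<in> idxJ CARD('m::finite) CARD('n::finite)"
  shows "kk a * ki a = (1 :: ('m, 'n) uq)"
proof -
  have "kk a * ki a = kp a * (km (a + 1) * km a) * (kp (a + 1) :: ('m, 'n) uq)"
    by (simp only: mult.assoc)
  also have "\<dots> = (kp a * km a) * (km (a + 1) * kp (a + 1))"
    by (simp only: K_commute(3)[OF idxJ_I(2)[OF a] idxJ_I(1)[OF a]] mult.assoc)
  finally show ?thesis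
    by (simp only: kp_km[OF idxJ_I(1)[OF a]] km_kp[OF idxJ_I(2)[OF a]] mult_1_left)
qed

lemma ki_kk:
  assumes "a \<in> idxJ CARD('m::finite) CARD('n::finite)"
  shows "ki a * kk a = (1 :: ('m, 'n) uq)"
  using kk_ki[OF assms] kk_ki_commute(3)[OF assms assms] by simp

lemma ki_eu:
  assumes "a \<in> idxJ CARD('m::finite) CARD('n::finite)" "b \<in> idxJ CARD('m) CARD('n)"
  shows "ki a * eu b = (uq_scale (kap CARD('m) CARD('n) a b) (eu b * ki a) :: ('m, 'n) uq)"
proof -
  have "ki a * eu b = km a * (kp (a + 1) * eu b :: ('m, 'n) uq)" by (simp add: mult.assoc)
  also have "\<dots> = uq_scale (cup CARD('m) CARD('n) (a + 1) b) (km a * eu b * kp (a + 1))"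
    by (simp only: K_eu[OF idxJ_I(2)[OF assms(1)] assms(2)] uq_scale_mult_right mult.assoc)
  finally show ?thesis
    by (simp only: K_eu[OF idxJ_I(1)[OF assms(1)] assms(2)] uq_scale_mult_left uq.scale_scale kap_def
        mult.assoc mult.commute[of "cup _ _ (a + 1) b"])
qed

text \<open>The scalar is that of \<open>ki_eu\<close>: inverting the Cartan factor and passing to
  the opposite root each invert it.\<close>

lemma kk_ed:
  assumes "a \<in> idxJ CARD('m::finite) CARD('n::finite)" "b \<in> idxJ CARD('m) CARD('n)"
  shows "kk a * ed b = (uq_scale (kap CARD('m) CARD('n) a b) (ed b * kk a) :: ('m, 'n) uq)"
proof -
  have "kk a * ed b = kp a * (km (a + 1) * ed b :: ('m, 'n) uq)" by (simp add: mult.assoc)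
  also have "\<dots> = uq_scale (cup CARD('m) CARD('n) (a + 1) b) (kp a * ed b * km (a + 1))"
    by (simp only: K_ed[OF idxJ_I(2)[OF assms(1)] assms(2)] uq_scale_mult_right mult.assoc)
  finally show ?thesis
    by (simp only: K_ed[OF idxJ_I(1)[OF assms(1)] assms(2)] uq_scale_mult_left uq.scale_scale kap_def
        mult.assoc mult.commute[of "cup _ _ (a + 1) b"])
qed

lemma kk_eu:
  assumes "a \<in> idxJ CARD('m::finite) CARD('n::finite)" "b \<in> idxJ CARD('m) CARD('n)"
  shows "kk a * eu b = (uq_scale (inverse (kap CARD('m) CARD('n) a b)) (eu b * kk a) :: ('m, 'n) uq)"
  by (rule inverse_commute[OF kk_ki[OF assms(1)] ki_kk[OF assms(1)] ki_eu[OF assms] kap_nonzero])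

section \<open>The antipode\<close>

definition S_gen :: "rawgen \<Rightarrow> ('m::finite, 'n::finite) uq" where
  "S_gen g = (case g of Up a \<Rightarrow> - (eu a * ki a) | Dn a \<Rightarrow> - (kk a * ed a) | Kp a \<Rightarrow> km a | Km a \<Rightarrow> kp a)"

fun S_word :: "('m::finite, 'n::finite) gen list \<Rightarrow> ('m, 'n) uq" where
  "S_word [] = 1"
| "S_word (g # w) = ksign (gen_par g * word_par w) (S_word w * S_gen (Rep_gen g))"

definition S_fa :: "('m::finite, 'n::finite) fa \<Rightarrow> ('m, 'n) uq" where
  "S_fa x = (\<Sum>w\<in>Poly_Mapping.keys x. uq_scale (Poly_Mapping.lookup x w) (S_word w))"

lemma S_fa_superset:
  assumes "finite A" "Poly_Mapping.keys x \<subseteq> A"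
  shows "S_fa x = (\<Sum>w\<in>A. uq_scale (Poly_Mapping.lookup x w) (S_word w))"
  unfolding S_fa_def
  by (rule sum.mono_neutral_left) (use assms in \<open>auto simp: in_keys_iff\<close>)

lemma S_fa_add: "S_fa (x + y) = S_fa x + S_fa y"
proof -
  let ?A = "Poly_Mapping.keys x \<union> Poly_Mapping.keys y"
  have "Poly_Mapping.keys (x + y) \<subseteq> ?A" by (rule Poly_Mapping.keys_add)
  then show ?thesis
    by (simp add: S_fa_superset[of ?A] lookup_add uq.scale_left_distrib sum.distrib)
qed

lemma S_fa_0 [simp]: "S_fa 0 = 0"
  by (simp add: S_fa_def)

lemma S_fa_uminus: "S_fa (- x) = - S_fa x"
  using S_fa_add[of x "- x"] by (simp add: eq_neg_iff_add_eq_0 add.commute)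

lemma S_fa_diff: "S_fa (x - y) = S_fa x - S_fa y"
  using S_fa_add[of x "- y"] by (simp add: S_fa_uminus)

lemma S_fa_ksign: "S_fa (ksign s x) = ksign s (S_fa x)"
  by (simp add: ksign_def S_fa_uminus)

lemma S_fa_single: "S_fa (Poly_Mapping.single w c) = uq_scale c (S_word w)"
  by (cases "c = 0") (simp_all add: S_fa_def)

lemma uq_scale_ksign: "uq_scale c (ksign s x) = ksign s (uq_scale c x)"
  by (simp add: ksign_def)

lemma S_word_append: "S_word (u @ v) = ksign (word_par u * word_par v) (S_word v * S_word u)"
proof (induction u)
  case (Cons g u)
  show ?case
    by (simp only: append_Cons S_word.simps word_par_simps Cons.IH ksign_mult_left ksign_mult_right
        ksign_ksign distrib_left distrib_right mult.assoc) (simp only: ac_simps)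
qed simp

lemma S_fa_mult:
  assumes "x \<in> fa_gr s" "y \<in> fa_gr t"
  shows "S_fa (x * y) = ksign (s * t) (S_fa y * S_fa x)"
  using assms(1)
proof (induction rule: fa_gr_induct)
  case (single w c)
  from assms(2) show ?case
  proof (induction rule: fa_gr_induct)
    case (single w' c')
    then show ?case using \<open>word_par w = s\<close>
      by (simp add: mult_single S_fa_single plus_list_def S_word_append uq_scale_ksign mult.commute)
  qed (simp_all add: distrib_left distrib_right S_fa_add ksign_add)
qed (simp_all add: distrib_left distrib_right S_fa_add ksign_add)

lemma S_fa_fscal_mult: "S_fa (fscal c * x) = uq_scale c (S_fa x)"
  by (induction x rule: fa_induct)
    (simp_all add: fscal_mult_single S_fa_single S_fa_add distrib_left uq.scale_right_distrib)

lemma S_fa_1: "S_fa 1 = 1"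
  unfolding single_one[symmetric] zero_list_def by (simp add: S_fa_single)

lemma S_fa_fgen: "g \<in> valid CARD('m) CARD('n) \<Longrightarrow>
    S_fa (fgen g :: ('m::finite, 'n::finite) fa) = S_gen g"
  by (simp add: fgen_def S_fa_single Rep_Abs_gen)

text \<open>The antipode on lists of raw generators. It evaluates products of \<open>fgen\<close>
  without \<open>Abs_gen\<close> and \<open>Rep_gen\<close>.\<close>

fun S_raw :: "nat \<Rightarrow> rawgen list \<Rightarrow> ('m::finite, 'n::finite) uq" where
  "S_raw m [] = 1"
| "S_raw m (g # w) = ksign (rpar m g * sum_list (map (rpar m) w)) (S_raw m w * S_gen g)"

lemma prod_fgen_gr:
  "set gs \<subseteq> valid CARD('m) CARD('n) \<Longrightarrow>
    (prod_list (map fgen gs) :: ('m::finite, 'n::finite) fa) \<in> fa_gr (sum_list (map (rpar CARD('m)) gs))"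
  by (induction gs) (auto intro!: fa_gr_1 fa_gr_mult[OF fa_gr_fgen[OF _ refl]])

lemma S_fa_prod:
  "set gs \<subseteq> valid CARD('m) CARD('n) \<Longrightarrow>
    S_fa (prod_list (map fgen gs) :: ('m::finite, 'n::finite) fa) = S_raw CARD('m) gs"
proof (induction gs)
  case (Cons g gs)
  then show ?case
    by (simp add: S_fa_mult[OF fa_gr_fgen[OF _ refl] prod_fgen_gr] S_fa_fgen)
qed (simp add: S_fa_1)

text \<open>\<open>X\<^sub>i = d\<^sub>i e\<^sub>i l\<^sub>i\<close> with commuting \<open>l\<^sub>i\<close> that \<open>\<kappa>\<close>-commute with the \<open>e\<^sub>j\<close>: since \<open>\<kappa>\<close> is
  symmetric, the scalar picked up by a product of the \<open>X\<^sub>i\<close> does not depend on the order.\<close>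

locale twisted =
  fixes e l X :: "nat \<Rightarrow> ('m::finite, 'n::finite) uq" and d :: "nat \<Rightarrow> Cq"
    and \<kappa> :: "nat \<Rightarrow> nat \<Rightarrow> Cq" and J :: "nat set"
  assumes le: "i \<in> J \<Longrightarrow> j \<in> J \<Longrightarrow> l i * e j = uq_scale (\<kappa> i j) (e j * l i)"
    and ll: "i \<in> J \<Longrightarrow> j \<in> J \<Longrightarrow> l i * l j = l j * l i"
    and \<kappa>: "\<kappa> i j = \<kappa> j i"
    and X: "i \<in> J \<Longrightarrow> X i = uq_scale (d i) (e i * l i)"
begin

text \<open>The cost of collecting all \<open>l\<close> on the right: \<open>d i\<close> for each
  factor, and \<open>\<kappa> i j\<close> for each pair with \<open>i\<close> to the left of
  \<open>j\<close>.\<close>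

fun cc :: "nat list \<Rightarrow> Cq" where
  "cc [] = 1"
| "cc (i # js) = d i * prod_list (map (\<kappa> i) js) * cc js"

lemma le_prod: "i \<in> J \<Longrightarrow> set js \<subseteq> J \<Longrightarrow>
    l i * prod_list (map e js) = uq_scale (prod_list (map (\<kappa> i) js)) (prod_list (map e js) * l i)"
proof (induction js)
  case (Cons j js)
  have "l i * prod_list (map e (j # js)) = uq_scale (\<kappa> i j) (e j * (l i * prod_list (map e js)))"
    using Cons.prems le by (simp add: mult.assoc[symmetric])
  then show ?case using Cons by (simp add: mult.assoc)
qed simp

lemma prod_X: "set js \<subseteq> J \<Longrightarrow> prod_list (map X js) =
    uq_scale (cc js) (prod_list (map e js) * prod_list (map l js))"
proof (induction js)
  case (Cons j js)
  let ?E = "prod_list (map e js)" and ?L = "prod_list (map l js)"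
  have "prod_list (map X (j # js)) = uq_scale (d j * cc js) (e j * (l j * ?E * ?L))"
    using Cons X by (simp add: mult.assoc)
  also have "l j * ?E * ?L = uq_scale (prod_list (map (\<kappa> j) js)) (?E * (l j * ?L))"
    using Cons.prems by (simp add: le_prod mult.assoc)
  finally show ?case by (simp add: mult.assoc mult_ac(1,2,3)[where 'a = Cq])
qed simp

lemma X_quad: "i \<in> J \<Longrightarrow> j \<in> J \<Longrightarrow> e i * e j = e j * e i \<Longrightarrow> X i * X j = X j * X i"
  using prod_X[of "[i, j]"] prod_X[of "[j, i]"] by (simp add: ll \<kappa>[of i j] mult_ac)

lemma X_square: "i \<in> J \<Longrightarrow> e i * e i = 0 \<Longrightarrow> X i * X i = 0"
  using prod_X[of "[i, i]"] by simp

lemma X_serre: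
  assumes "i \<in> J" "j \<in> J" "e i * (e i * e j) - uq_scale c (e i * (e j * e i)) + e j * (e i * e i) = 0"
  shows "X i * (X i * X j) - uq_scale c (X i * (X j * X i)) + X j * (X i * X i) = 0"
proof -
  \<comment> \<open>All three words contain \<open>i\<close> twice and \<open>j\<close> once, so the
    symmetry of \<open>\<kappa>\<close> gives them one scalar.\<close>
  define C where "C = cc [i, i, j]"
  have "cc [i, j, i] = C" "cc [j, i, i] = C"
    by (simp_all add: C_def \<kappa>[of i j] mult_ac)
  note C = C_def[symmetric] this
  have L: "l i * (l j * l i) = l i * (l i * l j)" "l j * (l i * l i) = l i * (l i * l j)"
    using assms(1,2) by (metis ll mult.assoc)+
  have P: "X i * (X i * X j) = uq_scale C (e i * (e i * e j) * (l i * (l i * l j)))"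
    "X i * (X j * X i) = uq_scale C (e i * (e j * e i) * (l i * (l i * l j)))"
    "X j * (X i * X i) = uq_scale C (e j * (e i * e i) * (l i * (l i * l j)))"
    using prod_X[of "[i, i, j]"] prod_X[of "[i, j, i]"] prod_X[of "[j, i, i]"] assms(1,2)
    by (simp_all only: list.map prod_list.Cons prod_list.Nil mult_1_right C L list.set insert_subset
        empty_subsetI simp_thms)
  have "X i * (X i * X j) - uq_scale c (X i * (X j * X i)) + X j * (X i * X i) =
      uq_scale C ((e i * (e i * e j) - uq_scale c (e i * (e j * e i)) + e j * (e i * e i)) * (l i * (l i * l j)))"
    by (simp only: P distrib_right left_diff_distrib uq.scale_right_distrib uq.scale_right_diff_distrib
        uq_scale_mult_left uq.scale_scale mult.commute[of c])
  then show ?thesis by (simp only: assms(3) mult_zero_left uq.scale_zero_right)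
qed

lemma X_superserre:
  assumes J: "i \<in> J" "j \<in> J" "k \<in> J"
    and e: "e i * (e j * (e k * e j)) + e k * (e j * (e i * e j)) + e j * (e i * (e j * e k)) +
      e j * (e k * (e j * e i)) - uq_scale c (e j * (e i * (e k * e j))) = 0"
  shows "X i * (X j * (X k * X j)) + X k * (X j * (X i * X j)) + X j * (X i * (X j * X k)) +
      X j * (X k * (X j * X i)) - uq_scale c (X j * (X i * (X k * X j))) = 0"
proof -
  \<comment> \<open>Five arrangements of the letters i, j, j, k: again one scalar, and one product
    of the commuting \<open>l\<close>.\<close>
  define C where "C = cc [i, j, k, j]"
  define L where "L = l i * (l j * (l k * l j))"
  have C: "cc [i, j, k, j] = C" "cc [k, j, i, j] = C" "cc [j, i, j, k] = C" "cc [j, k, j, i] = C"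
    "cc [j, i, k, j] = C"
    by (simp_all add: C_def \<kappa>[of i j] \<kappa>[of k i] \<kappa>[of k j] mult_ac)
  have c: "l j * l i = l i * l j" "l k * l j = l j * l k" "l k * l i = l i * l k"
    using J ll by auto
  have c': "l j * (l i * z) = l i * (l j * z)" "l k * (l j * z) = l j * (l k * z)"
    "l k * (l i * z) = l i * (l k * z)" for z
    by (simp_all add: c mult.assoc[symmetric])
  have L: "l i * (l j * (l k * l j)) = L" "l k * (l j * (l i * l j)) = L"
    "l j * (l i * (l j * l k)) = L" "l j * (l k * (l j * l i)) = L" "l j * (l i * (l k * l j)) = L"
    by (simp_all add: L_def c c')
  have P: "X i * (X j * (X k * X j)) = uq_scale C (e i * (e j * (e k * e j)) * L)"
    "X k * (X j * (X i * X j)) = uq_scale C (e k * (e j * (e i * e j)) * L)"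
    "X j * (X i * (X j * X k)) = uq_scale C (e j * (e i * (e j * e k)) * L)"
    "X j * (X k * (X j * X i)) = uq_scale C (e j * (e k * (e j * e i)) * L)"
    "X j * (X i * (X k * X j)) = uq_scale C (e j * (e i * (e k * e j)) * L)"
    using prod_X[of "[i, j, k, j]"] prod_X[of "[k, j, i, j]"] prod_X[of "[j, i, j, k]"]
      prod_X[of "[j, k, j, i]"] prod_X[of "[j, i, k, j]"] J
    by (simp_all only: list.map prod_list.Cons prod_list.Nil mult_1_right C L list.set insert_subset
        empty_subsetI simp_thms)
  have "X i * (X j * (X k * X j)) + X k * (X j * (X i * X j)) + X j * (X i * (X j * X k)) +
      X j * (X k * (X j * X i)) - uq_scale c (X j * (X i * (X k * X j))) =
      uq_scale C ((e i * (e j * (e k * e j)) + e k * (e j * (e i * e j)) + e j * (e i * (e j * e k)) +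
      e j * (e k * (e j * e i)) - uq_scale c (e j * (e i * (e k * e j)))) * L)"
    by (simp only: P distrib_right left_diff_distrib uq.scale_right_distrib uq.scale_right_diff_distrib
        uq_scale_mult_left uq.scale_scale mult.commute[of c])
  then show ?thesis by (simp only: e mult_zero_left uq.scale_zero_right)
qed

end


lemma twisted_up: "twisted (eu :: nat \<Rightarrow> ('m::finite, 'n::finite) uq) (\<lambda>a. ki a) (\<lambda>a. S_gen (Up a)) (\<lambda>_. - 1)
    (kap CARD('m) CARD('n)) (idxJ CARD('m) CARD('n))"
  by unfold_locales (simp_all only: ki_eu kk_ki_commute kap_commute, simp add: S_gen_def)

text \<open>Here \<open>S_gen\<close> has its Cartan factor on the left; moving \<open>kk a\<close>
  past \<open>ed a\<close> produces the factor \<open>kap\<close> at \<open>a\<close>,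
  \<open>a\<close>.\<close>

lemma twisted_dn: "twisted (ed :: nat \<Rightarrow> ('m::finite, 'n::finite) uq) (\<lambda>a. kk a) (\<lambda>a. S_gen (Dn a))
    (\<lambda>a. - kap CARD('m) CARD('n) a a) (kap CARD('m) CARD('n)) (idxJ CARD('m) CARD('n))"
proof unfold_locales
  fix i assume "i \<in> idxJ CARD('m) CARD('n)"
  from kk_ed[OF this this] show "S_gen (Dn i) = uq_scale (- kap CARD('m) CARD('n) i i) (ed i * kk i :: ('m, 'n) uq)"
    by (simp add: S_gen_def)
qed (simp_all only: kk_ed kk_ki_commute kap_commute)

section \<open>Images of the relations under the antipode\<close>

lemma S_fa_2:
  assumes "g \<in> valid CARD('m) CARD('n)" "h \<in> valid CARD('m) CARD('n)"
  shows "S_fa (fgen g * fgen h :: ('m::finite, 'n::finite) fa) =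
    ksign (rpar CARD('m) g * rpar CARD('m) h) (S_gen h * S_gen g)"
  using S_fa_prod[where 'm = 'm and 'n = 'n, of "[g, h]"] assms by simp

lemma S_fa_3:
  assumes "g \<in> valid CARD('m) CARD('n)" "h \<in> valid CARD('m) CARD('n)" "k \<in> valid CARD('m) CARD('n)"
  shows "S_fa (fgen g * fgen h * fgen k :: ('m::finite, 'n::finite) fa) =
    ksign (rpar CARD('m) g * (rpar CARD('m) h + rpar CARD('m) k) + rpar CARD('m) h * rpar CARD('m) k)
      (S_gen k * S_gen h * S_gen g)"
  using S_fa_prod[where 'm = 'm and 'n = 'n, of "[g, h, k]"] assms by (simp add: mult.assoc ksign_mult_left ksign_ksign)

lemma S_fa_4:
  assumes "g \<in> valid CARD('m) CARD('n)" "h \<in> valid CARD('m) CARD('n)"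
    "k \<in> valid CARD('m) CARD('n)" "i \<in> valid CARD('m) CARD('n)"
  shows "S_fa (fgen g * (fgen h * (fgen k * fgen i)) :: ('m::finite, 'n::finite) fa) =
    ksign (rpar CARD('m) g * (rpar CARD('m) h + (rpar CARD('m) k + rpar CARD('m) i)) +
        (rpar CARD('m) h * (rpar CARD('m) k + rpar CARD('m) i) + rpar CARD('m) k * rpar CARD('m) i))
      (S_gen i * (S_gen k * (S_gen h * S_gen g)))"
  using S_fa_prod[where 'm = 'm and 'n = 'n, of "[g, h, k, i]"] assms by (simp add: mult.assoc ksign_mult_left ksign_ksign)

lemma fgen_fscal: "fgen g * (fscal c * y) = fscal c * (fgen g * y)"
  by (simp only: mult.assoc[symmetric] fscal_central[of "fgen g" c])

lemma fscal_fscal: "fscal c * (fscal d * x) = fscal (c * d) * x"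
  by (simp add: mult.assoc[symmetric] fscal_mult)

text \<open>Both super Serre relations expand to this polynomial. Modulo \<open>y\<^sup>2 = 0\<close> and \<open>x z = z x\<close> it is
  invariant under reversal of words, which is why the antipode preserves it.\<close>

definition super_serre_poly :: "rawgen \<Rightarrow> rawgen \<Rightarrow> rawgen \<Rightarrow> ('m::finite, 'n::finite) fa" where
  "super_serre_poly g h k = (let x = fgen g; y = fgen h; z = fgen k in
     x * (y * (z * y)) + z * (y * (x * y)) + y * (x * (y * z)) + y * (z * (y * x)) -
     fscal (inverse qq) * (y * (x * (z * y))) - fscal qq * (y * (z * (x * y))) -
     fscal qq * (z * (x * (y * y))) - fscal (inverse qq) * (y * (y * (x * z))))"

text \<open>The coefficients are the inverses of \<open>qi\<close> at the intermediate indices m and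
  m + 1, which lie on different sides of the change from \<open>qq\<close> to
  \<open>inverse qq\<close>.\<close>

lemma super_serre_up_eq:
  "root_up (CARD('m) - 1) 2 * fgen (Up CARD('m)) + fgen (Up CARD('m)) * root_up (CARD('m) - 1) 2 =
    (super_serre_poly (Up (CARD('m) - 1)) (Up CARD('m)) (Up (CARD('m) + 1)) :: ('m::finite, 'n::finite) fa)"
proof -
  have "Suc (CARD('m) - Suc 0) = CARD('m)" by simp
  then show ?thesis
    by (simp add: numeral_2_eq_2 super_serre_poly_def Let_def qi_def distrib_left distrib_right
      left_diff_distrib right_diff_distrib mult.assoc fgen_fscal fscal_fscal)
qed

text \<open>Compared with the raising case the factors are interchanged and \<open>qi\<close>
  replaces its inverse. The two changes compensate: the root vector consists of the same four words
  with the same coefficients.\<close>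

lemma super_serre_dn_eq:
  "root_dn (CARD('m) - 1) 2 * fgen (Dn CARD('m)) + fgen (Dn CARD('m)) * root_dn (CARD('m) - 1) 2 =
    (super_serre_poly (Dn (CARD('m) - 1)) (Dn CARD('m)) (Dn (CARD('m) + 1)) :: ('m::finite, 'n::finite) fa)"
proof -
  have "Suc (CARD('m) - Suc 0) = CARD('m)" by simp
  then show ?thesis
    by (simp add: numeral_2_eq_2 super_serre_poly_def Let_def qi_def distrib_left distrib_right
      left_diff_distrib right_diff_distrib mult.assoc fgen_fscal fscal_fscal)
qed

text \<open>Terms containing \<open>y * y\<close> drop out, and two of the remaining words coincide
  because \<open>x\<close> and \<open>z\<close> commute. Their coefficients \<open>a\<close> and
  \<open>b\<close> enter only through the sum, which does not change when they are
  exchanged.\<close>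

lemma super_serre_poly_zero:
  fixes x y z :: "('m::finite, 'n::finite) uq"
  assumes "y * y = 0" "x * z = z * x"
  shows "x * (y * (z * y)) + z * (y * (x * y)) + y * (x * (y * z)) + y * (z * (y * x)) -
     uq_scale a (y * (x * (z * y))) - uq_scale b (y * (z * (x * y))) -
     uq_scale c (z * (x * (y * y))) - uq_scale d (y * (y * (x * z))) =
     x * (y * (z * y)) + z * (y * (x * y)) + y * (x * (y * z)) + y * (z * (y * x)) -
     uq_scale (b + a) (y * (x * (z * y)))"
proof -
  have "z * (x * w) = x * (z * w)" "y * (y * w) = 0" for w
    using assms by (metis mult.assoc mult_zero_left)+
  then show ?thesis by (simp add: assms(1) uq.scale_left_distrib)
qed

text \<open>\<open>E\<close> stands for \<open>Up\<close> or \<open>Dn\<close>. Reversal of words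
  exchanges \<open>qq\<close> and \<open>inverse qq\<close> on the words that survive, and only the
  sum of the two matters.\<close>

lemma S_super_serre:
  fixes E :: "nat \<Rightarrow> rawgen"
  assumes tw: "twisted (\<lambda>a. uq_gen (E a) :: ('m::finite, 'n::finite) uq) l (\<lambda>a. S_gen (E a)) d
      (kap CARD('m) CARD('n)) (idxJ CARD('m) CARD('n))"
    and E: "\<And>a. a \<in> idxJ CARD('m) CARD('n) \<Longrightarrow> E a \<in> valid CARD('m) CARD('n)"
    and par: "\<And>a. rpar CARD('m) (E a) = (if a = CARD('m) then 1 else 0)"
    and sq: "uq_gen (E CARD('m)) * uq_gen (E CARD('m)) = (0 :: ('m, 'n) uq)"
    and far: "uq_gen (E (CARD('m) - 1)) * uq_gen (E (CARD('m) + 1)) =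
      (uq_gen (E (CARD('m) + 1)) * uq_gen (E (CARD('m) - 1)) :: ('m, 'n) uq)"
    and mn: "CARD('m) \<ge> 2" "CARD('n) \<ge> 2"
    and rel: "abs_uq (super_serre_poly (E (CARD('m) - 1)) (E CARD('m)) (E (CARD('m) + 1))) = (0 :: ('m, 'n) uq)"
  shows "S_fa (super_serre_poly (E (CARD('m) - 1)) (E CARD('m)) (E (CARD('m) + 1)) :: ('m, 'n) fa) = 0"
proof -
  interpret twisted "\<lambda>a. uq_gen (E a) :: ('m, 'n) uq" l "\<lambda>a. S_gen (E a)" d "kap CARD('m) CARD('n)"
    "idxJ CARD('m) CARD('n)" by (rule tw)
  let ?a = "CARD('m) - 1" and ?b = "CARD('m)" and ?c = "CARD('m) + 1"
  have J: "?a \<in> idxJ CARD('m) CARD('n)" "?b \<in> idxJ CARD('m) CARD('n)" "?c \<in> idxJ CARD('m) CARD('n)"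
    using mn by (simp_all only: atLeastAtMost_iff) linarith+
  have p: "rpar CARD('m) (E ?a) = 0" "rpar CARD('m) (E ?b) = 1" "rpar CARD('m) (E ?c) = 0"
    using mn by (simp_all add: par)
  define x y z where xyz: "x = (uq_gen (E ?a) :: ('m, 'n) uq)" "y = (uq_gen (E ?b) :: ('m, 'n) uq)"
    "z = (uq_gen (E ?c) :: ('m, 'n) uq)"
  define X Y Z where XYZ: "X = (S_gen (E ?a) :: ('m, 'n) uq)" "Y = (S_gen (E ?b) :: ('m, 'n) uq)"
    "Z = (S_gen (E ?c) :: ('m, 'n) uq)"
  have "x * (y * (z * y)) + z * (y * (x * y)) + y * (x * (y * z)) + y * (z * (y * x)) -
     uq_scale (qq + inverse qq) (y * (x * (z * y))) = 0"
    using rel sq far super_serre_poly_zero[of y x z "inverse qq" qq qq "inverse qq"]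
    by (simp add: super_serre_poly_def Let_def abs_uq_hom uq_rel_simps xyz)
  from X_superserre[OF J this[unfolded xyz]]
  have *: "X * (Y * (Z * Y)) + Z * (Y * (X * Y)) + Y * (X * (Y * Z)) + Y * (Z * (Y * X)) -
     uq_scale (qq + inverse qq) (Y * (X * (Z * Y))) = 0"
    by (simp only: XYZ)
  have YY: "Y * Y = 0" using X_square[OF J(2) sq] by (simp only: XYZ)
  then have YY': "Y * (Y * w) = 0" for w by (simp add: mult.assoc[symmetric])
  have XZ: "X * Z = Z * X" using X_quad[OF J(1,3) far] by (simp only: XYZ)
  note v = E[OF J(1)] E[OF J(2)] E[OF J(3)]
  \<comment> \<open>Each word contains the odd letter twice and two even letters, so its reversal
    costs the common sign -1.\<close>
  have "S_fa (super_serre_poly (E ?a) (E ?b) (E ?c) :: ('m, 'n) fa) =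
     - (X * (Y * (Z * Y)) + Z * (Y * (X * Y)) + Y * (X * (Y * Z)) + Y * (Z * (Y * X)) -
     uq_scale qq (Y * (X * (Z * Y))) - uq_scale (inverse qq) (Y * (Z * (X * Y))) -
     uq_scale (inverse qq) (Y * (Y * (X * Z))) - uq_scale qq (Z * (X * (Y * Y))))"
    unfolding super_serre_poly_def Let_def
    by (simp only: S_fa_add S_fa_diff S_fa_fscal_mult S_fa_4 v p XYZ[symmetric])
      (simp add: YY YY' XZ algebra_simps)
  also have "\<dots> = 0"
    using * super_serre_poly_zero[OF YY XZ, of qq "inverse qq" qq "inverse qq"]
    by (simp add: YY YY' XZ algebra_simps)
  finally show ?thesis .
qed

text \<open>Up to sign, the images of a raising and a lowering generator multiply to
  \<open>e * i * (k * f)\<close>. Moving \<open>i\<close> behind \<open>f\<close> and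
  \<open>k\<close> in front of \<open>e\<close> costs mutually inverse scalars, so the product
  \<open>e * f\<close> is merely enclosed between \<open>k\<close> and \<open>i\<close>.\<close>

lemma exchange:
  assumes "k * e = uq_scale (inverse c) (e * k)" "f * i = uq_scale c (i * f)" "k * i = i * k" "c \<noteq> 0"
  shows "k * (e * f) * i = e * i * (k * f)"
proof -
  have "k * (e * f) * i = (k * e) * (f * i)" by (simp only: mult.assoc)
  also have "\<dots> = e * (k * i) * f" using assms(4) by (simp add: assms(1,2) mult.assoc)
  finally show ?thesis by (simp only: assms(3) mult.assoc)
qed

lemma S_fa_rels: "r \<in> uq_rels \<Longrightarrow> S_fa (r :: ('m::finite, 'n::finite) fa) = 0"
proof (induction rule: uq_rels.induct)
  case (K_inv a)
  then show ?case
    by (simp add: S_fa_diff S_fa_2 S_fa_1 rpar_def S_gen_def kp_km del: atLeastAtMost_iff)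
next
  case (K_comm a b x y)
  have "S_fa (fgen x * fgen y :: ('m, 'n) fa) = S_gen y * S_gen x" "S_fa (fgen y * fgen x :: ('m, 'n) fa) = S_gen x * S_gen y"
    using K_comm by (auto simp: S_fa_2 rpar_def simp del: atLeastAtMost_iff)
  moreover have "S_gen x * S_gen y = (S_gen y * S_gen x :: ('m, 'n) uq)"
    using K_comm K_commute[OF K_comm(1,2)] K_commute[OF K_comm(2,1)] by (auto simp: S_gen_def)
  ultimately show ?case by (simp add: S_fa_diff)
next
  case (K_up a b)
  have "S_fa (fgen (Kp a) * fgen (Up b) * fgen (Km a) :: ('m, 'n) fa) = - (kp a * (eu b * ki b) * km a)"
    using K_up by (subst S_fa_3) (simp_all add: rpar_def S_gen_def mult.assoc)
  also have "kp a * (eu b * ki b) * km a = kp a * eu b * km a * (ki b :: ('m, 'n) uq)"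
    using K_commute[OF K_up(1) idxJ_I(1)[OF K_up(2)]] K_commute[OF K_up(1) idxJ_I(2)[OF K_up(2)]]
      K_commute[OF idxJ_I(1)[OF K_up(2)] K_up(1)] K_commute[OF idxJ_I(2)[OF K_up(2)] K_up(1)]
    by (metis (no_types) mult.assoc)
  finally show ?case
    using K_up by (simp add: S_fa_diff S_fa_fscal_mult S_fa_fgen kp_eu_km cup_def S_gen_def del: atLeastAtMost_iff)
next
  case (K_dn a b)
  have "S_fa (fgen (Kp a) * fgen (Dn b) * fgen (Km a) :: ('m, 'n) fa) = - (kp a * (kk b * ed b) * km a)"
    using K_dn by (subst S_fa_3) (simp_all add: rpar_def S_gen_def mult.assoc)
  also have "kp a * (kk b * ed b) * km a = kk b * (kp a * ed b * (km a :: ('m, 'n) uq))"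
    using K_commute[OF K_dn(1) idxJ_I(1)[OF K_dn(2)]] K_commute[OF K_dn(1) idxJ_I(2)[OF K_dn(2)]]
      K_commute[OF idxJ_I(1)[OF K_dn(2)] K_dn(1)] K_commute[OF idxJ_I(2)[OF K_dn(2)] K_dn(1)]
    by (metis (no_types) mult.assoc)
  finally show ?case
    using K_dn by (simp add: S_fa_diff S_fa_fscal_mult S_fa_fgen kp_ed_km cdn_eq[symmetric] S_gen_def del: atLeastAtMost_iff)
next
  case (up_dn a b)
  define s :: bit where "s = (if a = CARD('m) \<and> b = CARD('m) then 1 else 0)"
  \<comment> \<open>Zero off the diagonal, so that one formula covers both cases of the
    relation.\<close>
  define c where "c = (if a = b then inverse (qi CARD('m) a - inverse (qi CARD('m) a)) else 0)"
  have s: "rpar CARD('m) (Up a) * rpar CARD('m) (Dn b) = s" "rpar CARD('m) (Dn b) * rpar CARD('m) (Up a) = s"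
    by (auto simp: s_def rpar_def)
  have I: "a \<in> idxI CARD('m) CARD('n)" "a + 1 \<in> idxI CARD('m) CARD('n)" by (rule idxJ_I[OF up_dn(1)])+
  have r: "fgen (Up a) * fgen (Dn b) - ksign s (fgen (Dn b) * fgen (Up a)) -
    (if a = b then fscal (inverse (qi CARD('m) a - inverse (qi CARD('m) a))) *
      (fgen (Kp a) * fgen (Km (a + 1)) - fgen (Km a) * fgen (Kp (a + 1))) else 0) =
    fgen (Up a) * fgen (Dn b) - ksign s (fgen (Dn b) * fgen (Up a)) -
    fscal c * (fgen (Kp a) * fgen (Km (a + 1)) - fgen (Km a) * fgen (Kp (a + 1)) :: ('m, 'n) fa)"
    by (simp add: c_def fscal_def)
  have 1: "eu a * ed b - ksign s (ed b * eu a) = uq_scale c (kk a - ki a :: ('m, 'n) uq)"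
    using abs_uq_rel[OF uq_rels.up_dn[OF up_dn], folded s_def, unfolded r]
    by (simp add: abs_uq_hom abs_uq_ksign uq_rel_simps)
  have "ed b * ki a = (uq_scale (kap CARD('m) CARD('n) a b) (ki a * ed b) :: ('m, 'n) uq)"
    by (simp only: inverse_commute[OF ki_kk[OF up_dn(1)] kk_ki[OF up_dn(1)] kk_ed[OF up_dn] kap_nonzero]
        uq.scale_scale) simp
  from exchange[OF kk_eu[OF up_dn(2,1)] this[unfolded kap_commute[of _ _ a b]]
      kk_ki_commute(3)[OF up_dn(2,1)] kap_nonzero]
  have 2: "eu a * ki a * (kk b * ed b) = (kk b * (eu a * ed b) * ki a :: ('m, 'n) uq)"
    by (rule sym)
  have 3: "kk b * (kk a - ki a) * ki a = (kk b * ki a * (kk a - ki a) :: ('m, 'n) uq)"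
    using kk_ki_commute(3)[OF up_dn(1,1)]
    by (simp only: right_diff_distrib left_diff_distrib mult.assoc)
  \<comment> \<open>On the diagonal \<open>kk b * ki a\<close> is 1; off the diagonal the scalar
    vanishes.\<close>
  have 4: "a = b \<or> c = 0" by (auto simp: c_def)
  have 5: "uq_scale c (kk b * ki a * (kk a - ki a)) = uq_scale c (kk a - ki a :: ('m, 'n) uq)"
    using 4
  proof
    assume "a = b"
    show ?thesis by (simp only: \<open>a = b\<close>[symmetric] kk_ki[OF up_dn(1)] mult_1_left)
  qed simp
  have K: "S_fa (fgen (Kp a) * fgen (Km (a + 1)) - fgen (Km a) * fgen (Kp (a + 1)) :: ('m, 'n) fa) = ki a - kk a"
    using K_commute[OF I] K_commute[OF I(2,1)] S_fa_2[where 'm = 'm and 'n = 'n, of "Kp a" "Km (a + 1)"]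
      S_fa_2[where 'm = 'm and 'n = 'n, of "Km a" "Kp (a + 1)"] I
    by (simp only: S_fa_diff rpar_def valid_iff) (simp add: S_gen_def)
  have "S_fa (fgen (Up a) * fgen (Dn b) - ksign s (fgen (Dn b) * fgen (Up a)) -
      fscal c * (fgen (Kp a) * fgen (Km (a + 1)) - fgen (Km a) * fgen (Kp (a + 1))) :: ('m, 'n) fa) =
     ksign s (kk b * (ed b * eu a) * ki a) - eu a * ki a * (kk b * ed b) - uq_scale c (ki a - kk a)"
    using S_fa_2[where 'm = 'm and 'n = 'n, of "Up a" "Dn b"] S_fa_2[where 'm = 'm and 'n = 'n, of "Dn b" "Up a"] up_dn
    by (simp only: S_fa_diff[of _ "fscal c * _"] S_fa_diff[of "_ * _" "ksign _ _"] S_fa_ksign S_fa_fscal_mult K s valid_iff)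
      (simp add: ksign_ksign S_gen_def mult.assoc)
  \<comment> \<open>The supercommutator reappears with opposite sign between \<open>kk b\<close> and
    \<open>ki a\<close>, where the original relation evaluates it.\<close>
  also have "\<dots> = uq_scale c (kk a - ki a) - kk b * (eu a * ed b - ksign s (ed b * eu a)) * ki a"
    by (simp only: 2) (simp add: right_diff_distrib left_diff_distrib ksign_mult_left ksign_mult_right
        uq.scale_right_diff_distrib)
  also have "\<dots> = 0"
    by (simp only: 1 uq_scale_mult_left uq_scale_mult_right 3 5) simp
  finally show ?case unfolding s_def[symmetric] r .
next
  case up_sq
  have "eu CARD('m) * eu CARD('m) = (0 :: ('m, 'n) uq)"
    using abs_uq_rel[OF uq_rels.up_sq] by (simp add: abs_uq_hom uq_rel_simps)
  from twisted.X_square[OF twisted_up CARD_idxJ this]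
  show ?case using CARD_idxJ[where 'm = 'm and 'n = 'n] by (simp add: S_fa_2 del: atLeastAtMost_iff)
next
  case dn_sq
  have "ed CARD('m) * ed CARD('m) = (0 :: ('m, 'n) uq)"
    using abs_uq_rel[OF uq_rels.dn_sq] by (simp add: abs_uq_hom uq_rel_simps)
  from twisted.X_square[OF twisted_dn CARD_idxJ this]
  show ?case using CARD_idxJ[where 'm = 'm and 'n = 'n] by (simp add: S_fa_2 del: atLeastAtMost_iff)
next
  case (up_far a b)
  have "eu a * eu b = (eu b * eu a :: ('m, 'n) uq)"
    using abs_uq_rel[OF uq_rels.up_far[OF up_far]] by (simp add: abs_uq_hom uq_rel_simps)
  note X = twisted.X_quad[OF twisted_up up_far(1,2) this]
  have "rpar CARD('m) (Up a) * rpar CARD('m) (Up b) = 0" using up_far(3) by (auto simp: rpar_def)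
  then show ?case using up_far X by (simp add: S_fa_2 S_fa_diff mult.commute[where 'a = bit] del: atLeastAtMost_iff)
next
  case (dn_far a b)
  have "ed a * ed b = (ed b * ed a :: ('m, 'n) uq)"
    using abs_uq_rel[OF uq_rels.dn_far[OF dn_far]] by (simp add: abs_uq_hom uq_rel_simps)
  note X = twisted.X_quad[OF twisted_dn dn_far(1,2) this]
  have "rpar CARD('m) (Dn a) * rpar CARD('m) (Dn b) = 0" using dn_far(3) by (auto simp: rpar_def)
  then show ?case using dn_far X by (simp add: S_fa_2 S_fa_diff mult.commute[where 'a = bit] del: atLeastAtMost_iff)
next
  case (serre a b x y)
  have v: "x \<in> valid CARD('m) CARD('n)" "y \<in> valid CARD('m) CARD('n)" using serre by auto
  have p: "rpar CARD('m) x = 0" using serre by (auto simp: rpar_def)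
  have "uq_gen x * (uq_gen x * uq_gen y) - uq_scale (qq + inverse qq) (uq_gen x * (uq_gen y * uq_gen x)) +
      uq_gen y * (uq_gen x * uq_gen x) = (0 :: ('m, 'n) uq)"
    using abs_uq_rel[OF uq_rels.serre[OF serre]] by (simp add: abs_uq_hom uq_rel_simps mult.assoc)
  then have "S_gen x * (S_gen x * S_gen y) - uq_scale (qq + inverse qq) (S_gen x * (S_gen y * S_gen x)) +
      S_gen y * (S_gen x * S_gen x) = (0 :: ('m, 'n) uq)"
    using serre(5) twisted.X_serre[OF twisted_up serre(1,2)] twisted.X_serre[OF twisted_dn serre(1,2)] by blast
  then show ?case
    by (simp only: S_fa_diff S_fa_add S_fa_fscal_mult S_fa_3 v p) (simp add: mult.assoc algebra_simps)
next
  case super_serre_up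
  let ?m = "CARD('m)"
  have J: "?m - 1 \<in> idxJ CARD('m) CARD('n)" "?m \<in> idxJ CARD('m) CARD('n)" "?m + 1 \<in> idxJ CARD('m) CARD('n)"
    using super_serre_up by (simp_all only: atLeastAtMost_iff) linarith+
  have far: "eu (?m - 1) * eu (?m + 1) = (eu (?m + 1) * eu (?m - 1) :: ('m, 'n) uq)"
    using abs_uq_rel[OF uq_rels.up_far[OF J(1,3)]] by (simp add: abs_uq_hom uq_rel_simps)
  have sq: "eu ?m * eu ?m = (0 :: ('m, 'n) uq)"
    using abs_uq_rel[OF uq_rels.up_sq] by (simp add: abs_uq_hom uq_rel_simps)
  show ?case unfolding super_serre_up_eq
    by (rule S_super_serre[OF twisted_up _ _ sq far super_serre_up])
      (use abs_uq_rel[OF uq_rels.super_serre_up[OF super_serre_up], unfolded super_serre_up_eq]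
        in \<open>auto simp: rpar_def\<close>)
next
  case super_serre_dn
  let ?m = "CARD('m)"
  have J: "?m - 1 \<in> idxJ CARD('m) CARD('n)" "?m \<in> idxJ CARD('m) CARD('n)" "?m + 1 \<in> idxJ CARD('m) CARD('n)"
    using super_serre_dn by (simp_all only: atLeastAtMost_iff) linarith+
  have far: "ed (?m - 1) * ed (?m + 1) = (ed (?m + 1) * ed (?m - 1) :: ('m, 'n) uq)"
    using abs_uq_rel[OF uq_rels.dn_far[OF J(1,3)]] by (simp add: abs_uq_hom uq_rel_simps)
  have sq: "ed ?m * ed ?m = (0 :: ('m, 'n) uq)"
    using abs_uq_rel[OF uq_rels.dn_sq] by (simp add: abs_uq_hom uq_rel_simps)
  show ?case unfolding super_serre_dn_eq
    by (rule S_super_serre[OF twisted_dn _ _ sq far super_serre_dn])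
      (use abs_uq_rel[OF uq_rels.super_serre_dn[OF super_serre_dn], unfolded super_serre_dn_eq]
        in \<open>auto simp: rpar_def\<close>)
qed


section \<open>The antipode on the quotient\<close>

lemma S_fa_single_mult:
  assumes "x \<in> fa_gr s"
  shows "S_fa (Poly_Mapping.single w c * x) = ksign (word_par w * s) (uq_scale c (S_fa x * S_word w))"
    "S_fa (x * Poly_Mapping.single w c) = ksign (word_par w * s) (uq_scale c (S_word w * S_fa x))"
  using S_fa_mult[OF fa_gr_single[OF refl] assms] S_fa_mult[OF assms fa_gr_single[OF refl]]
  by (simp_all add: S_fa_single uq_scale_ksign mult.commute)

text \<open>By additivity the outer factors may be taken to be monomials. These and \<open>r\<close>
  are homogeneous, so the image is, up to sign, a product with the vanishing factor
  \<open>S_fa r\<close>.\<close>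

lemma S_fa_ideal: "x \<in> uq_ideal \<Longrightarrow> S_fa x = 0"
proof (induction rule: uq_ideal.induct)
  case (rel r x y)
  obtain p where p: "r \<in> fa_gr p" using uq_rels_gr[OF rel] by blast
  show ?case
  proof (induction x rule: fa_induct)
    case (single w c)
    show ?case
    proof (induction y rule: fa_induct)
      case (single w' c')
      have "Poly_Mapping.single w c * r \<in> fa_gr (word_par w + p)"
        by (rule fa_gr_mult[OF fa_gr_single[OF refl] p refl])
      from S_fa_single_mult(2)[OF this, of w' c'] S_fa_single_mult(1)[OF p, of w c]
      show ?case by (simp add: S_fa_rels[OF rel])
    qed (simp add: distrib_left S_fa_add)
  qed (simp add: distrib_right S_fa_add)
qed (simp_all add: S_fa_add)

definition S_uq :: "('m::finite, 'n::finite) uq \<Rightarrow> ('m, 'n) uq" where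
  "S_uq x = S_fa (rep_uq x)"

lemma S_uq_abs: "S_uq (abs_uq x) = S_fa x"
proof -
  have "abs_uq (rep_uq (abs_uq x)) = abs_uq x" by (simp add: Quotient_abs_rep[OF Quotient_uq])
  then have "rep_uq (abs_uq x) - x \<in> uq_ideal" by (simp add: uq.abs_eq_iff uq_cong_def)
  from S_fa_ideal[OF this] show ?thesis by (simp add: S_uq_def S_fa_diff)
qed

lemma S_uq_word: "S_uq (uq_word w) = S_word w"
  by (simp add: uq_word_def S_uq_abs S_fa_single)

lemma linear_S_uq: "Vector_Spaces.linear uq_scale uq_scale S_uq"
  unfolding Vector_Spaces.linear_iff
proof (intro conjI allI)
  fix x y :: "('a, 'b) uq" and c
  obtain a b where "x = abs_uq a" "y = abs_uq b" by (metis uq_exh)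
  then show "S_uq (x + y) = S_uq x + S_uq y" "S_uq (uq_scale c x) = uq_scale c (S_uq x)"
    by (simp_all add: abs_uq_hom[symmetric] uq_scale_abs S_uq_abs S_fa_add S_fa_fscal_mult)
qed (rule vector_space_uq)+

lemma S_uq_add: "S_uq (x + y) = S_uq x + S_uq y"
  using linear_S_uq unfolding Vector_Spaces.linear_iff by blast

lemma S_uq_scale: "S_uq (uq_scale c x) = uq_scale c (S_uq x)"
  using linear_S_uq unfolding Vector_Spaces.linear_iff by blast

lemma S_uq_0: "S_uq 0 = 0"
  using S_uq_abs[of 0] by (simp add: abs_uq_hom)

lemmas S_uq_simps = S_uq_add S_uq_scale S_uq_0

section \<open>Comultiplication of words and the convolution identities\<close>

lemma gen_cases:
  fixes g :: "('m::finite, 'n::finite) gen"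
  obtains (Up) a where "a \<in> idxJ CARD('m) CARD('n)" "Rep_gen g = Up a"
  | (Dn) a where "a \<in> idxJ CARD('m) CARD('n)" "Rep_gen g = Dn a"
  | (Kp) a where "a \<in> idxI CARD('m) CARD('n)" "Rep_gen g = Kp a"
  | (Km) a where "a \<in> idxI CARD('m) CARD('n)" "Rep_gen g = Km a"
  using Rep_gen_valid[of g] unfolding valid_def by blast

lemma Rep_Abs_K:
  assumes "a \<in> idxJ CARD('m::finite) CARD('n::finite)"
  shows "Rep_gen (Abs_gen (Kp a) :: ('m, 'n) gen) = Kp a" "Rep_gen (Abs_gen (Km a) :: ('m, 'n) gen) = Km a"
    "Rep_gen (Abs_gen (Kp (a + 1)) :: ('m, 'n) gen) = Kp (a + 1)"
    "Rep_gen (Abs_gen (Km (a + 1)) :: ('m, 'n) gen) = Km (a + 1)"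
  using idxJ_I[OF assms] by (simp_all only: Rep_Abs_gen valid_iff)

lemma gen_par_Abs_K:
  assumes "a \<in> idxJ CARD('m::finite) CARD('n::finite)"
  shows "gen_par (Abs_gen (Kp a) :: ('m, 'n) gen) = 0" "gen_par (Abs_gen (Km a) :: ('m, 'n) gen) = 0"
    "gen_par (Abs_gen (Kp (a + 1)) :: ('m, 'n) gen) = 0"
    "gen_par (Abs_gen (Km (a + 1)) :: ('m, 'n) gen) = 0"
  using Rep_Abs_K[OF assms] by (simp_all add: gen_par_rpar rpar_def)

lemma coprod_gen_par: "(a, b) \<in> set (coprod_gen g) \<Longrightarrow> word_par a + word_par b = gen_par g"
proof (cases g rule: gen_cases)
  case (Up i)
  assume "(a, b) \<in> set (coprod_gen g)"
  then show ?thesis using Up(2) gen_par_Abs_K[OF Up(1)] by (auto simp: coprod_gen_def)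
next
  case (Dn i)
  assume "(a, b) \<in> set (coprod_gen g)"
  then show ?thesis using Dn(2) gen_par_Abs_K[OF Dn(1)] by (auto simp: coprod_gen_def)
qed (auto simp: coprod_gen_def gen_par_rpar rpar_def)

lemma coprod_word_par: "(s, u, v) \<in> set (coprod_word w) \<Longrightarrow> word_par u + word_par v = word_par w"
proof (induction w arbitrary: s u v)
  case (Cons g w)
  from Cons.prems obtain a b s' u' v' where "(a, b) \<in> set (coprod_gen g)"
    "(s', u', v') \<in> set (coprod_word w)" "u = a @ u'" "v = b @ v'" by auto
  with coprod_gen_par[of a b g] Cons.IH[of s' u' v'] show ?case by (simp add: ac_simps)
qed simp

definition coprod_sum where
  "coprod_sum f w = (\<Sum>(s, u, v)\<leftarrow>coprod_word w. f s u v)"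

lemma coprod_sum_Nil [simp]: "coprod_sum f [] = f 0 [] []"
  by (simp add: coprod_sum_def)

lemma coprod_sum_0 [simp]: "coprod_sum (\<lambda>s u v. 0) w = (0 :: 'c::comm_monoid_add)"
  by (simp add: coprod_sum_def split_def)

lemma coprod_sum_cong:
  "(\<And>s u v. (s, u, v) \<in> set (coprod_word w) \<Longrightarrow> f s u v = f' s u v) \<Longrightarrow> coprod_sum f w = coprod_sum f' w"
  unfolding coprod_sum_def by (rule arg_cong[of _ _ sum_list], rule map_cong) auto

text \<open>With the sum over the terms of the first generator innermost, an identity for a single
  generator can be applied inside the sum for the rest of the word.\<close>

lemma coprod_sum_Cons:
  fixes f :: "_ \<Rightarrow> _ \<Rightarrow> _ \<Rightarrow> 'c::comm_monoid_add"
  shows "coprod_sum f (g # w) =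
    coprod_sum (\<lambda>s u v. \<Sum>(a, b)\<leftarrow>coprod_gen g. f (word_par b * word_par u + s) (a @ u) (b @ v)) w"
proof -
  have "(\<Sum>(s, u, v)\<leftarrow>[(word_par b * word_par u + s, a @ u, b @ v). (a, b) \<leftarrow> L, (s, u, v) \<leftarrow> W]. f s u v) =
    (\<Sum>(s, u, v)\<leftarrow>W. \<Sum>(a, b)\<leftarrow>L. f (word_par b * word_par u + s) (a @ u) (b @ v))" for L W
    by (induction L) (auto simp: sum_list_addf split_def o_def)
  then show ?thesis by (simp add: coprod_sum_def)
qed

lemma coprod_sum_additive:
  assumes "additive h"
  shows "h (coprod_sum f w) = coprod_sum (\<lambda>s u v. h (f s u v)) w"
proof -
  interpret additive h by (rule assms)
  have "h (sum_list (map F L)) = sum_list (map (\<lambda>x. h (F x)) L)" for F L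
    by (induction L) (simp_all add: add zero)
  then show ?thesis by (simp add: coprod_sum_def split_def)
qed

text \<open>Where the counit does not vanish the parity is 0; this removes the signs from the
  convolution identities.\<close>

lemma counit_gen_0: "counit_word [g] = 0 \<or> counit_word [g] = 1 \<and> gen_par g = 0"
  by (cases g rule: gen_cases) (auto simp: counit_word_def gen_par_rpar rpar_def)

lemma counit_word_par: "counit_word w = 0 \<or> word_par w = 0"
proof (induction w)
  case (Cons g w)
  then show ?case using counit_word_append[of "[g]" w] counit_gen_0[of g] by auto
qed simp

lemma S_conv_gen: "(\<Sum>(a, b)\<leftarrow>coprod_gen g. S_word a * uq_word b) = uq_scale (counit_word [g]) 1"
proof (cases g rule: gen_cases)
  case (Up a)
  have "coprod_gen g = [([g],[Abs_gen (Kp a), Abs_gen (Km (a + 1))]), ([], [g])]"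
    using Up by (simp add: coprod_gen_def)
  moreover have "eu a * ki a * kk a = (eu a :: ('a, 'b) uq)"
    by (simp only: mult.assoc ki_kk[OF Up(1), unfolded mult.assoc] mult_1_right)
  ultimately show ?thesis using Up(2) Rep_Abs_K[OF Up(1)]
    by (simp add: uq_word_Cons counit_word_def S_gen_def image_iff)
next
  case (Dn a)
  have "coprod_gen g = [([g], []), ([Abs_gen (Km a), Abs_gen (Kp (a + 1))], [g])]"
    using Dn by (simp add: coprod_gen_def)
  moreover have "km (a + 1) * kp a = (kk a :: ('a, 'b) uq)"
    by (rule K_commute(2)[OF idxJ_I[OF Dn(1)], symmetric])
  ultimately show ?thesis using Dn(2) Rep_Abs_K[OF Dn(1)] gen_par_Abs_K[OF Dn(1)]
    by (simp add: uq_word_Cons counit_word_def S_gen_def image_iff)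
next
  case (Kp a)
  then show ?thesis using km_kp[OF Kp(1)] by (simp add: coprod_gen_def uq_word_Cons counit_word_def S_gen_def)
next
  case (Km a)
  then show ?thesis using kp_km[OF Km(1)] by (simp add: coprod_gen_def uq_word_Cons counit_word_def S_gen_def)
qed

lemma S_conv_gen': "(\<Sum>(a, b)\<leftarrow>coprod_gen g. uq_word a * S_word b) = uq_scale (counit_word [g]) 1"
proof (cases g rule: gen_cases)
  case (Up a)
  have "coprod_gen g = [([g],[Abs_gen (Kp a), Abs_gen (Km (a + 1))]), ([], [g])]"
    using Up by (simp add: coprod_gen_def)
  moreover have "kp (a + 1) * km a = (ki a :: ('a, 'b) uq)"
    by (rule K_commute(2)[OF idxJ_I(2,1)[OF Up(1)]])
  ultimately show ?thesis using Up(2) Rep_Abs_K[OF Up(1)] gen_par_Abs_K[OF Up(1)]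
    by (simp add: uq_word_Cons counit_word_def S_gen_def image_iff)
next
  case (Dn a)
  have "coprod_gen g = [([g], []), ([Abs_gen (Km a), Abs_gen (Kp (a + 1))], [g])]"
    using Dn by (simp add: coprod_gen_def)
  moreover have "ki a * (kk a * ed a) = (ed a :: ('a, 'b) uq)"
    by (simp only: mult.assoc[symmetric] ki_kk[OF Dn(1), unfolded mult.assoc[symmetric]] mult_1_left)
  ultimately show ?thesis using Dn(2) Rep_Abs_K[OF Dn(1)]
    by (simp add: uq_word_Cons counit_word_def S_gen_def image_iff)
next
  case (Kp a)
  then show ?thesis using kp_km[OF Kp(1)] by (simp add: coprod_gen_def uq_word_Cons counit_word_def S_gen_def)
next
  case (Km a)
  then show ?thesis using km_kp[OF Km(1)] by (simp add: coprod_gen_def uq_word_Cons counit_word_def S_gen_def)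
qed

text \<open>The antipode reverses products, so the two factors coming from the first generator meet
  in the middle, where \<open>S_conv_gen\<close> replaces their sum by a scalar.\<close>

lemma S_conv_left: "coprod_sum (\<lambda>s u v. ksign s (S_word u * uq_word v)) w = uq_scale (counit_word w) 1"
proof (induction w)
  case (Cons g w)
  have "coprod_sum (\<lambda>s u v. ksign s (S_word u * uq_word v)) (g # w) =
    coprod_sum (\<lambda>s u v. ksign (gen_par g * word_par u + s)
      (S_word u * (\<Sum>(a, b)\<leftarrow>coprod_gen g. S_word a * uq_word b) * uq_word v)) w"
    unfolding coprod_sum_Cons
  proof (rule coprod_sum_cong)
    fix s u v
    \<comment> \<open>Stated for any list \<open>L\<close> of terms of \<open>g\<close>, to allow
      induction along the list.\<close>
    have "(\<Sum>(a, b)\<leftarrow>L. ksign (word_par b * word_par u + s) (S_word (a @ u) * uq_word (b @ v))) =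
      ksign (gen_par g * word_par u + s) (S_word u * (\<Sum>(a, b)\<leftarrow>L. S_word a * uq_word b) * uq_word v)"
      if "set L \<subseteq> set (coprod_gen g)" for L
      using that
    proof (induction L)
      case (Cons p L)
      obtain a b where p: "p = (a, b)" by (cases p)
      have g: "gen_par g = word_par a + word_par b" using Cons.prems p coprod_gen_par by fastforce
      have "ksign (word_par b * word_par u + s) (S_word (a @ u) * uq_word (b @ v)) =
        ksign (gen_par g * word_par u + s) (S_word u * (S_word a * uq_word b) * uq_word v)"
        by (simp add: S_word_append uq_word_append ksign_mult_left ksign_ksign g mult.assoc distrib_right ac_simps(1-3)[where 'a = bit])
      with Cons p show ?case by (simp add: ksign_add distrib_left distrib_right)
    qed simp
    then show "(\<Sum>(a, b)\<leftarrow>coprod_gen g. ksign (word_par b * word_par u + s) (S_word (a @ u) * uq_word (b @ v))) =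
      ksign (gen_par g * word_par u + s) (S_word u * (\<Sum>(a, b)\<leftarrow>coprod_gen g. S_word a * uq_word b) * uq_word v)"
      by blast
  qed
  also have "\<dots> = uq_scale (counit_word (g # w)) 1"
    using counit_gen_0[of g] counit_word_append[of "[g]" w] Cons
    by (auto simp: S_conv_gen)
  finally show ?case .
qed (simp add: counit_word_def)

text \<open>Here it is the factors coming from the rest of the word that meet in the middle. Their
  sum is a scalar by induction, and \<open>S_conv_gen'\<close> then treats the first
  generator.\<close>

lemma S_conv_right: "coprod_sum (\<lambda>s u v. ksign s (uq_word u * S_word v)) w = uq_scale (counit_word w) 1"
proof (induction w)
  case (Cons g w)
  have "coprod_sum (\<lambda>s u v. ksign s (uq_word u * S_word v)) (g # w) =
    coprod_sum (\<lambda>s u v. \<Sum>(a, b)\<leftarrow>coprod_gen g.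
      ksign (word_par b * word_par w) (uq_word a * ksign s (uq_word u * S_word v) * S_word b)) w"
    unfolding coprod_sum_Cons
  proof (rule coprod_sum_cong)
    fix s u v
    assume uv: "(s, u, v) \<in> set (coprod_word w)"
    have w: "word_par w = word_par u + word_par v" using coprod_word_par[OF uv] by simp
    have "ksign (word_par b * word_par u + s) (uq_word (a @ u) * S_word (b @ v)) =
      ksign (word_par b * word_par w) (uq_word a * ksign s (uq_word u * S_word v) * S_word b)" for a b
      by (simp add: S_word_append uq_word_append ksign_mult_left ksign_mult_right ksign_ksign w mult.assoc
          distrib_left ac_simps(1-3)[where 'a = bit])
    then show "(\<Sum>(a, b)\<leftarrow>coprod_gen g. ksign (word_par b * word_par u + s) (uq_word (a @ u) * S_word (b @ v))) =
      (\<Sum>(a, b)\<leftarrow>coprod_gen g. ksign (word_par b * word_par w) (uq_word a * ksign s (uq_word u * S_word v) * S_word b))"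
      by simp
  qed
  also have "\<dots> = (\<Sum>(a, b)\<leftarrow>coprod_gen g. ksign (word_par b * word_par w)
      (uq_word a * coprod_sum (\<lambda>s u v. ksign s (uq_word u * S_word v)) w * S_word b))"
  proof (rule coprod_sum_additive[of "\<lambda>z. \<Sum>(a, b)\<leftarrow>coprod_gen g. ksign (word_par b * word_par w) (uq_word a * z * S_word b)", symmetric])
    show "additive (\<lambda>z. \<Sum>(a, b)\<leftarrow>coprod_gen g. ksign (word_par b * word_par w) (uq_word a * z * S_word b))"
      by unfold_locales (simp add: sum_list_addf[symmetric] split_def distrib_left distrib_right ksign_add)
  qed
  also have "\<dots> = uq_scale (counit_word w) (\<Sum>(a, b)\<leftarrow>coprod_gen g. uq_word a * S_word b)"
  proof -
    have "(\<Sum>(a, b)\<leftarrow>L. ksign (word_par b * word_par w) (uq_word a * uq_scale (counit_word w) 1 * S_word b)) =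
      uq_scale (counit_word w) (\<Sum>(a, b)\<leftarrow>L. uq_word a * S_word b)" for L
      using counit_word_par[of w] by (induction L) (auto simp: uq.scale_right_distrib)
    then show ?thesis by (simp only: Cons)
  qed
  also have "\<dots> = uq_scale (counit_word (g # w)) 1"
    using counit_word_append[of "[g]" w] by (simp add: S_conv_gen' uq.scale_scale mult.commute)
  finally show ?case .
qed (simp add: counit_word_def)


text \<open>The comultiplication of a word \<open>w\<close> has the term \<open>k \<otimes> w\<close> with \<open>k\<close> a product of \<open>K\<close>'s, and all other
  right factors contain fewer root generators. This triangularity determines a right convolution
  inverse of the identity.\<close>

definition root_count :: "('m::finite, 'n::finite) gen list \<Rightarrow> nat" where
  "root_count w = length (filter (\<lambda>g. Rep_gen g \<notin> range Kp \<union> range Km) w)"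

lemma root_count_simps [simp]:
  "root_count [] = 0" "root_count (u @ v) = root_count u + root_count v"
  "root_count (g # w) = (if Rep_gen g \<in> range Kp \<union> range Km then 0 else 1) + root_count w"
  by (simp_all add: root_count_def)

lemma coprod_triangular:
  fixes w :: "('m::finite, 'n::finite) gen list"
  shows "\<exists>k R. (\<exists>k'. k' * uq_word k = (1 :: ('m, 'n) uq)) \<and> word_par k = 0 \<and>
     (\<forall>(s, u, v)\<in>set R. root_count v < root_count w) \<and>
     (\<forall>f :: bit \<Rightarrow> _ \<Rightarrow> _ \<Rightarrow> ('m, 'n) uq. coprod_sum f w = f 0 k w + (\<Sum>(s, u, v)\<leftarrow>R. f s u v))"
proof (induction w)
  case Nil
  show ?case by (rule exI[of _ "[]"], rule exI[of _ "[]"]) (auto intro: exI[of _ 1])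
next
  case (Cons g w)
  obtain k k' R where k: "k' * uq_word k = (1 :: ('m, 'n) uq)" "word_par k = 0"
    and R: "\<forall>(s, u, v)\<in>set R. root_count v < root_count w"
    and f: "\<And>f :: bit \<Rightarrow> _ \<Rightarrow> _ \<Rightarrow> ('m, 'n) uq. coprod_sum f w = f 0 k w + (\<Sum>(s, u, v)\<leftarrow>R. f s u v)"
    using Cons by blast
  \<comment> \<open>In each case it suffices to name the left factor \<open>a\<close> that
    accompanies \<open>g\<close> on the right, a left inverse \<open>x\<close> of it, and the
    remaining terms.\<close>
  have *: ?case if "x * uq_word a = (1 :: ('m, 'n) uq)" "word_par a = 0"
    "\<forall>(s, u, v)\<in>set R'. root_count v < root_count (g # w)"
    "\<And>f :: bit \<Rightarrow> _ \<Rightarrow> _ \<Rightarrow> ('m, 'n) uq.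
      coprod_sum f (g # w) = f 0 (a @ k) (g # w) + (\<Sum>(s, u, v)\<leftarrow>R'. f s u v)" for x a R'
  proof (rule exI[of _ "a @ k"], rule exI[of _ R'], intro conjI)
    have "(k' * x) * uq_word (a @ k) = k' * (x * uq_word a) * uq_word k"
      by (simp only: uq_word_append mult.assoc)
    then show "\<exists>k''. k'' * uq_word (a @ k) = (1 :: ('m, 'n) uq)" using k that(1) by auto
  qed (use that k in auto)
  let ?T = "\<lambda>a b R. [(word_par b * word_par u + s, a @ u, b @ v). (s, u, v) \<leftarrow> R]"
  show ?case
  proof (cases g rule: gen_cases)
    case (Up i)
    note K = Rep_Abs_K[OF Up(1)] gen_par_Abs_K[OF Up(1)]
    have c: "coprod_gen g = [([g],[Abs_gen (Kp i), Abs_gen (Km (i + 1))]), ([], [g])]"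
      using Up by (simp add: coprod_gen_def)
    have g: "Rep_gen g \<notin> range Kp \<union> range Km" using Up by auto
    show ?thesis
    \<comment> \<open>The term of a raising generator with \<open>g\<close> on the right has left
      factor 1; the other term trades \<open>g\<close> for Cartan generators, which lowers the
      count.\<close>
    proof (rule *[of 1 "[]" "(0, g # k, Abs_gen (Kp i) # Abs_gen (Km (i + 1)) # w) #
        ?T [g] [Abs_gen (Kp i), Abs_gen (Km (i + 1))] R @ ?T [] [g] R"])
      show "\<forall>(s, u, v)\<in>set ((0, g # k, Abs_gen (Kp i) # Abs_gen (Km (i + 1)) # w) #
        ?T [g] [Abs_gen (Kp i), Abs_gen (Km (i + 1))] R @ ?T [] [g] R). root_count v < root_count (g # w)"
        using R g K by fastforce
    qed (use k K in \<open>simp_all add: coprod_sum_Cons f c split_def sum_list_addf o_def add_ac\<close>)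
  next
    case (Dn i)
    note K = Rep_Abs_K[OF Dn(1)] gen_par_Abs_K[OF Dn(1)]
    have c: "coprod_gen g = [([g], []), ([Abs_gen (Km i), Abs_gen (Kp (i + 1))], [g])]"
      using Dn by (simp add: coprod_gen_def)
    have g: "Rep_gen g \<notin> range Kp \<union> range Km" using Dn by auto
    show ?thesis
    \<comment> \<open>For a lowering generator the left factor is \<open>ki i\<close>, with inverse
      \<open>kk i\<close>.\<close>
    proof (rule *[of "kk i" "[Abs_gen (Km i), Abs_gen (Kp (i + 1))]" "(0, g # k, w) #
        ?T [g] [] R @ ?T [Abs_gen (Km i), Abs_gen (Kp (i + 1))] [g] R"])
      show "\<forall>(s, u, v)\<in>set ((0, g # k, w) #
        ?T [g] [] R @ ?T [Abs_gen (Km i), Abs_gen (Kp (i + 1))] [g] R). root_count v < root_count (g # w)"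
        using R g K by fastforce
      show "kk i * uq_word [Abs_gen (Km i), Abs_gen (Kp (i + 1))] = (1 :: ('m, 'n) uq)"
        using kk_ki[OF Dn(1)] K by (simp add: uq_word_Cons)
    qed (use k K in \<open>simp_all add: coprod_sum_Cons f c split_def sum_list_addf o_def add_ac\<close>)
  next
    case (Kp i)
    have c: "coprod_gen g = [([g], [g])]" using Kp by (simp add: coprod_gen_def)
    have g: "gen_par g = 0" "Rep_gen g \<in> range Kp \<union> range Km" using Kp by (simp_all add: gen_par_rpar rpar_def)
    show ?thesis
    proof (rule *[of "km i" "[g]" "?T [g] [g] R"])
      show "km i * uq_word [g] = (1 :: ('m, 'n) uq)" using km_kp[OF Kp(1)] Kp(2) by (simp add: uq_word_Cons)
    qed (use k R g in \<open>auto simp: coprod_sum_Cons f c split_def o_def\<close>)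
  next
    case (Km i)
    have c: "coprod_gen g = [([g], [g])]" using Km by (simp add: coprod_gen_def)
    have g: "gen_par g = 0" "Rep_gen g \<in> range Kp \<union> range Km" using Km by (simp_all add: gen_par_rpar rpar_def)
    show ?thesis
    proof (rule *[of "kp i" "[g]" "?T [g] [g] R"])
      show "kp i * uq_word [g] = (1 :: ('m, 'n) uq)" using kp_km[OF Km(1)] Km(2) by (simp add: uq_word_Cons)
    qed (use k R g in \<open>auto simp: coprod_sum_Cons f c split_def o_def\<close>)
  qed
qed

text \<open>Existence is given by the two convolution identities. Uniqueness is an induction on
  \<open>root_count\<close>: in the right identity for \<open>w\<close> the values on all other
  right factors are known, and the invertible factor \<open>uq_word k\<close> can be
  cancelled.\<close>

lemma antipode_eq: "antipode = (S_uq :: ('m::finite, 'n::finite) uq \<Rightarrow> _)"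
  unfolding antipode_def
proof (rule the_equality)
  show "Vector_Spaces.linear uq_scale uq_scale (S_uq :: ('m, 'n) uq \<Rightarrow> _) \<and>
     (\<forall>w. (\<Sum>(s, u, v)\<leftarrow>coprod_word w. ksign s (S_uq (uq_word u) * uq_word v)) =
            uq_scale (counit_word w) (1 :: ('m, 'n) uq) \<and>
          (\<Sum>(s, u, v)\<leftarrow>coprod_word w. ksign s (uq_word u * S_uq (uq_word v))) =
            uq_scale (counit_word w) (1 :: ('m, 'n) uq))"
    using linear_S_uq S_conv_left S_conv_right by (auto simp: S_uq_word coprod_sum_def)
next
  fix T :: "('m, 'n) uq \<Rightarrow> ('m, 'n) uq"
  assume T: "Vector_Spaces.linear uq_scale uq_scale T \<and>
     (\<forall>w. (\<Sum>(s, u, v)\<leftarrow>coprod_word w. ksign s (T (uq_word u) * uq_word v)) =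
            uq_scale (counit_word w) 1 \<and>
          (\<Sum>(s, u, v)\<leftarrow>coprod_word w. ksign s (uq_word u * T (uq_word v))) =
            uq_scale (counit_word w) 1)"
  have "T (uq_word w) = S_word w" for w
  proof (induction "root_count w" arbitrary: w rule: less_induct)
    case less
    obtain k k' R where k: "k' * uq_word k = (1 :: ('m, 'n) uq)"
      and R: "\<forall>(s, u, v)\<in>set R. root_count v < root_count w"
      and f: "\<And>f :: bit \<Rightarrow> _ \<Rightarrow> _ \<Rightarrow> ('m, 'n) uq. coprod_sum f w = f 0 k w + (\<Sum>(s, u, v)\<leftarrow>R. f s u v)"
      using coprod_triangular[of w] by blast
    have "coprod_sum (\<lambda>s u v. ksign s (uq_word u * T (uq_word v))) w =
        coprod_sum (\<lambda>s u v. ksign s (uq_word u * S_word v)) w"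
      using T S_conv_right[of w] by (simp add: coprod_sum_def)
    moreover have "(\<Sum>(s, u, v)\<leftarrow>R. ksign s (uq_word u * T (uq_word v))) =
        (\<Sum>(s, u, v)\<leftarrow>R. ksign s (uq_word u * S_word v))"
      using R less by (intro arg_cong[of _ _ sum_list] map_cong) auto
    ultimately have "uq_word k * T (uq_word w) = uq_word k * S_word w" unfolding f by simp
    then have "k' * uq_word k * T (uq_word w) = k' * uq_word k * S_word w" by (simp only: mult.assoc)
    then show ?case by (simp add: k)
  qed
  then show "T = S_uq"
  proof (intro ext)
    fix x assume *: "\<And>w. T (uq_word w) = S_word w"
    show "T x = S_uq x"
      by (induction x rule: uq_induct) (use T in \<open>simp_all add: Vector_Spaces.linear_iff S_uq_simps S_uq_word *\<close>)
  qed
qed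

section \<open>Gradings\<close>

text \<open>Formulated for subgroups and without scalars, so that one set of facts serves the free
  algebra, its ideal, the quotient, modules, duals and spaces of linear maps.\<close>

definition grading :: "(bit \<Rightarrow> 'v::ab_group_add set) \<Rightarrow> bool" where
  "grading G \<longleftrightarrow> (\<forall>s. 0 \<in> G s \<and> (\<forall>u\<in>G s. \<forall>v\<in>G s. u - v \<in> G s)) \<and> G 0 \<inter> G 1 = {0}"

definition gtot :: "(bit \<Rightarrow> 'v::ab_group_add set) \<Rightarrow> 'v set" where
  "gtot G = {u + v | u v. u \<in> G 0 \<and> v \<in> G 1}"

definition gtw :: "(bit \<Rightarrow> 'v::ab_group_add set) \<Rightarrow> bit \<Rightarrow> 'v \<Rightarrow> 'v" where
  "gtw G s v = (\<Sum>t\<in>{0, 1}. ksign (s * t) (hcomp G t v))"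

lemma bit_exh: obtains "s = (0::bit)" | "s = 1"
  by (cases "s = 0") auto

context
  fixes G :: "bit \<Rightarrow> 'v::ab_group_add set"
  assumes G: "grading G"
begin

lemma gr_0: "0 \<in> G s"
  using G by (auto simp: grading_def)

lemma gr_diff: "u \<in> G s \<Longrightarrow> v \<in> G s \<Longrightarrow> u - v \<in> G s"
  using G by (auto simp: grading_def)

lemma gr_uminus: "u \<in> G s \<Longrightarrow> - u \<in> G s"
  using gr_diff[OF gr_0, of u s] by simp

lemma gr_add: "u \<in> G s \<Longrightarrow> v \<in> G s \<Longrightarrow> u + v \<in> G s"
  using gr_diff[OF _ gr_uminus, of u s v] by simp

lemma gr_ksign: "u \<in> G s \<Longrightarrow> ksign t u \<in> G s"
  by (simp add: ksign_def gr_uminus)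

lemma gr_inter: "u \<in> G s \<Longrightarrow> u \<in> G (s + 1) \<Longrightarrow> u = 0"
  using G by (cases s rule: bit_exh) (auto simp: grading_def)

lemma gr_unique:
  assumes "u \<in> G s" "v \<in> G (s + 1)" "u' \<in> G s" "v' \<in> G (s + 1)" "u + v = u' + v'"
  shows "u = u'" "v = v'"
proof -
  have eq: "u - u' = v' - v" using assms(5) by (simp add: algebra_simps)
  then have "u - u' \<in> G (s + 1)" using gr_diff[OF assms(4,2)] by simp
  with gr_diff[OF assms(1,3)] have "u - u' = 0" by (rule gr_inter)
  with eq show "u = u'" "v = v'" by simp_all
qed

lemma hcomp_eq: "u \<in> G s \<Longrightarrow> v - u \<in> G (s + 1) \<Longrightarrow> hcomp G s v = u"
  unfolding hcomp_def
proof (rule the_equality)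
  fix w assume "u \<in> G s" "v - u \<in> G (s + 1)" "w \<in> G s \<and> v - w \<in> G (s + 1)"
  then show "w = u" by (intro gr_unique(1)[of w s "v - w" u "v - u"]) simp_all
qed simp

lemma hcomp_same: "u \<in> G s \<Longrightarrow> hcomp G s u = u"
  by (rule hcomp_eq) (simp_all add: gr_0)

lemma hcomp_other: "u \<in> G (s + 1) \<Longrightarrow> hcomp G s u = 0"
  by (rule hcomp_eq) (simp_all add: gr_0)

lemma hcomp_gr: "u \<in> G t \<Longrightarrow> hcomp G s u = (if s = t then u else 0)"
  using hcomp_same hcomp_other[of u s] by (auto simp: bit_neq_iff)

lemma gtotI: "u \<in> G s \<Longrightarrow> v \<in> G (s + 1) \<Longrightarrow> u + v \<in> gtot G"
proof (cases s rule: bit_exh)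
  case 1
  assume "u \<in> G s" "v \<in> G (s + 1)"
  with 1 show ?thesis unfolding gtot_def by auto
next
  case 2
  assume "u \<in> G s" "v \<in> G (s + 1)"
  with 2 have "u + v = v + u" "v \<in> G 0" "u \<in> G 1" by (simp_all add: add.commute)
  then show ?thesis unfolding gtot_def by blast
qed

lemma gtot_gr: "u \<in> G s \<Longrightarrow> u \<in> gtot G"
  using gtotI[OF _ gr_0, of u s] by simp

lemma gtotE:
  assumes "v \<in> gtot G"
  obtains u w where "v = u + w" "u \<in> G s" "w \<in> G (s + 1)"
proof -
  obtain a b where ab: "v = a + b" "a \<in> G 0" "b \<in> G 1" using assms by (auto simp: gtot_def)
  show thesis
    using that[of a b] that[of b a] ab by (cases s rule: bit_exh) (simp_all add: add.commute)
qed

lemma hcomp_in: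
  assumes "v \<in> gtot G" shows "hcomp G s v \<in> G s"
proof -
  obtain u w where "v = u + w" "u \<in> G s" "w \<in> G (s + 1)" by (rule gtotE[OF assms])
  then show ?thesis using hcomp_eq[of u s v] by simp
qed

lemma hcomp_split:
  assumes "v \<in> gtot G" shows "v = hcomp G s v + hcomp G (s + 1) v"
proof -
  obtain u w where "v = u + w" "u \<in> G s" "w \<in> G (s + 1)" by (rule gtotE[OF assms])
  then show ?thesis using hcomp_eq[of u s v] hcomp_eq[of w "s + 1" v] by (simp add: add.assoc)
qed

lemma hcomp_sum: "v \<in> gtot G \<Longrightarrow> (\<Sum>s\<in>{0, 1}. hcomp G s v) = v"
  using hcomp_split[of v 0] by simp

lemma gtot_0: "0 \<in> gtot G"
  by (rule gtot_gr[OF gr_0])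

lemma gtot_add:
  assumes "u \<in> gtot G" "v \<in> gtot G" shows "u + v \<in> gtot G"
proof -
  have "u + v = (hcomp G 0 u + hcomp G 0 v) + (hcomp G 1 u + hcomp G 1 v)"
    using hcomp_split[OF assms(1), of 0] hcomp_split[OF assms(2), of 0] by (simp add: algebra_simps)
  then show ?thesis using gtotI[of "hcomp G 0 u + hcomp G 0 v" 0] hcomp_in assms gr_add by simp
qed

lemma hcomp_add:
  assumes "u \<in> gtot G" "v \<in> gtot G" shows "hcomp G s (u + v) = hcomp G s u + hcomp G s v"
proof (rule hcomp_eq)
  have "u + v - (hcomp G s u + hcomp G s v) = hcomp G (s + 1) u + hcomp G (s + 1) v"
    using hcomp_split[OF assms(1), of s] hcomp_split[OF assms(2), of s] by (simp add: algebra_simps)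
  then show "u + v - (hcomp G s u + hcomp G s v) \<in> G (s + 1)" using hcomp_in assms gr_add by simp
qed (use hcomp_in assms gr_add in auto)

lemma gtot_uminus:
  assumes "u \<in> gtot G" shows "- u \<in> gtot G"
proof -
  obtain a b where "u = a + b" "a \<in> G 0" "b \<in> G (0 + 1)" by (rule gtotE[OF assms])
  then have "- u = - a + - b" "- a \<in> G 0" "- b \<in> G (0 + 1)" using gr_uminus by simp_all
  then show ?thesis using gtotI[of "- a" 0 "- b"] by simp
qed

lemma gtot_ksign: "u \<in> gtot G \<Longrightarrow> ksign s u \<in> gtot G"
  by (simp add: ksign_def gtot_uminus)

lemma gtot_sum: "(\<And>i. i \<in> I \<Longrightarrow> f i \<in> gtot G) \<Longrightarrow> sum f I \<in> gtot G"
  by (induction I rule: infinite_finite_induct) (auto simp: gtot_0 gtot_add)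

lemma gtw_in: "v \<in> gtot G \<Longrightarrow> gtw G s v \<in> gtot G"
  unfolding gtw_def by (intro gtot_sum gtot_ksign) (rule gtot_gr, rule hcomp_in)

lemma gtw_gr: "v \<in> G t \<Longrightarrow> gtw G s v = ksign (s * t) v"
  by (cases t rule: bit_exh) (simp_all add: gtw_def hcomp_gr)

lemma gtw_gr_in: "v \<in> G t \<Longrightarrow> gtw G s v \<in> G t"
  by (simp add: gtw_gr gr_ksign)

lemma gtw_add: "u \<in> gtot G \<Longrightarrow> v \<in> gtot G \<Longrightarrow> gtw G s (u + v) = gtw G s u + gtw G s v"
  unfolding gtw_def by (simp only: hcomp_add ksign_add sum.distrib)

lemma gtw_0_left: "v \<in> gtot G \<Longrightarrow> gtw G 0 v = v"
  using hcomp_sum[of v] by (simp add: gtw_def)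

lemma gtw_0_right [simp]: "gtw G s 0 = 0"
  by (simp add: gtw_gr[OF gr_0[of 0]])

lemma gtot_induct [consumes 1, case_names gr add]:
  assumes "v \<in> gtot G" "\<And>s u. u \<in> G s \<Longrightarrow> Q u"
    "\<And>u w. u \<in> gtot G \<Longrightarrow> w \<in> gtot G \<Longrightarrow> Q u \<Longrightarrow> Q w \<Longrightarrow> Q (u + w)"
  shows "Q v"
proof -
  obtain a b where "v = a + b" "a \<in> G 0" "b \<in> G (0 + 1)" by (rule gtotE[OF assms(1)])
  then show ?thesis using assms(2)[of a 0] assms(2)[of b 1] assms(3)[of a b] gtot_gr by simp
qed

lemma gtw_ksign: "v \<in> gtot G \<Longrightarrow> gtw G s (ksign t v) = ksign t (gtw G s v)"
proof (induction v rule: gtot_induct)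
  case (gr r u)
  then show ?case by (simp add: gtw_gr[of _ r] gr_ksign ksign_ksign add.commute)
qed (simp add: gtw_add ksign_add gtot_ksign)

lemma gtw_gtw: "v \<in> gtot G \<Longrightarrow> gtw G s (gtw G t v) = gtw G (s + t) v"
proof (induction v rule: gtot_induct)
  case (gr r u)
  then show ?case by (simp add: gtw_gr[of _ r] gr_ksign ksign_ksign distrib_right)
qed (simp add: gtw_add gtw_in)

end

section \<open>The grading of the quantum superalgebra\<close>

lemma uq_gr_def': "uq_gr s = abs_uq ` fa_gr s"
  by (auto simp: uq_gr_def fa_gr_def)

lemma fa_gr_inter: "x \<in> fa_gr 0 \<Longrightarrow> x \<in> fa_gr 1 \<Longrightarrow> x = 0"
proof -
  assume "x \<in> fa_gr 0" "x \<in> fa_gr 1"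
  then have "Poly_Mapping.keys x = {}" by (auto simp: fa_gr_def)
  then show ?thesis by simp
qed

lemma grading_fa: "grading fa_gr"
  unfolding grading_def using fa_gr_inter fa_gr_0 by (auto intro: fa_gr_diff)

lemma fa_gr_tot: "x \<in> gtot fa_gr"
  using fa_gr_split[of x] by (auto simp: gtot_def)

text \<open>The ideal is generated by homogeneous elements, and its elements are sums of products in
  which all three factors may be taken homogeneous.\<close>

lemma uq_ideal_graded: "x \<in> uq_ideal \<Longrightarrow> x \<in> gtot (\<lambda>s. fa_gr s \<inter> uq_ideal)"
proof -
  have gr: "grading (\<lambda>s. fa_gr s \<inter> uq_ideal :: ('a, 'b) fa set)"
    using grading_fa unfolding grading_def by (auto intro: uq_ideal.zero uq_ideal_diff)
  show "x \<in> uq_ideal \<Longrightarrow> x \<in> gtot (\<lambda>s. fa_gr s \<inter> uq_ideal)" for x :: "('a, 'b) fa"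
  proof (induction rule: uq_ideal.induct)
    case zero
    show ?case by (rule gtot_0[OF gr])
  next
    case (add x y)
    then show ?case by (intro gtot_add[OF gr])
  next
    case (rel r x y)
    obtain p where p: "r \<in> fa_gr p" using uq_rels_gr[OF rel] by blast
    show ?case using fa_gr_tot[of x]
    proof (induction x rule: gtot_induct[OF grading_fa, consumes 1])
      case (1 s u)
      show ?case using fa_gr_tot[of y]
      proof (induction y rule: gtot_induct[OF grading_fa, consumes 1])
        case (1 t v)
        have "u * r * v \<in> fa_gr (s + p + t) \<inter> uq_ideal"
          using fa_gr_mult[OF fa_gr_mult[OF \<open>u \<in> fa_gr s\<close> p refl] 1 refl] uq_ideal.rel[OF rel] by blast
        then show ?case by (rule gtot_gr[OF gr])
      qed (simp add: distrib_left gtot_add[OF gr])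
    qed (simp add: distrib_right gtot_add[OF gr])
  qed
qed

lemma uq_gr_inter:
  assumes "x \<in> uq_gr 0" "x \<in> uq_gr 1" shows "x = 0"
proof -
  obtain a b where ab: "x = abs_uq a" "a \<in> fa_gr 0" "x = abs_uq b" "b \<in> fa_gr 1"
    using assms unfolding uq_gr_def' by (elim imageE) simp
  then have "a - b \<in> uq_ideal" by (simp add: uq.abs_eq_iff[symmetric] uq_cong_def[symmetric])
  then obtain u v where uv: "a + - b = u + v" "u \<in> fa_gr 0" "v \<in> fa_gr 1" "u \<in> uq_ideal"
    using uq_ideal_graded[of "a - b"] by (auto simp: gtot_def)
  \<comment> \<open>The even component of the ideal element \<open>a - b\<close> is
    \<open>a\<close>, and it lies in the ideal because the ideal is graded.\<close>
  have "a = u"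
    by (rule gr_unique(1)[OF grading_fa, of a 0 "- b" u v]) (use ab uv fa_gr_uminus in auto)
  then show ?thesis using uv ab by (simp add: abs_uq_ideal)
qed

lemma grading_uq: "grading uq_gr"
  unfolding grading_def
proof (intro conjI allI ballI)
  show "0 \<in> uq_gr s" for s unfolding uq_gr_def' using fa_gr_0 by (metis abs_uq_hom(5) imageI)
  then show "uq_gr 0 \<inter> uq_gr 1 = {0}" using uq_gr_inter by auto
  show "u - v \<in> uq_gr s" if "u \<in> uq_gr s" "v \<in> uq_gr s" for u v s
    using that by (auto simp: uq_gr_def' abs_uq_hom[symmetric] intro!: imageI fa_gr_diff)
qed

lemma uq_tot: "x \<in> gtot uq_gr"
proof -
  obtain a where "x = abs_uq a" by (rule uq_exh)
  moreover obtain u v where "a = u + v" "u \<in> fa_gr 0" "v \<in> fa_gr 1" using fa_gr_split[of a] by blast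
  ultimately show ?thesis
    using gtotI[OF grading_uq, of "abs_uq u" 0 "abs_uq v"] by (simp add: abs_uq_hom uq_gr_def')
qed

lemmas uq_hcomp_in = hcomp_in[OF grading_uq uq_tot]
lemmas uq_hcomp_split = hcomp_split[OF grading_uq uq_tot]
lemmas uq_hcomp_gr = hcomp_gr[OF grading_uq]
lemmas uq_hcomp_add = hcomp_add[OF grading_uq uq_tot uq_tot]

lemma uq_gr_mult: "x \<in> uq_gr s \<Longrightarrow> y \<in> uq_gr t \<Longrightarrow> x * y \<in> uq_gr (s + t)"
  unfolding uq_gr_def' using fa_gr_mult[OF _ _ refl] by (force simp: abs_uq_hom)

lemma uq_gr_scale: "x \<in> uq_gr s \<Longrightarrow> uq_scale c x \<in> uq_gr s"
  unfolding uq_gr_def' using fa_gr_mult[OF fa_gr_fscal _ add_0_left] by (force simp: uq_scale_abs)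

lemma uq_gr_1: "1 \<in> uq_gr 0"
  unfolding uq_gr_def' using fa_gr_1 by (metis abs_uq_hom(6) imageI)

lemma uq_gr_word: "uq_word w \<in> uq_gr (word_par w)"
  unfolding uq_gr_def' uq_word_def by (rule imageI, rule fa_gr_single) simp

lemma uq_gr_gen: "g \<in> valid CARD('m) CARD('n) \<Longrightarrow>
    (uq_gen g :: ('m::finite, 'n::finite) uq) \<in> uq_gr (rpar CARD('m) g)"
  unfolding uq_gr_def' uq_gen_def by (rule imageI, rule fa_gr_fgen) simp_all

lemma uq_hcomp_scale: "hcomp uq_gr s (uq_scale c x) = uq_scale c (hcomp uq_gr s x)"
proof (rule hcomp_eq[OF grading_uq])
  have "uq_scale c x = uq_scale c (hcomp uq_gr s x) + uq_scale c (hcomp uq_gr (s + 1) x)"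
    by (subst uq_hcomp_split[of x s]) (rule uq.scale_right_distrib)
  then have "uq_scale c x - uq_scale c (hcomp uq_gr s x) = uq_scale c (hcomp uq_gr (s + 1) x)"
    by (simp only: add_diff_cancel_left')
  then show "uq_scale c x - uq_scale c (hcomp uq_gr s x) \<in> uq_gr (s + 1)"
    by (simp add: uq_gr_scale uq_hcomp_in)
qed (simp add: uq_gr_scale uq_hcomp_in)

lemma uq_hcomp_0: "hcomp uq_gr s 0 = 0"
  by (simp add: uq_hcomp_gr[OF gr_0[OF grading_uq, of s]])

lemma uq_gr_induct [case_names gr add]:
  assumes "\<And>s x. x \<in> uq_gr s \<Longrightarrow> Q x" "\<And>x y. Q x \<Longrightarrow> Q y \<Longrightarrow> Q (x + y)"
  shows "Q x"
  by (rule gtot_induct[OF grading_uq uq_tot]) (use assms in auto)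

lemma S_gen_gr:
  fixes g :: "('m::finite, 'n::finite) gen"
  shows "(S_gen (Rep_gen g) :: ('m, 'n) uq) \<in> uq_gr (gen_par g)"
proof (cases g rule: gen_cases)
  case (Up a)
  then have v: "Up a \<in> valid CARD('m) CARD('n)" "Km a \<in> valid CARD('m) CARD('n)" "Kp (a + 1) \<in> valid CARD('m) CARD('n)"
    using idxJ_I[OF Up(1)] by (simp_all only: valid_iff)
  from uq_gr_mult[OF uq_gr_gen[OF v(1)] uq_gr_mult[OF uq_gr_gen[OF v(2)] uq_gr_gen[OF v(3)]]] Up(2)
  show ?thesis by (simp add: S_gen_def gen_par_rpar rpar_def gr_uminus[OF grading_uq] split: if_splits)
next
  case (Dn a)
  then have v: "Dn a \<in> valid CARD('m) CARD('n)" "Kp a \<in> valid CARD('m) CARD('n)" "Km (a + 1) \<in> valid CARD('m) CARD('n)"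
    using idxJ_I[OF Dn(1)] by (simp_all only: valid_iff)
  from uq_gr_mult[OF uq_gr_mult[OF uq_gr_gen[OF v(2)] uq_gr_gen[OF v(3)]] uq_gr_gen[OF v(1)]] Dn(2)
  show ?thesis by (simp add: S_gen_def gen_par_rpar rpar_def gr_uminus[OF grading_uq] split: if_splits)
next
  case (Kp a)
  then show ?thesis using uq_gr_gen[where 'm = 'm and 'n = 'n, of "Km a"]
    by (simp add: S_gen_def gen_par_rpar rpar_def)
next
  case (Km a)
  then show ?thesis using uq_gr_gen[where 'm = 'm and 'n = 'n, of "Kp a"]
    by (simp add: S_gen_def gen_par_rpar rpar_def)
qed

lemma S_word_gr: "S_word w \<in> uq_gr (word_par w)"
proof (induction w)
  case (Cons g w)
  from uq_gr_mult[OF this S_gen_gr[of g]] show ?case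
    by (simp add: gr_ksign[OF grading_uq] add.commute)
qed (simp add: uq_gr_1)

lemma S_uq_gr:
  assumes "x \<in> uq_gr s" shows "S_uq x \<in> uq_gr s"
proof -
  obtain a where a: "x = abs_uq a" "a \<in> fa_gr s" using assms by (auto simp: uq_gr_def')
  have "S_fa a \<in> uq_gr s" using a(2)
  proof (induction a rule: fa_gr_induct)
    case (single w c)
    then show ?case using S_word_gr[of w] by (simp add: S_fa_single uq_gr_scale)
  qed (simp_all add: S_fa_add gr_add[OF grading_uq] gr_0[OF grading_uq])
  then show ?thesis by (simp add: a S_uq_abs)
qed

lemma S_uq_mult:
  assumes "x \<in> uq_gr s" "y \<in> uq_gr t" shows "S_uq (x * y) = ksign (s * t) (S_uq y * S_uq x)"
proof -
  obtain a b where "x = abs_uq a" "a \<in> fa_gr s" "y = abs_uq b" "b \<in> fa_gr t"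
    using assms by (auto simp: uq_gr_def')
  then show ?thesis by (simp add: abs_uq_hom[symmetric] S_uq_abs S_fa_mult)
qed

lemma S_uq_hcomp: "S_uq (hcomp uq_gr s x) = hcomp uq_gr s (S_uq x)"
proof (rule hcomp_eq[OF grading_uq, symmetric])
  have "S_uq x = S_uq (hcomp uq_gr s x) + S_uq (hcomp uq_gr (s + 1) x)"
    by (subst uq_hcomp_split[of x s]) (rule S_uq_add)
  then have "S_uq x - S_uq (hcomp uq_gr s x) = S_uq (hcomp uq_gr (s + 1) x)"
    by (simp only: add_diff_cancel_left')
  then show "S_uq x - S_uq (hcomp uq_gr s x) \<in> uq_gr (s + 1)" by (simp add: S_uq_gr uq_hcomp_in)
qed (simp add: S_uq_gr uq_hcomp_in)

section \<open>Quantum sub-superalgebras\<close>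

definition sub_words :: "nat set \<Rightarrow> nat set \<Rightarrow> ('m::finite, 'n::finite) gen list set" where
  "sub_words A B = {w. \<forall>g\<in>set w. Rep_gen g \<in> range Kp \<union> range Km \<union> Up ` A \<union> Dn ` B}"

lemma sub_words_append: "u @ v \<in> sub_words A B \<longleftrightarrow> u \<in> sub_words A B \<and> v \<in> sub_words A B"
  by (auto simp: sub_words_def)

lemma uq_word_sub:
  fixes w :: "('m::finite, 'n::finite) gen list"
  shows "w \<in> sub_words A B \<Longrightarrow> uq_word w \<in> uq_sub A B"
proof (induction w)
  case (Cons g w)
  have "(uq_gen (Rep_gen g) :: ('m, 'n) uq) \<in> uq_sub A B"
    using Cons.prems by (cases g rule: gen_cases) (auto simp: sub_words_def intro: uq_sub.intros simp del: atLeastAtMost_iff One_nat_def)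
  with Cons show ?case by (auto simp: uq_word_Cons sub_words_def intro: uq_sub.mult)
qed (simp add: uq_sub.one)

lemma uq_sub_0: "0 \<in> uq_sub A B"
  using uq_sub.scale[OF uq_sub.one, where c = 0] by simp

lemma uq_sub_subspace: "uq.subspace (uq_sub A B)"
  by (rule uq.subspaceI) (auto intro: uq_sub.intros uq_sub_0)

text \<open>A spanning set of homogeneous elements: closure under components, and the behaviour of
  the antipode on the sub-superalgebra, can be checked on words.\<close>

lemma uq_sub_span:
  assumes A: "A \<subseteq> idxJ CARD('m::finite) CARD('n::finite)" and B: "B \<subseteq> idxJ CARD('m) CARD('n)"
  shows "(uq_sub A B :: ('m, 'n) uq set) = uq.span (uq_word ` sub_words A B)"
proof
  let ?W = "uq_word ` sub_words A B :: ('m, 'n) uq set"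
  have gen: "uq_gen g \<in> uq.span ?W" if "g \<in> valid CARD('m) CARD('n)"
    "g \<in> range Kp \<union> range Km \<union> Up ` A \<union> Dn ` B" for g
  proof -
    have "uq_word [Abs_gen g] \<in> ?W" using that by (auto simp: sub_words_def Rep_Abs_gen)
    then show ?thesis using that(1) by (auto simp: uq_word_single Rep_Abs_gen intro: uq.span_base)
  qed
  show "uq_sub A B \<subseteq> uq.span ?W"
  proof
    fix x :: "('m, 'n) uq" assume "x \<in> uq_sub A B"
    then show "x \<in> uq.span ?W"
    proof (induction rule: uq_sub.induct)
      case one
      have "uq_word [] \<in> ?W" by (auto simp: sub_words_def simp del: uq_word_Nil)
      then show ?case by (auto intro: uq.span_base)
    next
      case (mult x y)
      have "x * uq_word w \<in> uq.span ?W" if "w \<in> sub_words A B" for w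
        using mult(3)
      proof (induction rule: uq.span_induct)
        case base
        show ?case unfolding uq.subspace_def
          by (auto simp: distrib_right uq.span_zero uq.span_add uq.span_scale)
      next
        case (step x)
        then show ?case using that by (auto simp: uq_word_append[symmetric] sub_words_append intro!: uq.span_base imageI)
      qed
      with mult(4) show ?case
      proof (induction y rule: uq.span_induct)
        case base
        show ?case unfolding uq.subspace_def
          by (auto simp: distrib_left uq.span_zero uq.span_add uq.span_scale)
      qed auto
    next
      case (Up a)
      then show ?case using A by (intro gen) auto
    next
      case (Dn a)
      then show ?case using B by (intro gen) auto
    qed (auto intro: uq.span_add uq.span_scale gen simp del: atLeastAtMost_iff One_nat_def)
  qed
  show "uq.span ?W \<subseteq> uq_sub A B"
    by (rule uq.span_minimal[OF _ uq_sub_subspace]) (auto intro: uq_word_sub)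
qed

lemma uq_sub_hcomp:
  fixes x :: "('m::finite, 'n::finite) uq"
  assumes "A \<subseteq> idxJ CARD('m) CARD('n)" "B \<subseteq> idxJ CARD('m) CARD('n)" "x \<in> uq_sub A B"
  shows "hcomp uq_gr s x \<in> uq_sub A B"
  using assms(3) unfolding uq_sub_span[OF assms(1,2)]
proof (induction rule: uq.span_induct)
  case base
  show ?case unfolding uq.subspace_def
    by (auto simp: uq_hcomp_add uq_hcomp_scale uq_hcomp_0
        uq.span_zero uq.span_add uq.span_scale)
next
  case (step x)
  then show ?case by (auto simp: uq_hcomp_gr[OF uq_gr_word] uq.span_zero intro: uq.span_base[OF imageI])
qed

lemma S_word_sub:
  fixes w :: "('m::finite, 'n::finite) gen list"
  shows "w \<in> sub_words A B \<Longrightarrow> (S_word w :: ('m, 'n) uq) \<in> uq_sub A B"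
proof (induction w)
  case (Cons g w)
  have "(S_gen (Rep_gen g) :: ('m, 'n) uq) \<in> uq_sub A B"
  proof (cases g rule: gen_cases)
    case (Up a)
    then have "a \<in> A" using Cons.prems by (auto simp: sub_words_def)
    then show ?thesis using Up idxJ_I[OF Up(1)]
      by (auto simp: S_gen_def intro!: uq.subspace_neg[OF uq_sub_subspace] uq_sub.intros simp del: atLeastAtMost_iff)
  next
    case (Dn a)
    then have "a \<in> B" using Cons.prems by (auto simp: sub_words_def)
    then show ?thesis using Dn idxJ_I[OF Dn(1)]
      by (auto simp: S_gen_def intro!: uq.subspace_neg[OF uq_sub_subspace] uq_sub.intros simp del: atLeastAtMost_iff)
  qed (auto simp: S_gen_def intro: uq_sub.intros)
  with Cons show ?case
    by (auto simp: sub_words_def ksign_def intro!: uq.subspace_neg[OF uq_sub_subspace] uq_sub.mult)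
qed (simp add: uq_sub.one)

lemma S_uq_sub:
  fixes x :: "('m::finite, 'n::finite) uq"
  assumes "A \<subseteq> idxJ CARD('m) CARD('n)" "B \<subseteq> idxJ CARD('m) CARD('n)" "x \<in> uq_sub A B"
  shows "S_uq x \<in> uq_sub A B"
  using assms(3) unfolding uq_sub_span[OF assms(1,2)]
proof (induction rule: uq.span_induct)
  case base
  show ?case unfolding uq.subspace_def
    by (auto simp: S_uq_simps uq.span_zero uq.span_add uq.span_scale)
next
  case (step x)
  then show ?case by (auto simp: S_uq_word uq_sub_span[OF assms(1,2), symmetric] S_word_sub)
qed

lemma S_uq_gen:
  "g \<in> valid CARD('m) CARD('n) \<Longrightarrow> S_uq (uq_gen g :: ('m::finite, 'n::finite) uq) = S_gen g"
  by (simp add: uq_gen_def S_uq_abs S_fa_fgen)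

lemma S_uq_uminus: "S_uq (- x) = - S_uq x"
  using S_uq_scale[of "- 1" x] by simp

text \<open>The preimages are values of the inverse antipode, for instance
  \<open>- (ki a * eu a)\<close>: reversal puts \<open>kk a\<close>, the image of
  \<open>ki a\<close>, behind \<open>- (eu a * ki a)\<close> and cancels its Cartan factor.\<close>

lemma S_uq_surj_gen:
  fixes g :: "('m::finite, 'n::finite) gen"
  assumes "[g] \<in> sub_words A B"
  shows "\<exists>y \<in> uq_sub A B \<inter> uq_gr (gen_par g). S_uq y = (uq_gen (Rep_gen g) :: ('m, 'n) uq)"
proof (cases g rule: gen_cases)
  case (Up a)
  have v: "Up a \<in> valid CARD('m) CARD('n)" "Km a \<in> valid CARD('m) CARD('n)" "Kp (a + 1) \<in> valid CARD('m) CARD('n)"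
    using idxJ_I[OF Up(1)] Up(1) by (simp_all only: valid_iff)
  have p: "rpar CARD('m) (Km a) = 0" "rpar CARD('m) (Kp (a + 1)) = 0" by (simp_all add: rpar_def)
  have ki: "(ki a :: ('m, 'n) uq) \<in> uq_gr 0" using uq_gr_mult[OF uq_gr_gen[OF v(2)] uq_gr_gen[OF v(3)]] p by simp
  have Ski: "S_uq (ki a :: ('m, 'n) uq) = kk a"
    using S_uq_mult[OF uq_gr_gen[OF v(2)] uq_gr_gen[OF v(3)]] K_commute(2)[OF idxJ_I[OF Up(1)]]
    by (simp only: p S_uq_gen[OF v(2)] S_uq_gen[OF v(3)] S_gen_def rawgen.case mult_zero_left ksign_0)
  have "a \<in> A" using assms Up by (auto simp: sub_words_def)
  then have "(ki a * eu a :: ('m, 'n) uq) \<in> uq_sub A B"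
    using idxJ_I[OF Up(1)] by (auto intro!: uq_sub.intros simp del: atLeastAtMost_iff)
  moreover have g: "(ki a * eu a :: ('m, 'n) uq) \<in> uq_gr (gen_par g)"
    using uq_gr_mult[OF ki uq_gr_gen[OF v(1)]] Up by (simp add: gen_par_rpar)
  moreover have "S_uq (ki a * eu a :: ('m, 'n) uq) = - (eu a * ki a * kk a)"
    using S_uq_mult[OF ki uq_gr_gen[OF v(1)]] by (simp only: Ski S_uq_gen[OF v(1)] S_gen_def rawgen.case mult_zero_left ksign_0 mult_minus_left)
  then have "S_uq (- (ki a * eu a) :: ('m, 'n) uq) = uq_gen (Rep_gen g)"
    by (simp only: S_uq_uminus mult.assoc[of "eu a" "ki a" "kk a"] ki_kk[OF Up(1)] mult_1_right minus_minus Up(2))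
  ultimately show ?thesis
    using uq.subspace_neg[OF uq_sub_subspace] gr_uminus[OF grading_uq g] by blast
next
  case (Dn a)
  have v: "Dn a \<in> valid CARD('m) CARD('n)" "Kp a \<in> valid CARD('m) CARD('n)" "Km (a + 1) \<in> valid CARD('m) CARD('n)"
    using idxJ_I[OF Dn(1)] Dn(1) by (simp_all only: valid_iff)
  have p: "rpar CARD('m) (Kp a) = 0" "rpar CARD('m) (Km (a + 1)) = 0" by (simp_all add: rpar_def)
  have kk: "(kk a :: ('m, 'n) uq) \<in> uq_gr 0" using uq_gr_mult[OF uq_gr_gen[OF v(2)] uq_gr_gen[OF v(3)]] p by simp
  have Skk: "S_uq (kk a :: ('m, 'n) uq) = ki a"
    using S_uq_mult[OF uq_gr_gen[OF v(2)] uq_gr_gen[OF v(3)]] K_commute(2)[OF idxJ_I(2,1)[OF Dn(1)]]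
    by (simp only: p S_uq_gen[OF v(2)] S_uq_gen[OF v(3)] S_gen_def rawgen.case mult_zero_left ksign_0)
  have "a \<in> B" using assms Dn by (auto simp: sub_words_def)
  then have "(ed a * kk a :: ('m, 'n) uq) \<in> uq_sub A B"
    using idxJ_I[OF Dn(1)] by (auto intro!: uq_sub.intros simp del: atLeastAtMost_iff)
  moreover have g: "(ed a * kk a :: ('m, 'n) uq) \<in> uq_gr (gen_par g)"
    using uq_gr_mult[OF uq_gr_gen[OF v(1)] kk] Dn by (simp add: gen_par_rpar)
  moreover have "S_uq (ed a * kk a :: ('m, 'n) uq) = - ((ki a * kk a) * ed a)"
    using S_uq_mult[OF uq_gr_gen[OF v(1)] kk] by (simp only: Skk S_uq_gen[OF v(1)] S_gen_def rawgen.case mult_zero_right ksign_0 mult_minus_right mult.assoc)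
  then have "S_uq (- (ed a * kk a) :: ('m, 'n) uq) = uq_gen (Rep_gen g)"
    by (simp only: S_uq_uminus ki_kk[OF Dn(1)] mult_1_left minus_minus Dn(2))
  ultimately show ?thesis
    using uq.subspace_neg[OF uq_sub_subspace] gr_uminus[OF grading_uq g] by blast
next
  case (Kp a)
  then have "Km a \<in> valid CARD('m) CARD('n)" by simp
  from uq_gr_gen[OF this] S_uq_gen[OF this] Kp uq_sub.Km[OF Kp(1)] show ?thesis
    by (intro bexI[of _ "km a :: ('m, 'n) uq"]) (simp_all add: S_gen_def gen_par_rpar rpar_def)
next
  case (Km a)
  then have "Kp a \<in> valid CARD('m) CARD('n)" by simp
  from uq_gr_gen[OF this] S_uq_gen[OF this] Km uq_sub.Kp[OF Km(1)] show ?thesis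
    by (intro bexI[of _ "kp a :: ('m, 'n) uq"]) (simp_all add: S_gen_def gen_par_rpar rpar_def)
qed

lemma S_uq_surj_word:
  fixes w :: "('m::finite, 'n::finite) gen list"
  shows "w \<in> sub_words A B \<Longrightarrow>
    \<exists>y \<in> uq_sub A B \<inter> uq_gr (word_par w). S_uq y = (uq_word w :: ('m, 'n) uq)"
proof (induction w)
  case Nil
  show ?case using S_uq_word[of "[]"] uq_gr_1 by (intro bexI[of _ 1]) (auto intro: uq_sub.one)
next
  case (Cons g w)
  obtain x where x: "x \<in> uq_sub A B" "x \<in> uq_gr (gen_par g)" "S_uq x = (uq_gen (Rep_gen g) :: ('m, 'n) uq)"
    using S_uq_surj_gen[of g A B] Cons.prems by (auto simp: sub_words_def)
  obtain y where y: "y \<in> uq_sub A B" "y \<in> uq_gr (word_par w)" "S_uq y = (uq_word w :: ('m, 'n) uq)"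
    using Cons by (auto simp: sub_words_def)
  \<comment> \<open>Order and sign compensate the reversal and the sign in
    \<open>S_uq_mult\<close>.\<close>
  let ?z = "ksign (word_par w * gen_par g) (y * x)"
  have "?z \<in> uq_sub A B" using x y by (auto simp: ksign_def intro!: uq.subspace_neg[OF uq_sub_subspace] uq_sub.mult)
  moreover have "?z \<in> uq_gr (word_par (g # w))"
    using gr_ksign[OF grading_uq uq_gr_mult[OF y(2) x(2)]] by (simp add: add.commute)
  moreover have "S_uq ?z = uq_word (g # w)"
    using S_uq_mult[OF y(2) x(2)] S_uq_scale[of "- 1" "y * x"]
    by (simp add: ksign_def x y uq_word_Cons split: if_splits)
  ultimately show ?case by blast
qed

text \<open>The condition that defines \<open>gamma_obj\<close> involves elements of P only through
  their antipodes. A preimage can be chosen homogeneous because the antipode commutes with taking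
  components.\<close>

lemma S_uq_surj:
  fixes x :: "('m::finite, 'n::finite) uq"
  assumes "A \<subseteq> idxJ CARD('m) CARD('n)" "B \<subseteq> idxJ CARD('m) CARD('n)" "x \<in> uq_sub A B" "x \<in> uq_gr s"
  shows "\<exists>y \<in> uq_sub A B \<inter> uq_gr s. S_uq y = x"
proof -
  have "\<exists>y \<in> uq_sub A B. S_uq y = x"
    using assms(3) unfolding uq_sub_span[OF assms(1,2)]
  proof (induction rule: uq.span_induct)
    case base
    show ?case unfolding uq.subspace_def
      by (auto intro: S_uq_simps(3) uq.span_zero) (metis S_uq_simps(1) uq.span_add, metis S_uq_simps(2) uq.span_scale)
  next
    case (step x)
    then show ?case using S_uq_surj_word unfolding uq_sub_span[OF assms(1,2), symmetric] by blast
  qed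
  then obtain y where y: "y \<in> uq_sub A B" "S_uq y = x" by blast
  have "S_uq (hcomp uq_gr s y) = x" by (simp add: S_uq_hcomp y uq_hcomp_gr[OF assms(4)])
  then show ?thesis using uq_sub_hcomp[OF assms(1,2) y(1)] uq_hcomp_in by blast
qed

section \<open>Linear maps on the quantum superalgebra\<close>

lemma vector_space_fscale:
  assumes "vector_space scl" shows "vector_space (fscale scl :: Cq \<Rightarrow> ('u \<Rightarrow> 'v::ab_group_add) \<Rightarrow> _)"
proof -
  interpret vector_space scl by (rule assms)
  show ?thesis
    by unfold_locales (simp_all add: fscale_def fun_eq_iff scale_right_distrib scale_left_distrib)
qed

lemma lin_onD:
  assumes "lin_on A s1 s2 f"
  shows "u \<in> A \<Longrightarrow> v \<in> A \<Longrightarrow> f (u + v) = f u + f v" "u \<in> A \<Longrightarrow> f (s1 c u) = s2 c (f u)"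
  using assms by (auto simp: lin_on_def)

lemma lin_on_0:
  assumes "lin_on A s1 s2 f" "vector_space s1" "vector_space s2" "0 \<in> A"
  shows "f 0 = 0"
proof -
  interpret a: vector_space s1 by (rule assms)
  interpret b: vector_space s2 by (rule assms)
  show ?thesis using lin_onD(2)[OF assms(1,4), of 0] by simp
qed

lemma lin_on_uminus:
  assumes "lin_on A s1 s2 f" "vector_space s1" "vector_space s2" "u \<in> A"
  shows "f (- u) = - f u"
proof -
  interpret a: vector_space s1 by (rule assms)
  interpret b: vector_space s2 by (rule assms)
  show ?thesis using lin_onD(2)[OF assms(1,4), of "- 1"] by simp
qed

lemma lin_on_ksign:
  assumes "lin_on A s1 s2 f" "vector_space s1" "vector_space s2" "u \<in> A"
  shows "f (ksign s u) = ksign s (f u)"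
  by (simp add: ksign_def lin_on_uminus[OF assms])

text \<open>\<open>gtw G s\<close> multiplies the component of degree \<open>t\<close> by \<open>(-1)\<^bsup>s t\<^esup>\<close>. With it the action on
  \<^const>\<open>hom_mod\<close> and the one on tensors are given by one formula, which needs no decomposition of the
  linear map and does not mention \<open>P\<close>.\<close>

definition act :: "('m::finite, 'n::finite, 'v::ab_group_add) smod \<Rightarrow> ('m, 'n) uq \<Rightarrow>
    (('m, 'n) uq \<Rightarrow> 'v) \<Rightarrow> ('m, 'n) uq \<Rightarrow> 'v" where
  "act V y \<zeta> = (\<lambda>x. \<Sum>s\<in>{0, 1}. ksign s (gtw (mgrade V) s (\<zeta> (x * hcomp uq_gr s y))))"

text \<open>Just what makes \<open>hom_gr P V\<close> a graded subspace that is stable under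
  \<open>act\<close>. It is vacuous for the empty set, so the same lemmas apply to the space of all
  graded linear maps.\<close>

definition pcompat :: "('m::finite, 'n::finite) uq set \<Rightarrow> ('m, 'n, 'v::ab_group_add) smod \<Rightarrow> bool" where
  "pcompat P V \<longleftrightarrow> (\<forall>x\<in>P. lin_on (mcarrier V) (mscale V) (mscale V) (mact V x)) \<and>
     (\<forall>s t. \<forall>x\<in>P \<inter> uq_gr s. \<forall>v\<in>mgrade V t. mact V x v \<in> mgrade V (s + t))"

lemma pcompat_empty: "pcompat {} V"
  by (simp add: pcompat_def)

lemma pcompat_super_module: "super_module P V \<Longrightarrow> pcompat P V"
  unfolding pcompat_def super_module_def by blast

text \<open>Most of the argument only uses the grading of the module. In particular
  \<open>hom_gr {} V\<close> consists of all graded linear maps.\<close>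

locale gmod =
  fixes V :: "('m::finite, 'n::finite, 'v::ab_group_add) smod"
  assumes vs: "vector_space (mscale V)"
    and gr_sub: "module.subspace (mscale V) (mgrade V s)"
    and gr_int: "mgrade V 0 \<inter> mgrade V 1 = {0}"
    and carrier: "mcarrier V = gtot (mgrade V)"

lemma gmod_super_module: "super_module R V \<Longrightarrow> gmod V"
  unfolding gmod_def super_module_def gtot_def by simp

context gmod
begin

sublocale vs: vector_space "mscale V" by (rule vs)
sublocale fv: vector_space "fscale (mscale V) :: Cq \<Rightarrow> (('m, 'n) uq \<Rightarrow> 'v) \<Rightarrow> _"
  by (rule vector_space_fscale[OF vs])

abbreviation "scl \<equiv> mscale V"
abbreviation "G \<equiv> mgrade V"
abbreviation "fs \<equiv> (fscale (mscale V) :: Cq \<Rightarrow> (('m, 'n) uq \<Rightarrow> 'v) \<Rightarrow> _)"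

lemma grading_G: "grading G"
  unfolding grading_def
  by (intro conjI allI ballI) (simp_all add: gr_int vs.subspace_0[OF gr_sub] vs.subspace_diff[OF gr_sub])

lemma scl_gr: "v \<in> G s \<Longrightarrow> scl c v \<in> G s"
  by (rule vs.subspace_scale[OF gr_sub])

lemma scl_gtot: "v \<in> gtot G \<Longrightarrow> scl c v \<in> gtot G"
proof (induction v rule: gtot_induct[OF grading_G, consumes 1, case_names gr add])
  case (gr s u)
  then show ?case by (rule gtot_gr[OF grading_G scl_gr])
qed (simp add: vs.scale_right_distrib gtot_add[OF grading_G])

lemma subspace_carrier: "vs.subspace (gtot G)"
  by (rule vs.subspaceI) (simp_all add: gtot_0[OF grading_G] gtot_add[OF grading_G] scl_gtot)

lemma scl_ksign: "scl c (ksign s v) = ksign s (scl c v)"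
  by (simp add: ksign_def)

lemma gtw_scl: "v \<in> gtot G \<Longrightarrow> gtw G s (scl c v) = scl c (gtw G s v)"
proof (induction v rule: gtot_induct[OF grading_G, consumes 1, case_names gr add])
  case (gr t u)
  then show ?case by (simp add: gtw_gr[OF grading_G, of _ t] scl_gr scl_ksign)
qed (simp add: vs.scale_right_distrib gtw_add[OF grading_G] scl_gtot)

lemma fs_apply [simp]: "fs c \<zeta> x = scl c (\<zeta> x)"
  by (simp add: fscale_def)

text \<open>Linear maps into the carrier without a chosen decomposition into even and odd part; the
  linearity properties of \<open>act\<close> hold here.\<close>

definition HL :: "(('m, 'n) uq \<Rightarrow> 'v) set" where
  "HL = {\<zeta>. lin_on UNIV uq_scale scl \<zeta> \<and> (\<forall>x. \<zeta> x \<in> gtot G)}"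

lemma HL_D:
  assumes "\<zeta> \<in> HL"
  shows "\<zeta> (x + y) = \<zeta> x + \<zeta> y" "\<zeta> (uq_scale c x) = scl c (\<zeta> x)" "\<zeta> x \<in> gtot G" "\<zeta> 0 = 0"
    "\<zeta> (- x) = - \<zeta> x" "\<zeta> (ksign s x) = ksign s (\<zeta> x)"
proof -
  have l: "lin_on UNIV uq_scale scl \<zeta>" using assms by (simp add: HL_def)
  show "\<zeta> (x + y) = \<zeta> x + \<zeta> y" "\<zeta> (uq_scale c x) = scl c (\<zeta> x)" using l by (simp_all add: lin_on_def)
  show "\<zeta> x \<in> gtot G" using assms by (simp add: HL_def)
  show "\<zeta> 0 = 0" "\<zeta> (- x) = - \<zeta> x" "\<zeta> (ksign s x) = ksign s (\<zeta> x)"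
    by (rule lin_on_0[OF l vector_space_uq vs] lin_on_uminus[OF l vector_space_uq vs]
        lin_on_ksign[OF l vector_space_uq vs]; simp)+
qed

lemma HL_split: "\<zeta> \<in> HL \<Longrightarrow> \<zeta> x = \<zeta> (hcomp uq_gr s x) + \<zeta> (hcomp uq_gr (s + 1) x)"
  by (subst uq_hcomp_split[of x s]) (simp add: HL_D)

lemma hom_gr_mono: "\<zeta> \<in> hom_gr P V r \<Longrightarrow> \<zeta> \<in> hom_gr {} V r"
  by (simp add: hom_gr_def)

lemma hom_gr_val: "\<zeta> \<in> hom_gr P V r \<Longrightarrow> x \<in> uq_gr s \<Longrightarrow> \<zeta> x \<in> G (s + r)"
  by (auto simp: hom_gr_def)

lemma hom_gr_HL:
  assumes "\<zeta> \<in> hom_gr P V r" shows "\<zeta> \<in> HL"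
proof -
  have l: "lin_on UNIV uq_scale scl \<zeta>" using assms by (simp add: hom_gr_def)
  have "\<zeta> x \<in> gtot G" for x
  proof (induction x rule: uq_gr_induct)
    case (gr s x)
    show ?case by (rule gtot_gr[OF grading_G hom_gr_val[OF assms gr]])
  next
    case (add x y)
    then show ?case using l by (simp add: lin_on_def gtot_add[OF grading_G])
  qed
  with l show ?thesis by (simp add: HL_def)
qed

lemma subspace_HL: "fv.subspace HL"
  by (rule fv.subspaceI) (auto simp: HL_def lin_on_def vs.scale_right_distrib mult.commute
      scl_gtot gtot_0[OF grading_G] gtot_add[OF grading_G] vs.scale_left_commute ac_simps)

lemma subspace_hom_gr:
  assumes "pcompat P V" shows "fv.subspace (hom_gr P V r)"
proof (rule fv.subspaceI)
  have m: "mact V x (u + v) = mact V x u + mact V x v" "mact V x (scl c u) = scl c (mact V x u)" "mact V x 0 = 0"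
    if "x \<in> P" "u \<in> gtot G" "v \<in> gtot G" for x u v c
    using assms that lin_onD[of "gtot G" scl scl "mact V x"]
      lin_on_0[of "gtot G" scl scl "mact V x", OF _ vs vs gtot_0[OF grading_G]]
    by (simp_all add: pcompat_def carrier)
  show "0 \<in> hom_gr P V r"
    using m(3)[OF _ gtot_0[OF grading_G] gtot_0[OF grading_G]]
    by (auto simp: hom_gr_def lin_on_def gr_0[OF grading_G])
  show "\<zeta> + \<eta> \<in> hom_gr P V r" if z: "\<zeta> \<in> hom_gr P V r" "\<eta> \<in> hom_gr P V r" for \<zeta> \<eta>
  proof -
    have "\<zeta> + \<eta> \<in> HL" using fv.subspace_add[OF subspace_HL] hom_gr_HL z by blast
    moreover have "(\<zeta> + \<eta>) x \<in> G (s + r)" if "x \<in> uq_gr s" for s x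
      using hom_gr_val z that gr_add[OF grading_G] by simp
    moreover have "(\<zeta> + \<eta>) (x * y) = ksign (s * r) (mact V x ((\<zeta> + \<eta>) y))" if "x \<in> P" "x \<in> uq_gr s" for s x y
      using z that HL_D(3)[OF hom_gr_HL] m(1)[OF that(1)] by (auto simp: hom_gr_def ksign_add)
    ultimately show ?thesis by (auto simp: hom_gr_def HL_def)
  qed
  show "fs c \<zeta> \<in> hom_gr P V r" if z: "\<zeta> \<in> hom_gr P V r" for c \<zeta>
  proof -
    have "fs c \<zeta> \<in> HL" using fv.subspace_scale[OF subspace_HL] hom_gr_HL z by blast
    moreover have "(fs c \<zeta>) x \<in> G (s + r)" if "x \<in> uq_gr s" for s x
      using hom_gr_val z that scl_gr by simp
    moreover have "(fs c \<zeta>) (x * y) = ksign (s * r) (mact V x ((fs c \<zeta>) y))" if "x \<in> P" "x \<in> uq_gr s" for s x y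
      using that m(2)[OF that(1) HL_D(3)[OF hom_gr_HL[OF z]] gtot_0[OF grading_G]] z
      by (auto simp: hom_gr_def scl_ksign)
    ultimately show ?thesis by (auto simp: hom_gr_def HL_def)
  qed
qed

lemma grading_hom_gr:
  assumes "pcompat P V" shows "grading (hom_gr P V)"
  unfolding grading_def
proof (intro conjI allI ballI)
  note s = subspace_hom_gr[OF assms]
  show "0 \<in> hom_gr P V s" for s by (rule fv.subspace_0[OF s])
  show "u - v \<in> hom_gr P V s" if "u \<in> hom_gr P V s" "v \<in> hom_gr P V s" for s u v
    using that by (rule fv.subspace_diff[OF s])
  show "hom_gr P V 0 \<inter> hom_gr P V 1 = {0}"
  proof
    show "hom_gr P V 0 \<inter> hom_gr P V 1 \<subseteq> {0}"
    proof
      fix \<zeta> assume z: "\<zeta> \<in> hom_gr P V 0 \<inter> hom_gr P V 1"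
      have "\<zeta> x = 0" for x
      proof (induction x rule: uq_gr_induct)
        case (gr s x)
        then show ?case using z hom_gr_val[of \<zeta> P 0 x s] hom_gr_val[of \<zeta> P 1 x s] gr_inter[OF grading_G] by auto
      next
        case (add x y)
        then show ?case using z HL_D(1)[OF hom_gr_HL, of \<zeta> P 0] by auto
      qed
      then show "\<zeta> \<in> {0}" by auto
    qed
    show "{0} \<subseteq> hom_gr P V 0 \<inter> hom_gr P V 1" using fv.subspace_0[OF s] by simp
  qed
qed

abbreviation "Tot \<equiv> gtot (hom_gr {} V)"
abbreviation "H \<equiv> hom_gr {} V"

lemmas grading_H = grading_hom_gr[OF pcompat_empty]

lemma gtot_hom_gr_HL:
  assumes "pcompat P V" "\<zeta> \<in> gtot (hom_gr P V)" shows "\<zeta> \<in> HL"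
  using assms(2)
proof (induction \<zeta> rule: gtot_induct[OF grading_hom_gr[OF assms(1)], consumes 1, case_names gr add])
  case (gr s u)
  then show ?case by (rule hom_gr_HL)
next
  case (add u w)
  show ?case by (rule fv.subspace_add[OF subspace_HL add(3,4)])
qed

lemmas Tot_HL = gtot_hom_gr_HL[OF pcompat_empty]

lemma gtot_subspace:
  assumes "\<And>s. fv.subspace (A s)" shows "fv.subspace (gtot A)"
proof (rule fv.subspaceI)
  show "0 \<in> gtot A" unfolding gtot_def
    using fv.subspace_0[OF assms[of 0]] fv.subspace_0[OF assms[of 1]] by (auto intro!: exI[of _ 0])
  show "u + v \<in> gtot A" if "u \<in> gtot A" "v \<in> gtot A" for u v
  proof -
    obtain a b a' b' where "u = a + b" "v = a' + b'" "a \<in> A 0" "a' \<in> A 0" "b \<in> A 1" "b' \<in> A 1"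
      using \<open>u \<in> gtot A\<close> \<open>v \<in> gtot A\<close> unfolding gtot_def by blast
    moreover from this have "u + v = (a + a') + (b + b')" by (simp only: ac_simps)
    ultimately have "u + v = (a + a') + (b + b')" "a + a' \<in> A 0" "b + b' \<in> A 1"
      using fv.subspace_add[OF assms] by blast+
    then show ?thesis unfolding gtot_def by blast
  qed
  show "fs c u \<in> gtot A" if "u \<in> gtot A" for c u
    using that fv.subspace_scale[OF assms] unfolding gtot_def
    by (auto simp: fv.scale_right_distrib) blast
qed

lemma subspace_Tot: "fv.subspace Tot"
  by (rule gtot_subspace[OF subspace_hom_gr[OF pcompat_empty]])

section \<open>The action on linear maps\<close>

lemma act_gr: "\<zeta> \<in> HL \<Longrightarrow> y \<in> uq_gr s \<Longrightarrow> act V y \<zeta> x = ksign s (gtw G s (\<zeta> (x * y)))"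
  by (cases s rule: bit_exh) (simp_all add: act_def uq_hcomp_gr HL_D gtw_0_right[OF grading_G])

lemma act_add_left: "\<zeta> \<in> HL \<Longrightarrow> act V (y + z) \<zeta> = act V y \<zeta> + act V z \<zeta>"
  by (simp add: act_def fun_eq_iff uq_hcomp_add distrib_left HL_D gtw_add[OF grading_G] ksign_add)

lemma act_scale_left: "\<zeta> \<in> HL \<Longrightarrow> act V (uq_scale c y) \<zeta> = fs c (act V y \<zeta>)"
  by (simp add: act_def fun_eq_iff uq_hcomp_scale HL_D gtw_scl scl_ksign vs.scale_right_distrib
      flip: uminus_add_conv_diff)

lemma act_add: "\<zeta> \<in> HL \<Longrightarrow> \<eta> \<in> HL \<Longrightarrow> act V y (\<zeta> + \<eta>) = act V y \<zeta> + act V y \<eta>"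
  by (simp add: act_def fun_eq_iff HL_D gtw_add[OF grading_G] ksign_add)

lemma act_scale: "\<zeta> \<in> HL \<Longrightarrow> act V y (fs c \<zeta>) = fs c (act V y \<zeta>)"
  by (simp add: act_def fun_eq_iff HL_D gtw_scl scl_ksign vs.scale_right_distrib
      flip: uminus_add_conv_diff)

lemma act_HL:
  assumes "\<zeta> \<in> HL" shows "act V y \<zeta> \<in> HL"
proof -
  have "act V y \<zeta> (u + v) = act V y \<zeta> u + act V y \<zeta> v" for u v
    by (simp add: act_def distrib_right HL_D[OF assms] gtw_add[OF grading_G] ksign_add)
  moreover have "act V y \<zeta> (uq_scale c u) = scl c (act V y \<zeta> u)" for c u
    by (simp add: act_def HL_D[OF assms] gtw_scl scl_ksign vs.scale_right_distrib
      flip: uminus_add_conv_diff)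
  moreover have "act V y \<zeta> u \<in> gtot G" for u
    unfolding act_def
    by (intro gtot_sum[OF grading_G] gtot_ksign[OF grading_G] gtw_in[OF grading_G] HL_D[OF assms])
  ultimately show ?thesis by (simp add: HL_def lin_on_def)
qed

lemma act_one: "\<zeta> \<in> HL \<Longrightarrow> act V 1 \<zeta> = \<zeta>"
  by (rule ext) (simp add: act_gr[OF _ uq_gr_1] gtw_0_left[OF grading_G] HL_D)

lemma act_mult:
  assumes "\<zeta> \<in> HL" shows "act V (y * z) \<zeta> = act V y (act V z \<zeta>)"
proof (induction y rule: uq_gr_induct)
  case (gr s y)
  show ?case
  proof (induction z rule: uq_gr_induct)
    case (gr t z)
    show ?case
    proof (rule ext)
      fix x
      have "act V y (act V z \<zeta>) x = ksign s (gtw G s (ksign t (gtw G t (\<zeta> (x * y * z)))))"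
        by (simp add: act_gr[OF act_HL[OF assms] \<open>y \<in> uq_gr s\<close>] act_gr[OF assms gr])
      also have "\<dots> = ksign (s + t) (gtw G (s + t) (\<zeta> (x * (y * z))))"
        by (simp add: gtw_ksign[OF grading_G] gtw_gtw[OF grading_G] gtw_in[OF grading_G]
            HL_D[OF assms] ksign_ksign mult.assoc)
      finally show "act V (y * z) \<zeta> x = act V y (act V z \<zeta>) x"
        by (simp add: act_gr[OF assms uq_gr_mult[OF \<open>y \<in> uq_gr s\<close> gr]])
    qed
  next
    case (add z z')
    then show ?case by (simp only: distrib_left act_add_left[OF assms] act_add[OF act_HL[OF assms] act_HL[OF assms]])
  qed
next
  case (add y y')
  then show ?case by (simp only: distrib_right act_add_left[OF assms] act_add_left[OF act_HL[OF assms]])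
qed

lemma act_hom_gr:
  assumes pc: "pcompat P V" and z: "\<zeta> \<in> hom_gr P V r" and y: "y \<in> uq_gr s"
  shows "act V y \<zeta> \<in> hom_gr P V (s + r)"
proof -
  note HL = hom_gr_HL[OF z]
  have "act V y \<zeta> x \<in> G (t + (s + r))" if "x \<in> uq_gr t" for t x
    unfolding act_gr[OF HL y]
    using gr_ksign[OF grading_G gtw_gr_in[OF grading_G hom_gr_val[OF z uq_gr_mult[OF that y]]]]
    by (simp add: add.assoc)
  moreover have "act V y \<zeta> (p * x) = ksign (t * (s + r)) (mact V p (act V y \<zeta> x))"
    if p: "p \<in> P" "p \<in> uq_gr t" for t p x
  proof -
    have lin: "lin_on (gtot G) scl scl (mact V p)" using pc p by (simp add: pcompat_def carrier)
    \<comment> \<open>The twist passes the action of \<open>p\<close> at the cost of the sign for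
      \<open>s * t\<close>. This is the sign by which the rule for a homomorphism of degree
      \<open>s + r\<close> differs from that for degree \<open>r\<close>.\<close>
    have tw: "gtw G s (mact V p v) = ksign (s * t) (mact V p (gtw G s v))" "mact V p v \<in> gtot G"
      if "v \<in> gtot G" for v
    proof -
      from that have "gtw G s (mact V p v) = ksign (s * t) (mact V p (gtw G s v)) \<and> mact V p v \<in> gtot G"
      proof (induction v rule: gtot_induct[OF grading_G, consumes 1, case_names gr add])
        case (gr d v)
        then have "mact V p v \<in> G (t + d)" using pc p by (auto simp: pcompat_def)
        then show ?case using gr gtot_gr[OF grading_G]
          by (simp add: gtw_gr[OF grading_G, of _ d] gtw_gr[OF grading_G, of _ "t + d"]
              lin_on_ksign[OF lin vs vs] ksign_ksign distrib_left)
      next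
        case (add u v)
        then show ?case
          by (simp add: lin_onD(1)[OF lin] gtw_add[OF grading_G] gtot_add[OF grading_G] gtw_in[OF grading_G] ksign_add)
      qed
      then show "gtw G s (mact V p v) = ksign (s * t) (mact V p (gtw G s v))" "mact V p v \<in> gtot G" by simp_all
    qed
    have "act V y \<zeta> (p * x) = ksign s (gtw G s (ksign (t * r) (mact V p (\<zeta> (x * y)))))"
      using z p by (auto simp: act_gr[OF HL y] mult.assoc hom_gr_def)
    also have "\<dots> = ksign (s + (t * r + s * t)) (mact V p (gtw G s (\<zeta> (x * y))))"
      by (simp add: gtw_ksign[OF grading_G] tw HL_D[OF HL] ksign_ksign)
    also have "\<dots> = ksign (t * (s + r)) (mact V p (ksign s (gtw G s (\<zeta> (x * y)))))"
      by (simp add: lin_on_ksign[OF lin vs vs] gtw_in[OF grading_G] HL_D[OF HL] ksign_ksign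
          distrib_left ac_simps)
    finally show ?thesis by (simp add: act_gr[OF HL y])
  qed
  ultimately show ?thesis using act_HL[OF HL, of y] by (auto simp: hom_gr_def HL_def)
qed

lemma act_gtot_hom_gr:
  assumes pc: "pcompat P V" and z: "\<zeta> \<in> gtot (hom_gr P V)"
  shows "act V y \<zeta> \<in> gtot (hom_gr P V)"
  using z
proof (induction \<zeta> rule: gtot_induct[OF grading_hom_gr[OF pc], consumes 1, case_names gr add])
  case (gr r \<zeta>)
  note hom = gr
  show ?case
  proof (induction y rule: uq_gr_induct)
    case (gr s y)
    show ?case by (rule gtot_gr[OF grading_hom_gr[OF pc] act_hom_gr[OF pc hom gr]])
  next
    case (add x y)
    then show ?case
      by (simp only: act_add_left[OF hom_gr_HL[OF hom]] gtot_add[OF grading_hom_gr[OF pc]])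
  qed
next
  case (add u w)
  then show ?case
    by (simp only: act_add gtot_hom_gr_HL[OF pc] gtot_add[OF grading_hom_gr[OF pc]])
qed

text \<open>For homogeneous arguments the value of the component of degree \<open>r\<close> at
  \<open>u * w\<close> has degree \<open>t + s + r\<close>, so the sign \<open>s * (t + r)\<close>
  of the definition can be read off the value alone, up to the sign for \<open>s\<close>.\<close>

lemma mact_hom_mod:
  assumes pc: "pcompat P V" and z: "\<zeta> \<in> gtot (hom_gr P V)"
  shows "mact (hom_mod P V) y \<zeta> = act V y \<zeta>"
proof (rule ext)
  fix x
  let ?h = "\<lambda>r. hcomp (hom_gr P V) r \<zeta>"
  note grH = grading_hom_gr[OF pc]
  have hr: "?h r \<in> hom_gr P V r" for r by (rule hcomp_in[OF grH z])
  have zs: "\<zeta> = ?h 0 + ?h 1" using hcomp_split[OF grH z, of 0] by simp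
  have HL: "?h r \<in> HL" for r by (rule hom_gr_HL[OF hr])
  have 1: "ksign (s * (t + r)) (?h r (u * w)) = ksign s (gtw G s (?h r (u * w)))"
    if "u \<in> uq_gr t" "w \<in> uq_gr s" for s t r u w
  proof -
    have "s * (t + r) = s + s * (t + s + r)"
      by (cases s rule: bit_exh; cases t rule: bit_exh; cases r rule: bit_exh) simp_all
    then show ?thesis
      by (simp only: gtw_gr[OF grading_G hom_gr_val[OF hr uq_gr_mult[OF that]]] ksign_ksign)
  qed
  have 2: "?h r (x * w) = ?h r (hcomp uq_gr 0 x * w) + ?h r (hcomp uq_gr 1 x * w)" for r w
  proof -
    have "x * w = hcomp uq_gr 0 x * w + hcomp uq_gr 1 x * w"
      using uq_hcomp_split[of x 0] by (metis add_0 distrib_right)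
    then show ?thesis by (simp only: HL_D(1)[OF HL])
  qed
  have 3: "gtw G s (\<zeta> (x * w)) = (\<Sum>t\<in>{0, 1}. \<Sum>r\<in>{0, 1}. gtw G s (?h r (hcomp uq_gr t x * w)))" for s w
  proof -
    have "\<zeta> (x * w) = ?h 0 (x * w) + ?h 1 (x * w)"
      using fun_cong[OF zs, of "x * w"] by (simp only: plus_fun_apply)
    then have "gtw G s (\<zeta> (x * w)) = (gtw G s (?h 0 (hcomp uq_gr 0 x * w)) + gtw G s (?h 0 (hcomp uq_gr 1 x * w))) +
       (gtw G s (?h 1 (hcomp uq_gr 0 x * w)) + gtw G s (?h 1 (hcomp uq_gr 1 x * w)))"
      by (simp only: 2 gtw_add[OF grading_G] gtot_add[OF grading_G] HL_D(3)[OF HL])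
    then show ?thesis by (simp only: bit_sum) (simp only: ac_simps)
  qed
  have "mact (hom_mod P V) y \<zeta> x = (\<Sum>s\<in>{0, 1}. \<Sum>t\<in>{0, 1}. \<Sum>r\<in>{0, 1}.
      ksign s (gtw G s (?h r (hcomp uq_gr t x * hcomp uq_gr s y))))"
    unfolding hom_mod_def by (simp only: smod.simps 1[OF uq_hcomp_in uq_hcomp_in])
  also have "\<dots> = act V y \<zeta> x"
    unfolding act_def by (simp only: 3 ksign_sum)
  finally show "mact (hom_mod P V) y \<zeta> x = act V y \<zeta> x" .
qed

end

section \<open>Submodules and weights\<close>

text \<open>The common normal form of induced modules and of values of the functor \<Gamma>: grading
  and action do not refer to P, so two such records are equal as soon as their carriers are.\<close>

definition Mod :: "('m::finite, 'n::finite, 'v::ab_group_add) smod \<Rightarrow> (('m, 'n) uq \<Rightarrow> 'v) set \<Rightarrow>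
    ('m, 'n, ('m, 'n) uq \<Rightarrow> 'v) smod" where
  "Mod V N = \<lparr> mcarrier = N, mgrade = (\<lambda>s. N \<inter> hom_gr {} V s), mscale = fscale (mscale V),
     mact = (\<lambda>x. restrict (act V x) N) \<rparr>"

lemma Mod_simps [simp]:
  "mcarrier (Mod V N) = N" "mgrade (Mod V N) = (\<lambda>s. N \<inter> hom_gr {} V s)"
  "mscale (Mod V N) = fscale (mscale V)" "mact (Mod V N) = (\<lambda>x. restrict (act V x) N)"
  by (simp_all add: Mod_def)

lemma super_module_act_closed:
  "super_module R M \<Longrightarrow> x \<in> R \<Longrightarrow> v \<in> mcarrier M \<Longrightarrow> mact M x v \<in> mcarrier M"
  unfolding super_module_def by blast

text \<open>The value \<open>0\<close> outside the index set makes characters equal as soon as they agree on the \<open>K\<^sub>a\<close>.\<close>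

definition weight_char :: "nat \<Rightarrow> nat \<Rightarrow> (nat \<Rightarrow> int) \<Rightarrow> nat \<Rightarrow> Cq" where
  "weight_char m n \<mu> a = (if a \<in> idxI m n then qq powi wform m n \<mu> (eps a) else 0)"

context gmod
begin

definition gsubm :: "(('m, 'n) uq \<Rightarrow> 'v) set \<Rightarrow> bool" where
  "gsubm N \<longleftrightarrow> fv.subspace N \<and> N \<subseteq> gtot (\<lambda>s. N \<inter> H s) \<and> (\<forall>y. act V y ` N \<subseteq> N)"

lemma gsubmD:
  assumes "gsubm N"
  shows "fv.subspace N" "\<zeta> \<in> N \<Longrightarrow> act V y \<zeta> \<in> N" "\<zeta> \<in> N \<Longrightarrow> \<zeta> \<in> Tot" "\<zeta> \<in> N \<Longrightarrow> \<zeta> \<in> HL"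
    "\<zeta> \<in> N \<Longrightarrow> hcomp H s \<zeta> \<in> N" "N = gtot (\<lambda>s. N \<inter> H s)"
proof -
  show sub: "fv.subspace N" and "\<zeta> \<in> N \<Longrightarrow> act V y \<zeta> \<in> N"
    using assms unfolding gsubm_def by blast+
  have N: "N \<subseteq> gtot (\<lambda>s. N \<inter> H s)" using assms unfolding gsubm_def by blast
  have gr: "grading (\<lambda>s. N \<inter> H s)"
    unfolding grading_def
  proof (intro conjI allI ballI)
    show "0 \<in> N \<inter> H s" for s using fv.subspace_0[OF sub] gr_0[OF grading_H] by blast
    show "u - v \<in> N \<inter> H s" if "u \<in> N \<inter> H s" "v \<in> N \<inter> H s" for s u v
      using that fv.subspace_diff[OF sub] gr_diff[OF grading_H] by blast
    show "N \<inter> H 0 \<inter> (N \<inter> H 1) = {0}"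
      using grading_H fv.subspace_0[OF sub] unfolding grading_def by blast
  qed
  show "\<zeta> \<in> Tot" if "\<zeta> \<in> N"
    using N that unfolding gtot_def by blast
  then show "\<zeta> \<in> N \<Longrightarrow> \<zeta> \<in> HL" by (rule Tot_HL)
  show "hcomp H s \<zeta> \<in> N" if "\<zeta> \<in> N"
  proof -
    have "\<zeta> \<in> gtot (\<lambda>s. N \<inter> H s)" using N that by blast
    then obtain u w where u: "\<zeta> = u + w" "u \<in> N \<inter> H s" "w \<in> N \<inter> H (s + 1)" by (rule gtotE[OF gr])
    then have "hcomp H s \<zeta> = u" by (intro hcomp_eq[OF grading_H]) simp_all
    then show ?thesis using u by simp
  qed
  show "N = gtot (\<lambda>s. N \<inter> H s)"
  proof
    show "gtot (\<lambda>s. N \<inter> H s) \<subseteq> N"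
      using fv.subspace_add[OF sub] unfolding gtot_def by blast
  qed (rule N)
qed

lemma super_module_Mod: "super_module UNIV (Mod V N) \<longleftrightarrow> gsubm N"
proof
  assume sm: "super_module UNIV (Mod V N)"
  have gr: "fv.subspace (N \<inter> H s)" for s using sm unfolding super_module_def by simp
  have N: "N = gtot (\<lambda>s. N \<inter> H s)" using sm unfolding super_module_def gtot_def by simp
  have "fv.subspace N" by (subst N) (rule gtot_subspace[OF gr])
  moreover have "act V y \<zeta> \<in> N" if "\<zeta> \<in> N" for y \<zeta>
    using super_module_act_closed[OF sm, of y \<zeta>] that by simp
  ultimately show "gsubm N" unfolding gsubm_def using N by blast
next
  assume N: "gsubm N"
  note sub = gsubmD(1)[OF N] and HL = gsubmD(4)[OF N] and cl = gsubmD(2)[OF N]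
  show "super_module UNIV (Mod V N)"
    unfolding super_module_def Mod_simps
  proof (intro conjI allI ballI)
    show "vector_space fs" by (rule vector_space_fscale[OF vs])
    show "fv.subspace (N \<inter> H s)" for s
      by (rule fv.subspace_inter[OF sub subspace_hom_gr[OF pcompat_empty]])
    show "N \<inter> H 0 \<inter> (N \<inter> H 1) = {0}"
      using grading_H fv.subspace_0[OF sub] unfolding grading_def by blast
    show "N = {u + v |u v. u \<in> N \<inter> H 0 \<and> v \<in> N \<inter> H 1}"
      using gsubmD(6)[OF N] unfolding gtot_def .
    show "restrict (act V x) N ` N \<subseteq> N" for x using cl by auto
    show "lin_on N fs fs (restrict (act V x) N)" for x
      unfolding lin_on_def
      using fv.subspace_add[OF sub] fv.subspace_scale[OF sub] act_add act_scale HL by auto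
    show "lin_on UNIV uq_scale fs (\<lambda>x. restrict (act V x) N v)" if "v \<in> N" for v
      unfolding lin_on_def using that act_add_left[OF HL] act_scale_left[OF HL] by auto
    show "restrict (act V 1) N v = v" if "v \<in> N" for v using that act_one[OF HL] by simp
    show "restrict (act V (x * y)) N v = restrict (act V x) N (restrict (act V y) N v)" if "v \<in> N" for x y v
      using that act_mult[OF HL] cl by simp
    show "restrict (act V x) N v \<in> N \<inter> H (s + t)" if "x \<in> UNIV \<inter> uq_gr s" "v \<in> N \<inter> H t" for s t x v
      using that cl act_hom_gr[OF pcompat_empty, of v t x s] by simp
  qed
qed

section \<open>Finite vectors, weight spaces and separation of weights\<close>

definition ufin :: "(('m, 'n) uq \<Rightarrow> 'v) \<Rightarrow> bool" where
  "ufin \<zeta> \<longleftrightarrow> fin_spanned fs (range (\<lambda>x. act V x \<zeta>))"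

definition EW :: "(nat \<Rightarrow> Cq) \<Rightarrow> (('m, 'n) uq \<Rightarrow> 'v) set" where
  "EW \<chi> = {\<zeta> \<in> Tot. (\<forall>a\<in>idxI CARD('m) CARD('n). act V (kp a) \<zeta> = fs (\<chi> a) \<zeta>) \<and> ufin \<zeta>}"

definition WF :: "(('m, 'n) uq \<Rightarrow> 'v) set" where
  "WF = (\<Union>\<chi>\<in>range (weight_char CARD('m) CARD('n)). EW \<chi>)"

lemma ufin_add:
  assumes "ufin u" "ufin v" "u \<in> HL" "v \<in> HL" shows "ufin (u + v)"
proof -
  obtain A B where A: "finite A" "range (\<lambda>x. act V x u) \<subseteq> fv.span A"
    and B: "finite B" "range (\<lambda>x. act V x v) \<subseteq> fv.span B"
    using assms unfolding ufin_def fin_spanned_def by blast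
  have "act V x (u + v) \<in> fv.span (A \<union> B)" for x
    unfolding act_add[OF assms(3,4)]
    using A(2) B(2) fv.span_mono[of A "A \<union> B"] fv.span_mono[of B "A \<union> B"]
    by (intro fv.span_add) auto
  then show ?thesis unfolding ufin_def fin_spanned_def using A(1) B(1) by (intro exI[of _ "A \<union> B"]) auto
qed

lemma ufin_scale:
  assumes "ufin u" "u \<in> HL" shows "ufin (fs c u)"
proof -
  obtain A where A: "finite A" "range (\<lambda>x. act V x u) \<subseteq> fv.span A"
    using assms unfolding ufin_def fin_spanned_def by blast
  have "act V x (fs c u) \<in> fv.span A" for x
    unfolding act_scale[OF assms(2)] using A(2) by (intro fv.span_scale) auto
  then show ?thesis unfolding ufin_def fin_spanned_def using A(1) by (intro exI[of _ A]) auto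
qed

lemma act_0: "act V x 0 = 0"
proof -
  have "act V x (fs 0 0) = fs 0 (act V x 0)" by (rule act_scale[OF fv.subspace_0[OF subspace_HL]])
  then show ?thesis by simp
qed

lemma EW_subspace: "fv.subspace (EW \<chi>)"
proof (rule fv.subspaceI)
  have "fin_spanned fs (range (\<lambda>x. act V x 0))"
    unfolding fin_spanned_def using fv.span_zero by (intro exI[of _ "{}"]) (auto simp: act_0)
  then show "0 \<in> EW \<chi>" unfolding EW_def ufin_def using gtot_0[OF grading_H] by (simp add: act_0)
  show "u + v \<in> EW \<chi>" if "u \<in> EW \<chi>" "v \<in> EW \<chi>" for u v
    using that Tot_HL gtot_add[OF grading_H] ufin_add act_add fv.scale_right_distrib unfolding EW_def by auto
  show "fs c u \<in> EW \<chi>" if "u \<in> EW \<chi>" for c u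
    using that Tot_HL fv.subspace_scale[OF subspace_Tot] ufin_scale act_scale fv.scale_left_commute
    unfolding EW_def by auto
qed

text \<open>Terms of equal weight are merged, so that the characters in \<open>X\<close> are
  distinct and can be separated afterwards.\<close>

lemma span_WF:
  assumes "v \<in> fv.span WF"
  shows "\<exists>X f. finite X \<and> X \<subseteq> range (weight_char CARD('m) CARD('n)) \<and> (\<forall>\<chi>\<in>X. f \<chi> \<in> EW \<chi>) \<and> v = sum f X"
  using assms
proof (induction v rule: fv.span_induct_alt)
  case base
  show ?case by (intro exI[of _ "{}"]) simp
next
  case (step c u v)
  obtain X f where X: "finite X" "X \<subseteq> range (weight_char CARD('m) CARD('n))" "\<forall>\<chi>\<in>X. f \<chi> \<in> EW \<chi>" "v = sum f X" using step by blast
  obtain \<chi> where \<chi>: "\<chi> \<in> range (weight_char CARD('m) CARD('n))" "u \<in> EW \<chi>" using step(1) unfolding WF_def by blast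
  define f' where "f' = f(\<chi> := fs c u + (if \<chi> \<in> X then f \<chi> else 0))"
  have "f' \<chi> \<in> EW \<chi>"
    using \<chi> X(3) fv.subspace_add[OF EW_subspace] fv.subspace_scale[OF EW_subspace]
    by (auto simp: f'_def)
  then have "\<forall>\<psi>\<in>insert \<chi> X. f' \<psi> \<in> EW \<psi>" using X(3) by (auto simp: f'_def)
  moreover have "fs c u + v = sum f' (insert \<chi> X)"
  proof -
    have "sum f' (insert \<chi> X) = f' \<chi> + sum f' (X - {\<chi>})" using X(1) by (rule sum.insert_remove)
    also have "sum f' (X - {\<chi>}) = sum f (X - {\<chi>})" by (rule sum.cong) (auto simp: f'_def)
    also have "f' \<chi> + sum f (X - {\<chi>}) = fs c u + sum f X"
      using sum.remove[OF X(1), of \<chi> f] by (auto simp: f'_def add.assoc)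
    finally show ?thesis using X(4) by simp
  qed
  ultimately show ?case using X \<chi> by (intro exI[of _ "insert \<chi> X"] exI[of _ f']) simp
qed

text \<open>Weight components are separated by the operators \<open>K\<^sub>a - \<chi>\<^sub>0(a)\<close>, which kill the component of
  weight \<open>\<chi>\<^sub>0\<close> and rescale the others.\<close>

lemma weight_component_in:
  assumes N: "gsubm N" and X: "finite X" "X \<subseteq> range (weight_char CARD('m) CARD('n))"
    and f: "\<forall>\<chi>\<in>X. f \<chi> \<in> EW \<chi>" and s: "sum f X \<in> N"
  shows "\<forall>\<chi>\<in>X. f \<chi> \<in> N"
  using X f s
proof (induction X arbitrary: f rule: finite_induct)
  case (insert \<chi>0 X)
  note sub = gsubmD(1)[OF N]
  let ?v = "sum f (insert \<chi>0 X)"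
  have HL: "f \<chi> \<in> HL" if "\<chi> \<in> insert \<chi>0 X" for \<chi>
    using insert.prems(2) that Tot_HL unfolding EW_def by blast
  have act_sum: "act V y (sum f Y) = (\<Sum>\<chi>\<in>Y. act V y (f \<chi>))" if "finite Y" "Y \<subseteq> insert \<chi>0 X" for y Y
    using that
  proof (induction Y rule: finite_induct)
    case (insert \<chi> Y)
    have "sum f Y \<in> HL" using insert.prems HL by (intro fv.subspace_sum[OF subspace_HL]) auto
    moreover have "f \<chi> \<in> HL" using insert.prems HL by simp
    ultimately show ?case using insert.prems
      by (simp only: sum.insert[OF insert.hyps(1,2)] act_add insert.IH insert_subset simp_thms)
  qed (simp add: act_0)
  have in_X: "f \<chi> \<in> N" if "\<chi> \<in> X" for \<chi>
  proof -
    have "\<chi> \<noteq> \<chi>0" using that insert.hyps by blast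
    then obtain a where "\<chi> a \<noteq> \<chi>0 a" by blast
    moreover have "\<chi> \<in> range (weight_char CARD('m) CARD('n))" "\<chi>0 \<in> range (weight_char CARD('m) CARD('n))" using that insert.prems(1) by blast+
    ultimately have a: "a \<in> idxI CARD('m) CARD('n)" "\<chi> a \<noteq> \<chi>0 a"
      unfolding weight_char_def by (auto split: if_splits)
    have ev: "act V (kp a) (f \<psi>) = fs (\<psi> a) (f \<psi>)" if "\<psi> \<in> insert \<chi>0 X" for \<psi>
      using insert.prems(2) that a(1) unfolding EW_def by blast
    have "act V (kp a) ?v - fs (\<chi>0 a) ?v = (\<Sum>\<psi>\<in>insert \<chi>0 X. fs (\<psi> a) (f \<psi>)) - (\<Sum>\<psi>\<in>insert \<chi>0 X. fs (\<chi>0 a) (f \<psi>))"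
      using insert.hyps(1) by (simp only: act_sum[OF _ subset_refl] finite_insert fv.scale_sum_right) (simp add: ev)
    also have "\<dots> = (\<Sum>\<psi>\<in>insert \<chi>0 X. fs (\<psi> a - \<chi>0 a) (f \<psi>))"
      by (simp only: sum_subtractf[symmetric] fv.scale_left_diff_distrib)
    also have "\<dots> = (\<Sum>\<psi>\<in>X. fs (\<psi> a - \<chi>0 a) (f \<psi>))"
      using insert.hyps by simp
    finally have "(\<Sum>\<psi>\<in>X. fs (\<psi> a - \<chi>0 a) (f \<psi>)) = act V (kp a) ?v - fs (\<chi>0 a) ?v" by (rule sym)
    also have "\<dots> \<in> N"
      using gsubmD(2)[OF N insert.prems(3)] fv.subspace_scale[OF sub insert.prems(3)] by (rule fv.subspace_diff[OF sub])
    finally have 1: "(\<Sum>\<psi>\<in>X. fs (\<psi> a - \<chi>0 a) (f \<psi>)) \<in> N" .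
    have 2: "\<forall>\<psi>\<in>X. fs (\<psi> a - \<chi>0 a) (f \<psi>) \<in> EW \<psi>"
      using insert.prems(2) fv.subspace_scale[OF EW_subspace] by blast
    have "\<forall>\<psi>\<in>X. fs (\<psi> a - \<chi>0 a) (f \<psi>) \<in> N"
      by (rule insert.IH[OF _ 2 1]) (use insert.prems(1) in blast)
    then have "fs (\<chi> a - \<chi>0 a) (f \<chi>) \<in> N" using that by blast
    then have "fs (inverse (\<chi> a - \<chi>0 a)) (fs (\<chi> a - \<chi>0 a) (f \<chi>)) \<in> N"
      by (rule fv.subspace_scale[OF sub])
    moreover have "inverse (\<chi> a - \<chi>0 a) * (\<chi> a - \<chi>0 a) = 1" using a(2) by simp
    ultimately show ?thesis by (simp only: fv.scale_scale fv.scale_one)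
  qed
  moreover have "f \<chi>0 \<in> N"
  proof -
    have "f \<chi>0 = ?v - sum f X" using insert.hyps by simp
    also have "\<dots> \<in> N"
      by (rule fv.subspace_diff[OF sub insert.prems(3) fv.subspace_sum[OF sub in_X]])
    finally show ?thesis .
  qed
  ultimately show ?case by blast
qed simp

lemma gsubm_span_WF:
  assumes N: "gsubm N" and W: "N \<subseteq> fv.span WF" shows "N \<subseteq> fv.span (N \<inter> WF)"
proof
  fix v assume v: "v \<in> N"
  then obtain X f where X: "finite X" "X \<subseteq> range (weight_char CARD('m) CARD('n))" "\<forall>\<chi>\<in>X. f \<chi> \<in> EW \<chi>" "v = sum f X"
    using span_WF W by blast
  then have "\<forall>\<chi>\<in>X. f \<chi> \<in> N" using weight_component_in[OF N X(1,2,3)] v by simp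
  then have "f \<chi> \<in> N \<inter> WF" if "\<chi> \<in> X" for \<chi> using X that unfolding WF_def by blast
  then show "v \<in> fv.span (N \<inter> WF)" unfolding X(4) by (intro fv.span_sum fv.span_base)
qed

text \<open>The category asks for spanning by weight vectors inside \<open>N\<close>; on the right
  they may lie outside. The two agree by \<open>gsubm_span_WF\<close>, and the form on the right is
  inherited by graded submodules of \<open>N\<close>.\<close>

lemma cat_obj_Mod: "cat_obj UNIV UNIV (Mod V N) \<longleftrightarrow> gsubm N \<and> N \<subseteq> fv.span WF"
proof -
  have wv: "weight_vector (Mod V N) \<mu> v \<longleftrightarrow> v \<in> N \<and>
      (\<forall>a\<in>idxI CARD('m) CARD('n). act V (kp a) v = fs (weight_char CARD('m) CARD('n) \<mu> a) v)" for \<mu> v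
    unfolding weight_vector_def Mod_simps
    by (rule conj_cong[OF refl]) (simp add: weight_char_def del: atLeastAtMost_iff)
  have "{v. (\<exists>\<mu>. weight_vector (Mod V N) \<mu> v) \<and> fin_spanned fs (range (\<lambda>x. restrict (act V x) N v))} = N \<inter> WF"
    if N: "gsubm N"
  proof (intro set_eqI)
    fix v
    have "v \<in> N \<inter> WF \<longleftrightarrow> v \<in> N \<and> v \<in> Tot \<and> ufin v \<and> (\<exists>\<mu>. \<forall>a\<in>idxI CARD('m) CARD('n).
        act V (kp a) v = fs (weight_char CARD('m) CARD('n) \<mu> a) v)"
      unfolding WF_def EW_def by blast
    also have "\<dots> \<longleftrightarrow> (\<exists>\<mu>. weight_vector (Mod V N) \<mu> v) \<and> fin_spanned fs (range (\<lambda>x. restrict (act V x) N v))"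
      using gsubmD(3)[OF N, of v] unfolding wv ufin_def
      by (cases "v \<in> N") (simp_all add: conj_commute)
    finally show "v \<in> {v. (\<exists>\<mu>. weight_vector (Mod V N) \<mu> v) \<and> fin_spanned fs (range (\<lambda>x. restrict (act V x) N v))} \<longleftrightarrow> v \<in> N \<inter> WF"
      by simp
  qed
  then have "cat_obj UNIV UNIV (Mod V N) \<longleftrightarrow> gsubm N \<and> N \<subseteq> fv.span (N \<inter> WF)"
    unfolding cat_obj_def super_module_Mod Mod_simps by (cases "gsubm N") (simp_all only: simp_thms)
  moreover have "N \<subseteq> fv.span (N \<inter> WF) \<Longrightarrow> N \<subseteq> fv.span WF"
    using fv.span_mono[of "N \<inter> WF" WF] by blast
  ultimately show ?thesis using gsubm_span_WF by blast
qed

text \<open>A sum of an even and an odd P-homomorphism that is homogeneous as a linear map equals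
  one of the two, by uniqueness of components in \<open>H\<close>. Hence the finer grading by
  \<open>hom_gr P V\<close> may be replaced by \<open>H\<close>.\<close>

lemma restrict_hom_mod:
  assumes pc: "pcompat P V" and N: "N \<subseteq> gtot (hom_gr P V)"
  shows "restrict_mod (hom_mod P V) N = Mod V N"
proof -
  note grP = grading_hom_gr[OF pc]
  have "N \<inter> hom_gr P V s = N \<inter> H s" for s
  proof
    show "N \<inter> H s \<subseteq> N \<inter> hom_gr P V s"
    proof
      fix \<zeta> assume z: "\<zeta> \<in> N \<inter> H s"
      then have "\<zeta> \<in> gtot (hom_gr P V)" using N by blast
      then obtain u w where u: "\<zeta> = u + w" "u \<in> hom_gr P V s" "w \<in> hom_gr P V (s + 1)" by (rule gtotE[OF grP])
      have "u = \<zeta>"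
        by (rule gr_unique(1)[OF grading_H, of u s w \<zeta> 0])
          (use u z hom_gr_mono gr_0[OF grading_H] in auto)
      then show "\<zeta> \<in> N \<inter> hom_gr P V s" using u z by blast
    qed
    show "N \<inter> hom_gr P V s \<subseteq> N \<inter> H s" using hom_gr_mono by blast
  qed
  moreover have "restrict (mact (hom_mod P V) x) N = restrict (act V x) N" for x
    using mact_hom_mod[OF pc] N by (intro restrict_ext) blast
  moreover have "mgrade (hom_mod P V) = hom_gr P V" "mscale (hom_mod P V) = fs" by (simp_all add: hom_mod_def)
  ultimately show ?thesis unfolding restrict_mod_def Mod_def by simp
qed

end

section \<open>Matrix elements\<close>

lemma vector_space_Cq: "vector_space ((*) :: Cq \<Rightarrow> Cq \<Rightarrow> Cq)"
  by unfold_locales (simp_all add: algebra_simps)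

interpretation fc: vector_space "fscale (*) :: Cq \<Rightarrow> ('u \<Rightarrow> Cq) \<Rightarrow> _"
  by (rule vector_space_fscale[OF vector_space_Cq])

lemma coord_algI:
  fixes M :: "('m::finite, 'n::finite, nat \<Rightarrow>\<^sub>0 Cq) smod"
  assumes "cat_obj UNIV UNIV M" "fin_spanned (mscale M) (mcarrier M)" "v \<in> mcarrier M"
    "lin_on (mcarrier M) (mscale M) (*) g"
  shows "(\<lambda>x. g (mact M x v)) \<in> coord_alg"
  unfolding coord_alg_def by (rule fc.span_base) (use assms in blast)

lemma coord_alg_subspace: "fc.subspace coord_alg"
  unfolding coord_alg_def by (rule fc.subspace_span)

lemma coord_alg_induct [consumes 1, case_names mat zero add scale]:
  fixes f :: "('m::finite, 'n::finite) uq \<Rightarrow> Cq"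
  assumes "f \<in> coord_alg"
    and "\<And>(M :: ('m, 'n, nat \<Rightarrow>\<^sub>0 Cq) smod) g v. cat_obj UNIV UNIV M \<Longrightarrow> fin_spanned (mscale M) (mcarrier M) \<Longrightarrow>
      v \<in> mcarrier M \<Longrightarrow> lin_on (mcarrier M) (mscale M) (*) g \<Longrightarrow> Q (\<lambda>x. g (mact M x v))"
    and "Q (\<lambda>x. 0)" "\<And>f f'. Q f \<Longrightarrow> Q f' \<Longrightarrow> Q (\<lambda>x. f x + f' x)" "\<And>c f. Q f \<Longrightarrow> Q (\<lambda>x. c * f x)"
  shows "Q f"
  using assms(1) unfolding coord_alg_def
proof (induction f rule: fc.span_induct)
  case base
  show ?case
    using assms(3-5) by (auto simp: fc.subspace_def fscale_def zero_fun_def plus_fun_def)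
next
  case (step f)
  then show ?case using assms(2) by blast
qed

lemma super_module_linD:
  assumes "super_module UNIV M"
  shows "lin_on (mcarrier M) (mscale M) (mscale M) (mact M x)"
    "v \<in> mcarrier M \<Longrightarrow> lin_on UNIV uq_scale (mscale M) (\<lambda>x. mact M x v)"
    "v \<in> mcarrier M \<Longrightarrow> mact M 1 v = v"
    "v \<in> mcarrier M \<Longrightarrow> mact M x v \<in> mcarrier M"
    "v \<in> mcarrier M \<Longrightarrow> mact M (x * y) v = mact M x (mact M y v)"
    "x \<in> uq_gr s \<Longrightarrow> v \<in> mgrade M t \<Longrightarrow> mact M x v \<in> mgrade M (s + t)"
  using assms unfolding super_module_def by blast+

lemma cat_obj_super_module: "cat_obj R K M \<Longrightarrow> super_module R M"
  by (simp add: cat_obj_def)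

lemma coord_alg_lin: "f \<in> coord_alg \<Longrightarrow> lin_on UNIV uq_scale (*) f"
proof (induction f rule: coord_alg_induct)
  case (mat M g v)
  note sm = super_module_linD[OF cat_obj_super_module[OF mat(1)]]
  note l = lin_onD[OF sm(2)[OF mat(3)]] and g = lin_onD[OF mat(4)]
  show ?case unfolding lin_on_def
    using l g sm(4)[OF mat(3)] by simp
qed (simp_all add: lin_on_def algebra_simps)

lemma coord_alg_linD:
  assumes "f \<in> coord_alg"
  shows "f (x + y) = f x + f y" "f (uq_scale c x) = c * f x" "f 0 = 0"
  using coord_alg_lin[OF assms] lin_on_0[OF coord_alg_lin[OF assms] vector_space_uq vector_space_Cq]
  by (simp_all add: lin_on_def)

lemma coord_alg_zero: "(\<lambda>x. 0) \<in> coord_alg"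
  using fc.subspace_0[OF coord_alg_subspace] by (simp add: zero_fun_def)

lemma coord_alg_add: "f \<in> coord_alg \<Longrightarrow> f' \<in> coord_alg \<Longrightarrow> (\<lambda>x. f x + f' x) \<in> coord_alg"
  using fc.subspace_add[OF coord_alg_subspace, of f f'] by (simp add: plus_fun_def)

lemma coord_alg_scale: "f \<in> coord_alg \<Longrightarrow> (\<lambda>x. c * f x) \<in> coord_alg"
  using fc.subspace_scale[OF coord_alg_subspace, of f c] by (simp add: fscale_def)

lemma coord_alg_ksign: "f \<in> coord_alg \<Longrightarrow> (\<lambda>x. ksign s (f x)) \<in> coord_alg"
  using coord_alg_scale[of f "- 1"] by (cases s rule: bit_exh) simp_all

lemma coord_alg_trans: "f \<in> coord_alg \<Longrightarrow> (\<lambda>x. f (x * y)) \<in> coord_alg"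
proof (induction f rule: coord_alg_induct)
  case (mat M g v)
  note sm = super_module_linD[OF cat_obj_super_module[OF mat(1)]]
  have "(\<lambda>x. g (mact M (x * y) v)) = (\<lambda>x. g (mact M x (mact M y v)))"
    by (simp only: sm(5)[OF mat(3)])
  then show ?case using coord_algI[OF mat(1,2) sm(4)[OF mat(3)] mat(4)] by simp
qed (rule coord_alg_zero coord_alg_add coord_alg_scale; assumption)+

lemma (in gmod) hcomp_scl:
  assumes "v \<in> gtot G" shows "hcomp G s (scl c v) = scl c (hcomp G s v)"
proof (rule hcomp_eq[OF grading_G])
  have "scl c v = scl c (hcomp G s v) + scl c (hcomp G (s + 1) v)"
    by (subst hcomp_split[OF grading_G assms, of s]) (rule vs.scale_right_distrib)
  then have "scl c v - scl c (hcomp G s v) = scl c (hcomp G (s + 1) v)"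
    by (simp only: add_diff_cancel_left')
  then show "scl c v - scl c (hcomp G s v) \<in> G (s + 1)"
    by (simp only: scl_gr[OF hcomp_in[OF grading_G assms]])
qed (rule scl_gr[OF hcomp_in[OF grading_G assms]])

text \<open>Split \<open>v\<close> into components \<open>w t\<close>. The component of degree
  \<open>r\<close> of \<open>x\<close> sends \<open>w t\<close> to the component of degree
  \<open>r + t\<close> of \<open>x\<close> applied to \<open>w t\<close>, so the projection can be
  absorbed into the functional \<open>g\<close>.\<close>

lemma coord_alg_hcomp: "f \<in> coord_alg \<Longrightarrow> (\<lambda>x. f (hcomp uq_gr r x)) \<in> coord_alg"
proof (induction f rule: coord_alg_induct)
  case (mat M g v)
  note sm = super_module_linD[OF cat_obj_super_module[OF mat(1)]]
  interpret M: gmod M by (rule gmod_super_module[OF cat_obj_super_module[OF mat(1)]])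
  note c = M.carrier
  have v: "v \<in> gtot (mgrade M)" using mat(3) c by simp
  define w where "w t = hcomp (mgrade M) t v" for t
  have w: "w t \<in> mgrade M t" "w t \<in> mcarrier M" for t
    unfolding w_def c using hcomp_in[OF M.grading_G v] gtot_gr[OF M.grading_G] by blast+
  have tot: "mact M x u \<in> gtot (mgrade M)" if "u \<in> mcarrier M" for x u using sm(4)[OF that] c by simp
  have lin: "lin_on (mcarrier M) (mscale M) (*) (\<lambda>u. g (hcomp (mgrade M) t u))" for t
    unfolding lin_on_def
  proof (intro conjI ballI allI)
    have h: "hcomp (mgrade M) t u \<in> mcarrier M" if "u \<in> mcarrier M" for u
      using that unfolding c by (intro gtot_gr[OF M.grading_G hcomp_in[OF M.grading_G]])
    fix u u' k assume u: "u \<in> mcarrier M"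
    show "g (hcomp (mgrade M) t (mscale M k u)) = k * g (hcomp (mgrade M) t u)"
      using M.hcomp_scl[of u t k] u lin_onD(2)[OF mat(4) h[OF u]] by (simp add: c)
    assume u': "u' \<in> mcarrier M"
    show "g (hcomp (mgrade M) t (u + u')) = g (hcomp (mgrade M) t u) + g (hcomp (mgrade M) t u')"
      using hcomp_add[OF M.grading_G, of u u' t] u u' lin_onD(1)[OF mat(4) h[OF u] h[OF u']] by (simp add: c)
  qed
  have e: "mact M (hcomp uq_gr r x) (w t) = hcomp (mgrade M) (r + t) (mact M x (w t))" for x t
  proof (rule hcomp_eq[OF M.grading_G, symmetric])
    show "mact M (hcomp uq_gr r x) (w t) \<in> mgrade M (r + t)" by (rule sm(6)[OF uq_hcomp_in w(1)])
    have "mact M x (w t) = mact M (hcomp uq_gr r x) (w t) + mact M (hcomp uq_gr (r + 1) x) (w t)"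
      by (subst uq_hcomp_split[of x r]) (rule lin_onD(1)[OF sm(2)[OF w(2)]], simp_all)
    then have "mact M x (w t) - mact M (hcomp uq_gr r x) (w t) = mact M (hcomp uq_gr (r + 1) x) (w t)"
      by (simp only: add_diff_cancel_left')
    also have "\<dots> \<in> mgrade M (r + t + 1)" using sm(6)[OF uq_hcomp_in w(1), of "r + 1" x t] by (simp only: ac_simps)
    finally show "mact M x (w t) - mact M (hcomp uq_gr r x) (w t) \<in> mgrade M (r + t + 1)" .
  qed
  have "v = w 0 + w 1" unfolding w_def using hcomp_split[OF M.grading_G v, of 0] by simp
  then have "g (mact M (hcomp uq_gr r x) v) =
      g (hcomp (mgrade M) (r + 0) (mact M x (w 0))) + g (hcomp (mgrade M) (r + 1) (mact M x (w 1)))" for x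
    by (simp only: lin_onD(1)[OF sm(1) w(2) w(2)] lin_onD(1)[OF mat(4) sm(4)[OF w(2)] sm(4)[OF w(2)]])
      (simp only: e)
  then show ?case
    using coord_alg_add[OF coord_algI[OF mat(1,2) w(2)[of 0] lin[of "r + 0"]] coord_algI[OF mat(1,2) w(2)[of 1] lin[of "r + 1"]]]
    by (simp only:)
qed (rule coord_alg_zero coord_alg_add coord_alg_scale; assumption)+

lemma grading_dual_gr: "grading (dual_gr :: bit \<Rightarrow> (('m::finite, 'n::finite) uq \<Rightarrow> Cq) set)"
  unfolding grading_def
proof (intro conjI allI ballI)
  show zero: "(0 :: ('m, 'n) uq \<Rightarrow> Cq) \<in> dual_gr s" for s by (simp add: dual_gr_def lin_on_def)
  show "u - v \<in> dual_gr s" if "u \<in> dual_gr s" "v \<in> dual_gr s" for s and u v :: "('m, 'n) uq \<Rightarrow> Cq"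
    using that unfolding dual_gr_def lin_on_def by (simp add: algebra_simps)
  show "dual_gr 0 \<inter> dual_gr 1 = {0 :: ('m, 'n) uq \<Rightarrow> Cq}"
  proof
    show "dual_gr 0 \<inter> dual_gr 1 \<subseteq> {0 :: ('m, 'n) uq \<Rightarrow> Cq}"
    proof
      fix f :: "('m, 'n) uq \<Rightarrow> Cq" assume f: "f \<in> dual_gr 0 \<inter> dual_gr 1"
      have "f x = 0" for x
      proof (induction x rule: uq_gr_induct)
        case (gr s x)
        then show ?case using f by (cases s rule: bit_exh) (simp_all add: dual_gr_def)
      next
        case (add x y)
        then show ?case using f by (simp add: dual_gr_def lin_on_def)
      qed
      then show "f \<in> {0}" by (simp add: fun_eq_iff)
    qed
    show "{0 :: ('m, 'n) uq \<Rightarrow> Cq} \<subseteq> dual_gr 0 \<inter> dual_gr 1" using zero by simp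
  qed
qed

lemma dual_gr_hcomp:
  assumes "lin_on UNIV uq_scale (*) f" shows "(\<lambda>x. f (hcomp uq_gr r x)) \<in> dual_gr r"
  unfolding dual_gr_def
proof (intro CollectI conjI ballI)
  show "lin_on UNIV uq_scale (*) (\<lambda>x. f (hcomp uq_gr r x))"
    using assms by (simp add: lin_on_def uq_hcomp_add uq_hcomp_scale)
  show "f (hcomp uq_gr r x) = 0" if "x \<in> uq_gr (r + 1)" for x
    using lin_on_0[OF assms vector_space_uq vector_space_Cq] hcomp_other[OF grading_uq that] by simp
qed

lemma hcomp_dual_gr:
  assumes "lin_on UNIV uq_scale (*) f" shows "hcomp dual_gr r f = (\<lambda>x. f (hcomp uq_gr r x))"
proof (rule hcomp_eq[OF grading_dual_gr dual_gr_hcomp[OF assms]])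
  have s: "f x = f (hcomp uq_gr r x) + f (hcomp uq_gr (r + 1) x)" for x
    by (subst uq_hcomp_split[of x r]) (rule lin_onD(1)[OF assms], simp_all)
  have "f - (\<lambda>x. f (hcomp uq_gr r x)) = (\<lambda>x. f (hcomp uq_gr (r + 1) x))"
  proof (rule ext)
    fix x
    show "(f - (\<lambda>x. f (hcomp uq_gr r x))) x = f (hcomp uq_gr (r + 1) x)" using s[of x] by simp
  qed
  then show "f - (\<lambda>x. f (hcomp uq_gr r x)) \<in> dual_gr (r + 1)"
    using dual_gr_hcomp[OF assms, of "r + 1"] by simp
qed

section \<open>Matrix elements of finite dimensional modules on arbitrary carriers\<close>

lemma fin_spanned_basis:
  assumes "vector_space scl" "module.subspace scl W" "fin_spanned scl W"
  shows "\<exists>B. finite B \<and> B \<subseteq> W \<and> \<not> module.dependent scl B \<and> module.span scl B = W"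
proof -
  interpret vector_space scl by (rule assms(1))
  obtain T where T: "finite T" "W \<subseteq> span T" using assms(3) unfolding fin_spanned_def by blast
  obtain B where B: "B \<subseteq> W" "independent B" "W \<subseteq> span B" by (rule basis_exists[of W])
  have "finite B"
    using independent_span_bound[OF T(1) B(2) subset_trans[OF B(1) T(2)]] by (rule conjunct1)
  moreover have "span B \<subseteq> W" by (rule span_minimal[OF B(1) assms(2)])
  ultimately show ?thesis using B by (intro exI[of _ B]) simp
qed

definition pm_scale :: "Cq \<Rightarrow> (nat \<Rightarrow>\<^sub>0 Cq) \<Rightarrow> (nat \<Rightarrow>\<^sub>0 Cq)" where
  "pm_scale c p = Poly_Mapping.map ((*) c) p"

lemma lookup_pm_scale [simp]: "Poly_Mapping.lookup (pm_scale c p) k = c * Poly_Mapping.lookup p k"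
  by (simp add: pm_scale_def map.rep_eq when_def)

lemma vector_space_pm: "vector_space pm_scale"
  by unfold_locales (simp_all add: poly_mapping_eq_iff fun_eq_iff lookup_add algebra_simps)

lemma (in vector_space) coordinates:
  assumes "finite B" "independent B"
  obtains h :: "'b \<Rightarrow> (nat \<Rightarrow>\<^sub>0 'a)" where "\<And>u v. u \<in> span B \<Longrightarrow> v \<in> span B \<Longrightarrow> h (u + v) = h u + h v"
    "\<And>c u k. u \<in> span B \<Longrightarrow> Poly_Mapping.lookup (h (scale c u)) k = c * Poly_Mapping.lookup (h u) k"
    "inj_on h (span B)"
proof -
  obtain e :: "'b \<Rightarrow> nat" and n where e: "e ` B = {i. i < n}" "inj_on e B"
    using finite_imp_inj_to_nat_seg[OF assms(1)] by blast
  define h where "h u = (\<Sum>b\<in>B. Poly_Mapping.single (e b) (representation B u b))" for u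
  have l: "Poly_Mapping.lookup (h u) k = (\<Sum>b\<in>B. representation B u b when e b = k)" for u k
    by (simp add: h_def lookup_sum lookup_single)
  have r: "Poly_Mapping.lookup (h u) (e b) = representation B u b" if "b \<in> B" for u b
  proof -
    have "(\<Sum>c\<in>B. representation B u c when e c = e b) = (\<Sum>c\<in>B. representation B u c when c = b)"
      by (rule sum.cong) (use e(2) that in \<open>auto simp: inj_on_def when_def\<close>)
    then show ?thesis using assms(1) that unfolding l by (simp add: when_def sum.delta)
  qed
  show thesis
  proof (rule that[of h])
    fix u v c k assume u: "u \<in> span B"
    show "Poly_Mapping.lookup (h (scale c u)) k = c * Poly_Mapping.lookup (h u) k"
      unfolding l sum_distrib_left using representation_scale[OF assms(2) u]
      by (intro sum.cong) (simp_all add: when_def)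
    assume v: "v \<in> span B"
    show "h (u + v) = h u + h v"
    proof -
      have "representation B (u + v) b = representation B u b + representation B v b" for b
        using representation_add[OF assms(2) v u] representation_add[OF assms(2) u v] by (simp add: add.commute)
      then show ?thesis unfolding h_def by (simp add: single_add sum.distrib)
    qed
  next
    show "inj_on h (span B)"
    proof (rule inj_onI)
      fix u v assume uv: "u \<in> span B" "v \<in> span B" "h u = h v"
      have c: "representation B u b = representation B v b" if "b \<in> B" for b
        using r[OF that, of u] r[OF that, of v] by (simp only: uv(3))
      have "u = (\<Sum>b\<in>B. scale (representation B u b) b)"
        by (rule sum_representation_eq[OF assms(2) uv(1) assms(1) subset_refl, symmetric])
      also have "\<dots> = (\<Sum>b\<in>B. scale (representation B v b) b)" by (rule sum.cong) (simp_all only: c)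
      also have "\<dots> = v" by (rule sum_representation_eq[OF assms(2) uv(2) assms(1) subset_refl])
      finally show "u = v" .
    qed
  qed
qed

text \<open>Removes the restriction of \<open>coord_alg\<close> to modules of finitely supported
  sequences: the module structure is carried over by the coordinate map \<open>h\<close> of a finite
  basis, and the functional by its inverse \<open>i\<close>.\<close>

lemma coord_alg_matrix:
  fixes W :: "('m::finite, 'n::finite, 'w::ab_group_add) smod"
  assumes W: "cat_obj UNIV UNIV W" and fin: "fin_spanned (mscale W) (mcarrier W)"
    and v: "v \<in> mcarrier W" and g: "lin_on (mcarrier W) (mscale W) (*) g"
  shows "(\<lambda>x. g (mact W x v)) \<in> coord_alg"
proof -
  note smW = cat_obj_super_module[OF W]
  note sm = super_module_linD[OF smW]
  interpret W: gmod W by (rule gmod_super_module[OF smW])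
  interpret pm: vector_space pm_scale by (rule vector_space_pm)
  define C where "C = mcarrier W"
  have C: "C = gtot (mgrade W)" unfolding C_def by (rule W.carrier)
  have subC: "W.vs.subspace C" unfolding C by (rule W.subspace_carrier)
  obtain B where B: "finite B" "B \<subseteq> C" "W.vs.independent B" "W.vs.span B = C"
    using fin_spanned_basis[OF W.vs subC] fin unfolding C_def by blast
  obtain h :: "'w \<Rightarrow> nat \<Rightarrow>\<^sub>0 Cq" where h: "\<And>u v. u \<in> C \<Longrightarrow> v \<in> C \<Longrightarrow> h (u + v) = h u + h v"
    "\<And>c u k. u \<in> C \<Longrightarrow> Poly_Mapping.lookup (h (mscale W c u)) k = c * Poly_Mapping.lookup (h u) k"
    "inj_on h C"
    using W.vs.coordinates[OF B(1,3)] unfolding B(4) by metis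
  have hs: "h (mscale W c u) = pm_scale c (h u)" if "u \<in> C" for c u
    by (rule poly_mapping_eqI) (simp add: h(2)[OF that])
  have Cadd: "u + w \<in> C" "mscale W c u \<in> C" "0 \<in> C" if "u \<in> C" "w \<in> C" for u w c
    using W.vs.subspace_add[OF subC] W.vs.subspace_scale[OF subC] W.vs.subspace_0[OF subC] that by blast+
  have C0: "0 \<in> C" by (rule W.vs.subspace_0[OF subC])
  have h0: "h 0 = 0" using hs[OF C0, of 0] by simp
  have h0_im: "0 \<in> h ` mgrade W s" for s
    using imageI[OF gr_0[OF W.grading_G, of s], of h] by (simp only: h0)
  have grC: "u \<in> mgrade W s \<Longrightarrow> u \<in> C" for u s unfolding C by (rule gtot_gr[OF W.grading_G])
  have cl: "u \<in> C \<Longrightarrow> mact W x u \<in> C" for u x unfolding C_def by (rule sm(4))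
  define i where "i = inv_into C h"
  have i: "i (h u) = u" if "u \<in> C" for u unfolding i_def by (rule inv_into_f_f[OF h(3) that])
  define M where "M = \<lparr> mcarrier = h ` C, mgrade = (\<lambda>s. h ` mgrade W s), mscale = pm_scale,
    mact = (\<lambda>x u. h (mact W x (i u))) \<rparr>"
  have M: "mcarrier M = h ` C" "mgrade M = (\<lambda>s. h ` mgrade W s)" "mscale M = pm_scale"
    "mact M x u = h (mact W x (i u))" for x u by (simp_all add: M_def)
  have actM: "mact M x (h u) = h (mact W x u)" if "u \<in> C" for x u by (simp add: M i[OF that])
  have smM: "super_module UNIV M"
    unfolding super_module_def
  proof (intro conjI allI ballI)
    show "vector_space (mscale M)" unfolding M by (rule vector_space_pm)
    show "module.subspace (mscale M) (mgrade M s)" for s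
      unfolding M
    proof (rule pm.subspaceI)
      show "0 \<in> h ` mgrade W s" by (rule h0_im)
      show "x + y \<in> h ` mgrade W s" if xy: "x \<in> h ` mgrade W s" "y \<in> h ` mgrade W s" for x y
      proof -
        obtain a b where "x = h a" "y = h b" "a \<in> mgrade W s" "b \<in> mgrade W s" using xy by blast
        then have "x + y = h (a + b)" "a + b \<in> mgrade W s"
          by (simp_all only: h(1)[OF grC grC] gr_add[OF W.grading_G])
        then show ?thesis by (rule image_eqI)
      qed
      show "pm_scale c x \<in> h ` mgrade W s" if x: "x \<in> h ` mgrade W s" for c x
      proof -
        obtain a where "x = h a" "a \<in> mgrade W s" using x by blast
        then have "pm_scale c x = h (mscale W c a)" "mscale W c a \<in> mgrade W s"
          by (simp_all only: hs[OF grC] W.scl_gr)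
        then show ?thesis by (rule image_eqI)
      qed
    qed
    show "mgrade M 0 \<inter> mgrade M 1 = {0}"
    proof
      show "mgrade M 0 \<inter> mgrade M 1 \<subseteq> {0}"
      proof
        fix z assume "z \<in> mgrade M 0 \<inter> mgrade M 1"
        then obtain a b where ab: "z = h a" "z = h b" "a \<in> mgrade W 0" "b \<in> mgrade W 1" unfolding M by blast
        then have "h a = h b" "a \<in> C" "b \<in> C" using grC by simp_all
        then have "a = b" by (rule inj_onD[OF h(3)])
        then have "a = 0" using ab gr_inter[OF W.grading_G, of a 0] by simp
        then show "z \<in> {0}" using ab h0 by simp
      qed
      show "{0} \<subseteq> mgrade M 0 \<inter> mgrade M 1"
        unfolding M
        using h0_im by blast
    qed
    show "mcarrier M = {u + v |u v. u \<in> mgrade M 0 \<and> v \<in> mgrade M 1}"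
      unfolding M
    proof (intro equalityI subsetI)
      fix z assume "z \<in> h ` C"
      then obtain a b where "z = h (a + b)" "a \<in> mgrade W 0" "b \<in> mgrade W 1" unfolding C gtot_def by blast
      then have "z = h a + h b" "h a \<in> h ` mgrade W 0" "h b \<in> h ` mgrade W 1"
        by (simp_all only: h(1)[OF grC grC] imageI)
      then show "z \<in> {u + v |u v. u \<in> h ` mgrade W 0 \<and> v \<in> h ` mgrade W 1}" by blast
    next
      fix z assume "z \<in> {u + v |u v. u \<in> h ` mgrade W 0 \<and> v \<in> h ` mgrade W 1}"
      then obtain a b where "z = h a + h b" "a \<in> mgrade W 0" "b \<in> mgrade W 1" by blast
      then have "z = h (a + b)" "a + b \<in> C" by (simp_all only: h(1)[OF grC grC] Cadd(1)[OF grC grC])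
      then show "z \<in> h ` C" by blast
    qed
    show "mact M x ` mcarrier M \<subseteq> mcarrier M" for x
      unfolding M(1) by (rule image_subsetI, elim imageE) (simp add: actM cl)
    show "lin_on (mcarrier M) (mscale M) (mscale M) (mact M x)" for x
      unfolding lin_on_def M(1,3)
    proof (intro conjI ballI allI)
      fix u w c assume "u \<in> h ` C"
      then obtain a where a: "u = h a" "a \<in> C" by blast
      show "mact M x (pm_scale c u) = pm_scale c (mact M x u)"
        using a lin_onD(2)[OF sm(1)[of x], of a c] by (simp add: C_def[symmetric] hs[symmetric] actM Cadd cl)
      assume "w \<in> h ` C"
      then obtain b where b: "w = h b" "b \<in> C" by blast
      show "mact M x (u + w) = mact M x u + mact M x w"
        using a b lin_onD(1)[OF sm(1)[of x], of a b] by (simp add: C_def[symmetric] h(1)[symmetric] actM Cadd cl)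
    qed
    show "lin_on UNIV uq_scale (mscale M) (\<lambda>x. mact M x u)" if u: "u \<in> mcarrier M" for u
    proof -
      obtain a where a: "u = h a" "a \<in> C" using u unfolding M by blast
      have "lin_on UNIV uq_scale (mscale W) (\<lambda>x. mact W x a)" using sm(2) a unfolding C_def by blast
      note l = lin_onD[OF this]
      show ?thesis unfolding lin_on_def M(3) a(1)
        by (simp add: actM[OF a(2)] l h(1)[OF cl cl] hs[OF cl] a(2))
    qed
    show "mact M 1 u = u" if "u \<in> mcarrier M" for u
      using that sm(3) unfolding M(1) C_def[symmetric] by (auto simp: actM)
    show "mact M (x * y) u = mact M x (mact M y u)" if "u \<in> mcarrier M" for x y u
      using that sm(5) cl unfolding M(1) C_def[symmetric] by (auto simp: actM)
    show "mact M x u \<in> mgrade M (s + t)" if "x \<in> UNIV \<inter> uq_gr s" "u \<in> mgrade M t" for s t x u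
    proof -
      obtain a where a: "u = h a" "a \<in> mgrade W t" using \<open>u \<in> mgrade M t\<close> unfolding M by blast
      then show ?thesis using sm(6)[of x s a t] that(1) grC actM unfolding M(2) by auto
    qed
  qed
  \<comment> \<open>Used twice: for finite dimension and for spanning by weight vectors.\<close>
  have hspan: "h u \<in> pm.span (h ` A) \<and> u \<in> C" if "A \<subseteq> C" "u \<in> W.vs.span A" for A u
    using that(2)
  proof (induction u rule: W.vs.span_induct_alt)
    case base
    show ?case using h0 C0 pm.span_zero by simp
  next
    case (step c a u)
    then have a: "a \<in> C" using that(1) by blast
    have "h (mscale W c a + u) = pm_scale c (h a) + h u" using step a by (simp add: h(1) hs Cadd)
    moreover have "pm_scale c (h a) + h u \<in> pm.span (h ` A)"
      using step by (intro pm.span_add[OF pm.span_scale[OF pm.span_base[OF imageI]]]) simp_all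
    ultimately show ?case using step a by (simp add: Cadd)
  qed
  have finM: "fin_spanned (mscale M) (mcarrier M)"
    unfolding fin_spanned_def M using B hspan[OF B(2)] by (intro exI[of _ "h ` B"]) auto
  have "cat_obj UNIV UNIV M"
    unfolding cat_obj_def
  proof (intro conjI smM)
    let ?A = "{u. (\<exists>\<mu>. weight_vector W \<mu> u) \<and> fin_spanned (mscale W) (range (\<lambda>x. mact W x u))}"
    have A: "?A \<subseteq> C" unfolding weight_vector_def C_def by blast
    have "h ` ?A \<subseteq> {u. (\<exists>\<mu>. weight_vector M \<mu> u) \<and> fin_spanned (mscale M) (range (\<lambda>x. mact M x u))}"
    proof (intro image_subsetI CollectI conjI)
      fix u assume u: "u \<in> ?A"
      then have uC: "u \<in> C" using A by blast
      from u obtain \<mu> where \<mu>: "weight_vector W \<mu> u" by blast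
      have "weight_vector M \<mu> (h u)"
        using \<mu> uC unfolding weight_vector_def M(1,3) by (simp add: actM hs[symmetric] del: atLeastAtMost_iff)
      then show "\<exists>\<mu>. weight_vector M \<mu> (h u)" by blast
      have "range (\<lambda>x. mact M x (h u)) \<subseteq> mcarrier M"
        using super_module_linD(4)[OF smM] uC unfolding M(1) by blast
      then show "fin_spanned (mscale M) (range (\<lambda>x. mact M x (h u)))"
        using finM unfolding fin_spanned_def by (meson subset_trans)
    qed
    from pm.span_mono[OF this]
    have "pm.span (h ` ?A) \<subseteq> pm.span {u. (\<exists>\<mu>. weight_vector M \<mu> u) \<and> fin_spanned (mscale M) (range (\<lambda>x. mact M x u))}" .
    moreover have "C \<subseteq> W.vs.span ?A" using W unfolding cat_obj_def C_def by blast
    ultimately show "mcarrier M \<subseteq> module.span (mscale M)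
       {u. (\<exists>\<mu>. weight_vector M \<mu> u) \<and> fin_spanned (mscale M) (range (\<lambda>x. mact M x u))}"
      unfolding M(1) M(3) using hspan[OF A] by blast
  qed
  moreover have "lin_on (mcarrier M) (mscale M) (*) (\<lambda>u. g (i u))"
    unfolding lin_on_def M(1,3)
  proof (intro conjI ballI allI)
    fix u w c assume "u \<in> h ` C"
    then obtain a where a: "u = h a" "a \<in> C" by blast
    show "g (i (pm_scale c u)) = c * g (i u)"
      using a lin_onD(2)[OF g, of a c] by (simp add: C_def[symmetric] hs[symmetric] i Cadd)
    assume "w \<in> h ` C"
    then obtain b where b: "w = h b" "b \<in> C" by blast
    show "g (i (u + w)) = g (i u) + g (i w)"
      using a b lin_onD(1)[OF g, of a b] by (simp add: C_def[symmetric] h(1)[symmetric] i Cadd)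
  qed
  moreover have vC: "v \<in> C" "h v \<in> mcarrier M" using v unfolding M C_def by simp_all
  ultimately have "(\<lambda>x. g (i (mact M x (h v)))) \<in> coord_alg" using finM by (intro coord_algI)
  moreover have "g (i (mact M x (h v))) = g (mact W x v)" for x using vC by (simp add: actM i cl)
  ultimately show ?thesis by simp
qed

section \<open>The tensor product as a space of linear maps\<close>

context gmod
begin

abbreviation "pure \<equiv> (pure_tensor (mscale V) :: 'v \<Rightarrow> (('m, 'n) uq \<Rightarrow> Cq) \<Rightarrow> _)"

lemma pure_apply: "pure \<xi> f x = scl (f x) \<xi>"
  by (simp add: pure_tensor_def)

lemma pure_hom:
  assumes "\<xi> \<in> G s" "f \<in> coord_alg" "f \<in> dual_gr t"
  shows "pure \<xi> f \<in> H (s + t)"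
proof -
  have "lin_on UNIV uq_scale scl (pure \<xi> f)"
    unfolding lin_on_def by (simp add: pure_apply coord_alg_linD[OF assms(2)] vs.scale_left_distrib)
  moreover have "pure \<xi> f x \<in> G (r + (s + t))" if "x \<in> uq_gr r" for r x
  proof (cases "r = t")
    case True
    then have "r + (s + t) = s" by (simp add: add.left_commute)
    then show ?thesis using scl_gr[OF assms(1)] by (simp only: pure_apply)
  next
    case False
    then have "f x = 0" using that assms(3) unfolding dual_gr_def bit_neq_iff by blast
    then show ?thesis using gr_0[OF grading_G] by (simp add: pure_apply)
  qed
  ultimately show ?thesis unfolding hom_gr_def by blast
qed

lemma subspace_tensor_space: "fv.subspace (tensor_space V)"
  unfolding tensor_space_def by (rule fv.subspace_span)

lemma subspace_tensor_gr: "fv.subspace (tensor_gr V r)"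
  unfolding tensor_gr_def by (rule fv.subspace_span)

lemma pure_tensor_space: "\<xi> \<in> gtot G \<Longrightarrow> f \<in> coord_alg \<Longrightarrow> pure \<xi> f \<in> tensor_space V"
  unfolding tensor_space_def carrier by (rule fv.span_base) blast

text \<open>Scalars are absorbed into the functional, and left factors are split into homogeneous
  parts, so that a sign can be assigned to each pure tensor.\<close>

lemma tensor_induct [consumes 1, case_names pure add]:
  assumes "\<zeta> \<in> tensor_space V"
    and pure: "\<And>s \<xi> f. \<xi> \<in> G s \<Longrightarrow> f \<in> coord_alg \<Longrightarrow> Q (pure \<xi> f)"
    and add: "\<And>a b. a \<in> tensor_space V \<Longrightarrow> b \<in> tensor_space V \<Longrightarrow> Q a \<Longrightarrow> Q b \<Longrightarrow> Q (a + b)"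
  shows "Q \<zeta>"
proof -
  have 1: "Q (pure \<xi> f) \<and> pure \<xi> f \<in> tensor_space V" if \<xi>: "\<xi> \<in> gtot G" and f: "f \<in> coord_alg" for \<xi> f
  proof -
    obtain a b where ab: "\<xi> = a + b" "a \<in> G 0" "b \<in> G (0 + 1)" by (rule gtotE[OF grading_G \<xi>])
    then have tot: "a \<in> gtot G" "b \<in> gtot G" using gtot_gr[OF grading_G] by blast+
    have "pure \<xi> f = pure a f + pure b f"
      by (rule ext) (simp add: pure_apply ab(1) vs.scale_right_distrib)
    then show ?thesis
      using add[OF pure_tensor_space[OF tot(1) f] pure_tensor_space[OF tot(2) f] pure[OF ab(2) f] pure[OF ab(3) f]]
        pure_tensor_space[OF \<xi> f] by simp
  qed
  have "\<zeta> \<in> fv.span {pure \<xi> f | \<xi> f. \<xi> \<in> gtot G \<and> f \<in> coord_alg}"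
    using assms(1) unfolding tensor_space_def carrier .
  then have "Q \<zeta> \<and> \<zeta> \<in> tensor_space V"
  proof (induction \<zeta> rule: fv.span_induct_alt)
    case base
    have "pure 0 (\<lambda>x. 0) = 0" by (rule ext) (simp add: pure_apply)
    then show ?case using 1[OF gtot_0[OF grading_G] coord_alg_zero] by (simp only:)
  next
    case (step c u v)
    then obtain \<xi> f where u: "u = pure \<xi> f" "\<xi> \<in> gtot G" "f \<in> coord_alg" by blast
    have "fs c u = pure \<xi> (\<lambda>x. c * f x)" by (rule ext) (simp add: u(1) pure_apply)
    then have u': "Q (fs c u)" "fs c u \<in> tensor_space V" using 1[OF u(2) coord_alg_scale[OF u(3)]] by (simp_all only:)
    have v: "Q v" "v \<in> tensor_space V" using step by blast+
    show ?case
      using add[OF u'(2) v(2) u'(1) v(1)] fv.subspace_add[OF subspace_tensor_space u'(2) v(2)]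
      by blast
  qed
  then show ?thesis ..
qed

lemma tensor_gr_hom: "tensor_gr V r \<subseteq> H r"
  unfolding tensor_gr_def
  by (rule fv.span_minimal[OF _ subspace_hom_gr[OF pcompat_empty]]) (auto intro: pure_hom)

lemma tensor_gr_space: "tensor_gr V r \<subseteq> tensor_space V"
  unfolding tensor_gr_def
  by (rule fv.span_minimal[OF _ subspace_tensor_space])
    (auto intro: pure_tensor_space gtot_gr[OF grading_G])

text \<open>With a homogeneous left factor, splitting the functional by the parity of its argument
  splits the tensor; \<open>coord_alg_hcomp\<close> keeps both parts among the matrix
  elements.\<close>

lemma tensor_space_gr: "tensor_space V \<subseteq> gtot (tensor_gr V)"
proof
  fix \<zeta> assume "\<zeta> \<in> tensor_space V"
  then show "\<zeta> \<in> gtot (tensor_gr V)"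
  proof (induction \<zeta> rule: tensor_induct)
    case (pure s \<xi> f)
    note l = coord_alg_lin[OF pure(2)]
    have g: "pure \<xi> (\<lambda>x. f (hcomp uq_gr t x)) \<in> tensor_gr V (s + t)" for t
      unfolding tensor_gr_def
      by (rule fv.span_base) (use pure coord_alg_hcomp[OF pure(2)] dual_gr_hcomp[OF l] in blast)
    have "pure \<xi> f = pure \<xi> (\<lambda>x. f (hcomp uq_gr s x)) + pure \<xi> (\<lambda>x. f (hcomp uq_gr (s + 1) x))"
    proof (rule ext)
      fix x
      have "f x = f (hcomp uq_gr s x) + f (hcomp uq_gr (s + 1) x)"
        by (subst uq_hcomp_split[of x s]) (rule coord_alg_linD(1)[OF pure(2)])
      then show "pure \<xi> f x = (pure \<xi> (\<lambda>x. f (hcomp uq_gr s x)) + pure \<xi> (\<lambda>x. f (hcomp uq_gr (s + 1) x))) x"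
        by (simp only: pure_apply plus_fun_apply vs.scale_left_distrib)
    qed
    moreover have "pure \<xi> (\<lambda>x. f (hcomp uq_gr s x)) \<in> tensor_gr V 0" using g[of s] by simp
    moreover have "pure \<xi> (\<lambda>x. f (hcomp uq_gr (s + 1) x)) \<in> tensor_gr V 1" using g[of "s + 1"] by simp
    ultimately show ?case unfolding gtot_def by blast
  next
    case (add a b)
    show ?case by (rule fv.subspace_add[OF gtot_subspace[OF subspace_tensor_gr] add(3,4)])
  qed
qed

lemma tensor_space_Tot: "\<zeta> \<in> tensor_space V \<Longrightarrow> \<zeta> \<in> Tot"
  using tensor_space_gr tensor_gr_hom unfolding gtot_def by blast

lemma tensor_space_HL: "\<zeta> \<in> tensor_space V \<Longrightarrow> \<zeta> \<in> HL"
  by (rule Tot_HL[OF tensor_space_Tot])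

lemma tensor_hcomp: "\<zeta> \<in> tensor_space V \<Longrightarrow> hcomp H r \<zeta> \<in> tensor_gr V r"
proof -
  assume "\<zeta> \<in> tensor_space V"
  then obtain u w where u: "\<zeta> = u + w" "u \<in> tensor_gr V 0" "w \<in> tensor_gr V 1"
    using tensor_space_gr unfolding gtot_def by blast
  then have h: "u \<in> H 0" "w \<in> H 1" using tensor_gr_hom by blast+
  have "hcomp H 0 \<zeta> = u" by (rule hcomp_eq[OF grading_H]) (simp_all add: u h)
  moreover have "hcomp H 1 \<zeta> = w" by (rule hcomp_eq[OF grading_H]) (simp_all add: u h)
  ultimately show ?thesis using u by (cases r rule: bit_exh) simp_all
qed

text \<open>All values of the tensor are multiples of \<open>\<xi>\<close> and have its degree
  \<open>p\<close>, so the action changes only the functional.\<close>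

lemma act_pure:
  assumes "\<xi> \<in> G p" "f \<in> coord_alg"
  shows "act V y (pure \<xi> f) x = scl (\<Sum>s\<in>{0, 1}. ksign (s + s * p) (f (x * hcomp uq_gr s y))) \<xi>"
proof -
  have "ksign s (gtw G s (scl c \<xi>)) = scl (ksign (s + s * p) c) \<xi>" for s c
    using gtw_gr[OF grading_G scl_gr[OF assms(1)], of s c]
    by (simp add: ksign_ksign) (simp add: ksign_def)
  then show ?thesis
    unfolding act_def pure_apply by (simp add: vs.scale_left_distrib)
qed

lemma act_tensor_space: "\<zeta> \<in> tensor_space V \<Longrightarrow> act V y \<zeta> \<in> tensor_space V"
proof (induction \<zeta> rule: tensor_induct)
  case (pure p \<xi> f)
  let ?F = "\<lambda>x. \<Sum>s\<in>{0, 1}. ksign (s + s * p) (f (x * hcomp uq_gr s y))"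
  have "?F \<in> coord_alg"
    unfolding bit_sum by (intro coord_alg_add coord_alg_ksign coord_alg_trans pure(2))
  moreover have "act V y (pure \<xi> f) = pure \<xi> ?F"
    by (rule ext) (simp only: act_pure[OF pure] pure_apply)
  ultimately show ?case using pure_tensor_space[OF gtot_gr[OF grading_G pure(1)]] by simp
next
  case (add a b)
  show ?case unfolding act_add[OF tensor_space_HL[OF add(1)] tensor_space_HL[OF add(2)]]
    by (rule fv.subspace_add[OF subspace_tensor_space add(3,4)])
qed

text \<open>Replacing the functional in \<open>act_pure\<close> by a matrix element of
  \<open>v\<close> turns the action into a change of the vector. The orbit therefore lies in the
  span of the tensors that belong to a basis of \<open>M\<close>, and the weight of \<open>v\<close>
  is inherited.\<close>

lemma pure_weight_WF:
  fixes M :: "('m, 'n, nat \<Rightarrow>\<^sub>0 Cq) smod"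
  assumes M: "cat_obj UNIV UNIV M" "fin_spanned (mscale M) (mcarrier M)"
    and v: "weight_vector M \<mu> v" and g: "lin_on (mcarrier M) (mscale M) (*) g" and \<xi>: "\<xi> \<in> G p"
  shows "pure \<xi> (\<lambda>x. g (mact M x v)) \<in> WF"
proof -
  note sm = super_module_linD[OF cat_obj_super_module[OF M(1)]]
  interpret M: gmod M by (rule gmod_super_module[OF cat_obj_super_module[OF M(1)]])
  define C where "C = mcarrier M"
  have C: "C = gtot (mgrade M)" unfolding C_def by (rule M.carrier)
  have subC: "M.vs.subspace C" unfolding C by (rule M.subspace_carrier)
  have vC: "v \<in> C" using v unfolding weight_vector_def C_def by blast
  have f: "(\<lambda>x. g (mact M x u)) \<in> coord_alg" if "u \<in> C" for u
    using coord_algI[OF M _ g] that unfolding C_def by blast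
  let ?\<zeta> = "pure \<xi> (\<lambda>x. g (mact M x v))"
  have T: "?\<zeta> \<in> tensor_space V" by (rule pure_tensor_space[OF gtot_gr[OF grading_G \<xi>] f[OF vC]])
  obtain B where B: "finite B" "B \<subseteq> C" "M.vs.span B = C"
    using fin_spanned_basis[OF M.vs subC] M(2) unfolding C_def by blast
  have ga: "g (u + w) = g u + g w" "g (mscale M c u) = c * g u" if "u \<in> C" "w \<in> C" for u w c
    using lin_onD[OF g, of u] that unfolding C_def by blast+
  have cl: "mact M x u \<in> C" if "u \<in> C" for x u using sm(4) that unfolding C_def by blast
  have ma: "mact M x (u + w) = mact M x u + mact M x w" "mact M x (mscale M c u) = mscale M c (mact M x u)"
    if "u \<in> C" "w \<in> C" for x u w c
    using lin_onD[OF sm(1), of u] that unfolding C_def by blast+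
  have span: "pure \<xi> (\<lambda>x. g (mact M x u)) \<in> fv.span ((\<lambda>b. pure \<xi> (\<lambda>x. g (mact M x b))) ` B) \<and> u \<in> C"
    if "u \<in> C" for u
  proof -
    have "u \<in> M.vs.span B" using that B(3) by simp
    then show ?thesis
    proof (induction u rule: M.vs.span_induct_alt)
      case base
      have C0: "0 \<in> C" by (rule M.vs.subspace_0[OF subC])
      have "g (mact M x 0) = 0" for x using ma(2)[OF C0 C0, of x 0] ga(2)[OF cl[OF C0] C0, of 0 x] by simp
      then have "pure \<xi> (\<lambda>x. g (mact M x 0)) = 0" by (intro ext) (simp add: pure_apply)
      then show ?case by (simp only: fv.span_zero C0 simp_thms)
    next
      case (step c b u)
      then have b: "b \<in> C" "mscale M c b \<in> C" and u: "u \<in> C"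
        using B M.vs.subspace_scale[OF subC] by blast+
      have "pure \<xi> (\<lambda>x. g (mact M x (mscale M c b + u))) =
          fs c (pure \<xi> (\<lambda>x. g (mact M x b))) + pure \<xi> (\<lambda>x. g (mact M x u))"
      proof (rule ext)
        fix x
        have "g (mact M x (mscale M c b + u)) = c * g (mact M x b) + g (mact M x u)"
          using ma(1)[OF b(2) u, of x] ma(2)[OF b(1) u, of x c] ga(1)[OF cl[OF b(2)] cl[OF u], of x x]
            ga(2)[OF cl[OF b(1)] u, of c x] by simp
        then show "pure \<xi> (\<lambda>x. g (mact M x (mscale M c b + u))) x =
          (fs c (pure \<xi> (\<lambda>x. g (mact M x b))) + pure \<xi> (\<lambda>x. g (mact M x u))) x"
          by (simp only: pure_apply plus_fun_apply fs_apply vs.scale_left_distrib vs.scale_scale)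
      qed
      also have "\<dots> \<in> fv.span ((\<lambda>b. pure \<xi> (\<lambda>x. g (mact M x b))) ` B)"
        by (rule fv.span_add[OF fv.span_scale[OF fv.span_base[OF imageI[OF step(1)]]]]) (use step in blast)
      finally show ?case using M.vs.subspace_add[OF subC b(2) u] by blast
    qed
  qed
  have "act V y ?\<zeta> \<in> fv.span ((\<lambda>b. pure \<xi> (\<lambda>x. g (mact M x b))) ` B)" for y
  proof -
    \<comment> \<open>The vector whose matrix element is the translated functional in
      \<open>act_pure\<close>.\<close>
    define w where "w = (\<Sum>s\<in>{0, 1}. ksign (s + s * p) (mact M (hcomp uq_gr s y) v))"
    have k: "ksign t u \<in> C" "g (mact M x (ksign t u)) = ksign t (g (mact M x u))" if "u \<in> C" for t u x
    proof -
      have n: "mscale M (- 1) u = - u" by simp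
      show "ksign t u \<in> C" using M.vs.subspace_scale[OF subC that, of "- 1"] that by (simp add: ksign_def)
      show "g (mact M x (ksign t u)) = ksign t (g (mact M x u))"
        using ma(2)[OF that that, of x "- 1"] ga(2)[OF cl[OF that] that, of "- 1" x] by (simp add: ksign_def)
    qed
    have w: "w = ksign (0 + 0 * p) (mact M (hcomp uq_gr 0 y) v) + ksign (1 + 1 * p) (mact M (hcomp uq_gr 1 y) v)"
      unfolding w_def by (rule bit_sum)
    have wC: "w \<in> C" unfolding w by (rule M.vs.subspace_add[OF subC k(1)[OF cl[OF vC]] k(1)[OF cl[OF vC]]])
    have "g (mact M x w) = ksign (0 + 0 * p) (g (mact M (x * hcomp uq_gr 0 y) v)) +
       ksign (1 + 1 * p) (g (mact M (x * hcomp uq_gr 1 y) v))" for x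
      using ma(1)[OF k(1)[OF cl[OF vC]] k(1)[OF cl[OF vC]]] ga(1)[OF cl[OF k(1)[OF cl[OF vC]]] cl[OF k(1)[OF cl[OF vC]]]]
        sm(5)[of v x] vC
      by (simp only: w k(2)[OF cl[OF vC]] C_def)
    then have "act V y ?\<zeta> = pure \<xi> (\<lambda>x. g (mact M x w))"
      by (intro ext) (simp only: act_pure[OF \<xi> f[OF vC]] pure_apply bit_sum)
    then show ?thesis using span[OF wC] by simp
  qed
  then have "ufin ?\<zeta>"
    unfolding ufin_def fin_spanned_def using B(1) by (intro exI[of _ "(\<lambda>b. pure \<xi> (\<lambda>x. g (mact M x b))) ` B"]) auto
  moreover have "act V (kp a) ?\<zeta> = fs (weight_char CARD('m) CARD('n) \<mu> a) ?\<zeta>" if a: "a \<in> idxI CARD('m) CARD('n)" for a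
  proof (rule ext)
    fix x
    have "Kp a \<in> valid CARD('m) CARD('n)" using a by (simp only: valid_iff)
    from uq_gr_gen[OF this] have 0: "(kp a :: ('m, 'n) uq) \<in> uq_gr 0" by (simp add: rpar_def)
    have "mact M (kp a) v = mscale M (weight_char CARD('m) CARD('n) \<mu> a) v"
      using v a unfolding weight_vector_def weight_char_def by simp
    then have "g (mact M (x * kp a) v) = weight_char CARD('m) CARD('n) \<mu> a * g (mact M x v)"
      using sm(5)[of v x "kp a"] ma(2)[OF vC vC] ga(2)[OF cl[OF vC] vC] vC unfolding C_def by simp
    then show "act V (kp a) ?\<zeta> x = fs (weight_char CARD('m) CARD('n) \<mu> a) ?\<zeta> x"
      unfolding act_gr[OF tensor_space_HL[OF T] 0] fs_apply
      by (simp only: gtw_0_left[OF grading_G HL_D(3)[OF tensor_space_HL[OF T]]] ksign_0) (simp add: pure_apply)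
  qed
  ultimately show ?thesis unfolding WF_def EW_def using tensor_space_Tot[OF T] by blast
qed

text \<open>Objects of the category are spanned by weight vectors, so their matrix elements are
  combinations of those treated in \<open>pure_weight_WF\<close>.\<close>

lemma tensor_space_WF: "tensor_space V \<subseteq> fv.span WF"
proof
  fix \<zeta> assume "\<zeta> \<in> tensor_space V"
  then show "\<zeta> \<in> fv.span WF"
  proof (induction \<zeta> rule: tensor_induct)
    case (add a b)
    show ?case by (rule fv.span_add[OF add(3,4)])
  next
    case (pure p \<xi> f)
    note \<xi> = pure(1)
    from pure(2) show ?case
    proof (induction f rule: coord_alg_induct)
      case (mat M g v)
      note sm = super_module_linD[OF cat_obj_super_module[OF mat(1)]]
      interpret M: gmod M by (rule gmod_super_module[OF cat_obj_super_module[OF mat(1)]])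
      let ?A = "{u. (\<exists>\<mu>. weight_vector M \<mu> u) \<and> fin_spanned (mscale M) (range (\<lambda>x. mact M x u))}"
      have "v \<in> M.vs.span ?A" using mat(1,3) unfolding cat_obj_def by blast
      then have "pure \<xi> (\<lambda>x. g (mact M x v)) \<in> fv.span WF \<and> v \<in> mcarrier M"
      proof (induction v rule: M.vs.span_induct_alt)
        case base
        have C0: "0 \<in> mcarrier M" unfolding M.carrier by (rule gtot_0[OF M.grading_G])
        have "g (mact M x 0) = 0" for x
          using lin_onD(2)[OF sm(1) C0, of x 0] lin_onD(2)[OF mat(4) sm(4)[OF C0], of 0 x] by simp
        then have "pure \<xi> (\<lambda>x. g (mact M x 0)) = 0" by (intro ext) (simp add: pure_apply)
        then show ?case by (simp only: fv.span_zero C0 simp_thms)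
      next
        case (step c u w)
        obtain \<mu> where \<mu>: "weight_vector M \<mu> u" using step(1) by blast
        have u: "u \<in> mcarrier M" "mscale M c u \<in> mcarrier M"
          using \<mu> M.scl_gtot unfolding weight_vector_def M.carrier by blast+
        have w: "w \<in> mcarrier M" using step by blast
        have "pure \<xi> (\<lambda>x. g (mact M x (mscale M c u + w))) =
            fs c (pure \<xi> (\<lambda>x. g (mact M x u))) + pure \<xi> (\<lambda>x. g (mact M x w))"
        proof (rule ext)
          fix x
          have "g (mact M x (mscale M c u + w)) = c * g (mact M x u) + g (mact M x w)"
            using lin_onD(1)[OF sm(1) u(2) w, of x] lin_onD(2)[OF sm(1) u(1), of x c]
              lin_onD(1)[OF mat(4) sm(4)[OF u(2)] sm(4)[OF w], of x x]
              lin_onD(2)[OF mat(4) sm(4)[OF u(1)], of c x] by simp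
          then show "pure \<xi> (\<lambda>x. g (mact M x (mscale M c u + w))) x =
            (fs c (pure \<xi> (\<lambda>x. g (mact M x u))) + pure \<xi> (\<lambda>x. g (mact M x w))) x"
            by (simp only: pure_apply plus_fun_apply fs_apply vs.scale_left_distrib vs.scale_scale)
        qed
        also have "\<dots> \<in> fv.span WF"
          by (rule fv.span_add[OF fv.span_scale[OF fv.span_base[OF pure_weight_WF[OF mat(1,2) \<mu> mat(4) \<xi>]]]])
            (use step in blast)
        finally show ?case using gtot_add[OF M.grading_G] u w unfolding M.carrier by blast
      qed
      then show ?case ..
    next
      case zero
      have "pure \<xi> (\<lambda>x. 0) = 0" by (rule ext) (simp add: pure_apply)
      then show ?case by (simp only: fv.span_zero)
    next
      case (add f f')
      have "pure \<xi> (\<lambda>x. f x + f' x) = pure \<xi> f + pure \<xi> f'"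
        by (rule ext) (simp add: pure_apply vs.scale_left_distrib)
      then show ?case using fv.span_add[OF add] by (simp only:)
    next
      case (scale c f)
      have "pure \<xi> (\<lambda>x. c * f x) = fs c (pure \<xi> f)"
        by (rule ext) (simp add: pure_apply)
      then show ?case using fv.span_scale[OF scale] by (simp only:)
    qed
  qed
qed

end

section \<open>Finite submodules consist of tensors\<close>

lemma sum_fun_apply: "(\<Sum>i\<in>I. f i) x = (\<Sum>i\<in>I. f i x :: 'b::comm_monoid_add)"
  by (induction I rule: infinite_finite_induct) simp_all

context gmod
begin

lemma hcomp_H_scale:
  assumes "\<zeta> \<in> Tot" shows "hcomp H t (fs c \<zeta>) = fs c (hcomp H t \<zeta>)"
proof (rule hcomp_eq[OF grading_H])
  note sH = fv.subspace_scale[OF subspace_hom_gr[OF pcompat_empty] hcomp_in[OF grading_H assms]]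
  show "fs c (hcomp H t \<zeta>) \<in> H t" by (rule sH)
  have "fs c \<zeta> = fs c (hcomp H t \<zeta>) + fs c (hcomp H (t + 1) \<zeta>)"
    by (subst hcomp_split[OF grading_H assms, of t]) (rule fv.scale_right_distrib)
  then have "fs c \<zeta> - fs c (hcomp H t \<zeta>) = fs c (hcomp H (t + 1) \<zeta>)"
    by (simp only: add_diff_cancel_left')
  then show "fs c \<zeta> - fs c (hcomp H t \<zeta>) \<in> H (t + 1)" using sH by (simp only:)
qed

lemma hcomp_H_span:
  assumes B: "B \<subseteq> Tot" and u: "u \<in> fv.span B" shows "hcomp H t u \<in> fv.span (hcomp H t ` B)"
proof -
  have "hcomp H t u \<in> fv.span (hcomp H t ` B) \<and> u \<in> Tot" using u
  proof (induction u rule: fv.span_induct_alt)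
    case base
    have "hcomp H t 0 = 0" by (rule hcomp_eq[OF grading_H]) (simp_all only: diff_0 minus_zero gr_0[OF grading_H])
    then show ?case using gtot_0[OF grading_H] by (simp only: fv.span_zero simp_thms)
  next
    case (step c b u)
    then have b: "b \<in> Tot" "fs c b \<in> Tot" and u: "u \<in> Tot" "hcomp H t u \<in> fv.span (hcomp H t ` B)"
      using B fv.subspace_scale[OF subspace_Tot] by blast+
    have "hcomp H t (fs c b + u) = fs c (hcomp H t b) + hcomp H t u"
      by (simp only: hcomp_add[OF grading_H b(2) u(1)] hcomp_H_scale[OF b(1)])
    also have "\<dots> \<in> fv.span (hcomp H t ` B)"
      by (rule fv.span_add[OF fv.span_scale[OF fv.span_base[OF imageI[OF step(1)]]] u(2)])
    finally show ?case using gtot_add[OF grading_H b(2) u(1)] by blast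
  qed
  then show ?thesis ..
qed

lemma range_act_subspace: "\<zeta> \<in> HL \<Longrightarrow> fv.subspace (range (\<lambda>x. act V x \<zeta>))"
proof (rule fv.subspaceI)
  assume z: "\<zeta> \<in> HL"
  have "act V 0 \<zeta> = 0" using act_scale_left[OF z, of 0 0] by simp
  then show "0 \<in> range (\<lambda>x. act V x \<zeta>)" by (intro range_eqI[of _ _ 0]) (rule sym)
  show "u + w \<in> range (\<lambda>x. act V x \<zeta>)" if uw: "u \<in> range (\<lambda>x. act V x \<zeta>)" "w \<in> range (\<lambda>x. act V x \<zeta>)" for u w
  proof -
    obtain x y where "u = act V x \<zeta>" "w = act V y \<zeta>" using uw by blast
    then have "u + w = act V (x + y) \<zeta>" by (simp only: act_add_left[OF z])
    then show ?thesis by (rule range_eqI)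
  qed
  show "fs c u \<in> range (\<lambda>x. act V x \<zeta>)" if u: "u \<in> range (\<lambda>x. act V x \<zeta>)" for c u
  proof -
    obtain x where "u = act V x \<zeta>" using u by blast
    then have "fs c u = act V (uq_scale c x) \<zeta>" by (simp only: act_scale_left[OF z])
    then show ?thesis by (rule range_eqI)
  qed
qed

text \<open>A homogeneous \<open>x\<close> maps the component of \<open>v\<close> to a component of
  \<open>act V x v\<close>. Hence the orbit of the component is spanned by the components of a
  finite basis of the orbit of \<open>v\<close>.\<close>

lemma ufin_hcomp:
  assumes v: "v \<in> Tot" and fin: "ufin v" shows "ufin (hcomp H r v)"
proof -
  note HL = Tot_HL[OF v]
  obtain B where B: "finite B" "B \<subseteq> range (\<lambda>x. act V x v)" "fv.span B = range (\<lambda>x. act V x v)"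
    using fin_spanned_basis[OF vector_space_fscale[OF vs] range_act_subspace[OF HL]] fin
    unfolding ufin_def by blast
  have BT: "B \<subseteq> Tot" using B(2) act_gtot_hom_gr[OF pcompat_empty v] by blast
  define D where "D = hcomp H 0 ` B \<union> hcomp H 1 ` B"
  have hD: "hcomp H t u \<in> fv.span D" if "u \<in> fv.span B" for t u
  proof -
    have "hcomp H t ` B \<subseteq> D" unfolding D_def by (cases t rule: bit_exh) auto
    from fv.span_mono[OF this] hcomp_H_span[OF BT that] show ?thesis by blast
  qed
  have hr: "hcomp H r v \<in> H r" "hcomp H (r + 1) v \<in> H (r + 1)" by (rule hcomp_in[OF grading_H v])+
  have "act V x (hcomp H r v) \<in> fv.span D" for x
  proof (induction x rule: uq_gr_induct)
    case (gr s x)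
    have "act V x v = act V x (hcomp H r v) + act V x (hcomp H (r + 1) v)"
      by (subst hcomp_split[OF grading_H v, of r]) (rule act_add[OF hom_gr_HL[OF hr(1)] hom_gr_HL[OF hr(2)]])
    then have "act V x v - act V x (hcomp H r v) = act V x (hcomp H (r + 1) v)"
      by (simp only: add_diff_cancel_left')
    also have "\<dots> \<in> H (s + r + 1)" using act_hom_gr[OF pcompat_empty hr(2) gr] by (simp only: ac_simps)
    finally have "hcomp H (s + r) (act V x v) = act V x (hcomp H r v)"
      by (rule hcomp_eq[OF grading_H act_hom_gr[OF pcompat_empty hr(1) gr]])
    moreover have "act V x v \<in> fv.span B" unfolding B(3) by (rule rangeI)
    ultimately show ?case using hD[of "act V x v" "s + r"] by (simp only:)
  next
    case (add x y)
    then show ?case unfolding act_add_left[OF hom_gr_HL[OF hr(1)]] by (rule fv.span_add)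
  qed
  then have "range (\<lambda>x. act V x (hcomp H r v)) \<subseteq> fv.span D" by blast
  moreover have "finite D" unfolding D_def using B(1) by blast
  ultimately show ?thesis unfolding ufin_def fin_spanned_def by blast
qed

text \<open>A linear map is recovered from its translates by evaluation at \<open>1\<close>; the sign twist of \<open>x\<close> undoes
  the sign in the action.\<close>

lemma hom_eval:
  assumes z: "\<zeta> \<in> H r"
  shows "\<zeta> x = act V (\<Sum>s\<in>{0, 1}. ksign (s * r) (hcomp uq_gr s x)) \<zeta> 1"
proof -
  note HL = hom_gr_HL[OF z]
  have "act V (ksign (s * r) y) \<zeta> 1 = \<zeta> y" if y: "y \<in> uq_gr s" for s y
  proof -
    \<comment> \<open>The summands come from the sign in the action, from the twist of a value of
      degree \<open>s + r\<close>, and from the twist of the argument.\<close>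
    have e: "s + (s * (s + r) + s * r) = 0"
      by (cases s rule: bit_exh; cases r rule: bit_exh) simp_all
    have "act V (ksign (s * r) y) \<zeta> 1 = ksign s (gtw G s (\<zeta> (ksign (s * r) y)))"
      using act_gr[OF HL gr_ksign[OF grading_uq y], of "s * r" 1] by simp
    also have "\<dots> = ksign (s + (s * (s + r) + s * r)) (\<zeta> y)"
      using gtw_gr[OF grading_G gr_ksign[OF grading_G hom_gr_val[OF z y]], of s "s * r"]
      by (simp only: HL_D(6)[OF HL] ksign_ksign)
    finally show ?thesis by (simp only: e ksign_0)
  qed
  then have "act V (\<Sum>s\<in>{0, 1}. ksign (s * r) (hcomp uq_gr s x)) \<zeta> 1 =
      \<zeta> (hcomp uq_gr 0 x) + \<zeta> (hcomp uq_gr 1 x)"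
    by (simp only: bit_sum act_add_left[OF HL] plus_fun_apply uq_hcomp_in)
  also have "\<dots> = \<zeta> x" using HL_split[OF HL, of x 0] by simp
  finally show ?thesis by (rule sym)
qed

text \<open>The orbit of \<open>v\<close> is a graded submodule inside \<open>N\<close>, so by
  \<open>cat_obj_Mod\<close> it is an object of the category and its coordinate functions are matrix
  elements.\<close>

lemma ufin_cyclic_tensor:
  assumes N: "gsubm N" and W: "N \<subseteq> fv.span WF" and v: "v \<in> N" "v \<in> H r" and fin: "ufin v"
  shows "v \<in> tensor_space V"
proof -
  note HL = hom_gr_HL[OF v(2)]
  define F where "F = range (\<lambda>x. act V x v)"
  have subF: "fv.subspace F" unfolding F_def by (rule range_act_subspace[OF HL])
  have FN: "F \<subseteq> N" unfolding F_def using gsubmD(2)[OF N v(1)] by blast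
  \<comment> \<open>The orbit is graded because \<open>v\<close> is homogeneous.\<close>
  have "act V x v \<in> gtot (\<lambda>s. F \<inter> H s)" for x
  proof (induction x rule: uq_gr_induct)
    case (gr s x)
    have "act V x v \<in> F \<inter> H (s + r)"
      using act_hom_gr[OF pcompat_empty v(2) gr] unfolding F_def by blast
    moreover have "0 \<in> F \<inter> H t" for t using fv.subspace_0[OF subF] gr_0[OF grading_H] by blast
    ultimately show ?case unfolding gtot_def
      by (cases "s + r" rule: bit_exh) (metis (mono_tags, lifting) add_0 add_0_right mem_Collect_eq)+
  next
    case (add x y)
    show ?case unfolding act_add_left[OF HL]
      by (rule fv.subspace_add[OF gtot_subspace[OF fv.subspace_inter[OF subF subspace_hom_gr[OF pcompat_empty]]] add])
  qed
  then have "F \<subseteq> gtot (\<lambda>s. F \<inter> H s)" unfolding F_def by blast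
  moreover have "act V y u \<in> F" if u: "u \<in> F" for y u
  proof -
    obtain x where "u = act V x v" using u unfolding F_def by blast
    then have "act V y u = act V (y * x) v" by (simp only: act_mult[OF HL])
    then show ?thesis unfolding F_def by (rule range_eqI)
  qed
  ultimately have gF: "gsubm F" unfolding gsubm_def using subF by blast
  then have cat: "cat_obj UNIV UNIV (Mod V F)" unfolding cat_obj_Mod using FN W by blast
  have finF: "fin_spanned fs F" using fin unfolding ufin_def F_def .
  obtain B where B: "finite B" "B \<subseteq> F" "fv.independent B" "fv.span B = F"
    using fin_spanned_basis[OF vector_space_fscale[OF vs] subF finF] by blast
  have vF: "v \<in> F" unfolding F_def using act_one[OF HL] by (intro range_eqI[of _ _ 1]) (rule sym)
  define c where "c b x = fv.representation B (act V x v) b" for b x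
  have c: "c b \<in> coord_alg" for b
  proof -
    have "lin_on F fs (*) (\<lambda>u. fv.representation B u b)"
      unfolding lin_on_def
      by (intro conjI ballI allI)
        (simp_all only: fv.representation_add[OF B(3)] fv.representation_scale[OF B(3)] B(4))
    then have "(\<lambda>x. fv.representation B (restrict (act V x) F v) b) \<in> coord_alg"
      using coord_alg_matrix[OF cat, of v "\<lambda>u. fv.representation B u b"] finF vF by simp
    then show ?thesis using vF unfolding c_def[abs_def] by simp
  qed
  \<comment> \<open>The sign twist of the argument in \<open>hom_eval\<close>, moved into the
    coordinate function.\<close>
  define c' where "c' b x = (\<Sum>s\<in>{0, 1}. ksign (s * r) (c b (hcomp uq_gr s x)))" for b x
  have c': "c' b \<in> coord_alg" for b
    unfolding c'_def[abs_def] bit_sum by (intro coord_alg_add coord_alg_ksign coord_alg_hcomp c)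
  have cks: "c b (ksign s x) = ksign s (c b x)" for b s x
    by (rule lin_on_ksign[OF coord_alg_lin[OF c] vector_space_uq vector_space_Cq]) simp
  have "v = (\<Sum>b\<in>B. pure (b 1) (c' b))"
  proof (rule ext)
    fix x :: "('m, 'n) uq"
    let ?y = "\<Sum>s\<in>{0, 1}. ksign (s * r) (hcomp uq_gr s x)"
    have y: "c b ?y = c' b x" for b
      unfolding c'_def bit_sum by (simp only: coord_alg_linD(1)[OF c] cks)
    have "act V ?y v \<in> fv.span B" unfolding B(4) F_def by (rule rangeI)
    from fv.sum_representation_eq[OF B(3) this B(1) subset_refl]
    have "act V ?y v = (\<Sum>b\<in>B. fs (c' b x) b)" by (simp only: y[symmetric] c_def)
    then have "act V ?y v 1 = (\<Sum>b\<in>B. fs (c' b x) b) 1" by (rule fun_cong)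
    also have "\<dots> = (\<Sum>b\<in>B. fs (c' b x) b 1)" by (simp only: sum_fun_apply)
    also have "\<dots> = (\<Sum>b\<in>B. pure (b 1) (c' b) x)" by (simp only: fs_apply pure_apply)
    also have "\<dots> = (\<Sum>b\<in>B. pure (b 1) (c' b)) x" by (simp only: sum_fun_apply)
    finally show "v x = (\<Sum>b\<in>B. pure (b 1) (c' b)) x" using hom_eval[OF v(2), of x] by (simp only:)
  qed
  also have "\<dots> \<in> tensor_space V"
  proof (rule fv.subspace_sum[OF subspace_tensor_space])
    fix b assume "b \<in> B"
    then have "b \<in> HL" using B(2) FN gsubmD(4)[OF N] by blast
    then show "pure (b 1) (c' b) \<in> tensor_space V" by (rule pure_tensor_space[OF HL_D(3) c'])
  qed
  finally show ?thesis .
qed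

text \<open>\<open>N\<close> is spanned by its weight vectors with finite orbit; their homogeneous
  components stay in \<open>N\<close> and keep a finite orbit, as the cyclic case requires.\<close>

lemma gsubm_tensor_space:
  assumes N: "gsubm N" and W: "N \<subseteq> fv.span WF" shows "N \<subseteq> tensor_space V"
proof -
  have "N \<inter> WF \<subseteq> tensor_space V"
  proof
    fix v assume v: "v \<in> N \<inter> WF"
    then have T: "v \<in> Tot" and fin: "ufin v" unfolding WF_def EW_def by blast+
    have "hcomp H r v \<in> tensor_space V" for r
      using v by (intro ufin_cyclic_tensor[OF N W gsubmD(5)[OF N] hcomp_in[OF grading_H T] ufin_hcomp[OF T fin]]) blast
    then have "hcomp H 0 v + hcomp H (0 + 1) v \<in> tensor_space V" by (intro fv.subspace_add[OF subspace_tensor_space])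
    then show "v \<in> tensor_space V" using hcomp_split[OF grading_H T, of 0] by (simp only:)
  qed
  then have "fv.span (N \<inter> WF) \<subseteq> tensor_space V" by (rule fv.span_minimal[OF _ subspace_tensor_space])
  then show ?thesis using gsubm_span_WF[OF N W] by blast
qed

section \<open>The induced module\<close>

text \<open>The common carrier of the two modules to be compared.\<close>

definition ten_hom :: "('m, 'n) uq set \<Rightarrow> (('m, 'n) uq \<Rightarrow> 'v) set" where
  "ten_hom P = tensor_space V \<inter> gtot (hom_gr P V)"

lemma gsubm_ten_hom:
  assumes pc: "pcompat P V" shows "gsubm (ten_hom P)"
proof -
  note grP = grading_hom_gr[OF pc]
  have "\<zeta> \<in> gtot (\<lambda>s. ten_hom P \<inter> H s)" if z: "\<zeta> \<in> ten_hom P" for \<zeta>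
  proof -
    have T: "\<zeta> \<in> tensor_space V" "\<zeta> \<in> gtot (hom_gr P V)" using z unfolding ten_hom_def by blast+
    obtain u w where u: "\<zeta> = u + w" "u \<in> hom_gr P V 0" "w \<in> hom_gr P V 1" using T(2) unfolding gtot_def by blast
    \<comment> \<open>The parts as a P-homomorphism are the components in \<open>H\<close>, and
      those are tensors by \<open>tensor_hcomp\<close>.\<close>
    have "hcomp H 0 \<zeta> = u" by (rule hcomp_eq[OF grading_H]) (use u hom_gr_mono in auto)
    moreover have "hcomp H 1 \<zeta> = w" by (rule hcomp_eq[OF grading_H]) (use u hom_gr_mono in auto)
    moreover have "hcomp H r \<zeta> \<in> tensor_space V" for r
      using tensor_hcomp[OF T(1)] tensor_gr_space by blast
    ultimately have "u \<in> tensor_space V" "w \<in> tensor_space V" by metis+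
    then have "u \<in> ten_hom P \<inter> H 0" "w \<in> ten_hom P \<inter> H 1"
      using gtot_gr[OF grP u(2)] gtot_gr[OF grP u(3)] hom_gr_mono[OF u(2)] hom_gr_mono[OF u(3)] unfolding ten_hom_def by blast+
    then show ?thesis using u(1) unfolding gtot_def by blast
  qed
  moreover have "act V y \<zeta> \<in> ten_hom P" if "\<zeta> \<in> ten_hom P" for y \<zeta>
    using that act_tensor_space act_gtot_hom_gr[OF pc] unfolding ten_hom_def by blast
  moreover have "fv.subspace (ten_hom P)" unfolding ten_hom_def
    by (rule fv.subspace_inter[OF subspace_tensor_space gtot_subspace[OF subspace_hom_gr[OF pc]]])
  ultimately show ?thesis unfolding gsubm_def by blast
qed

text \<open>\<open>ten_hom P\<close> is itself one of the submodules in the union and contains all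
  the others, so the union is already a subspace.\<close>

lemma ind_obj_eq:
  assumes pc: "pcompat P V" shows "ind_obj P V = Mod V (ten_hom P)"
proof -
  have mc: "mcarrier (hom_mod P V) = gtot (hom_gr P V)" "mscale (hom_mod P V) = fs"
    unfolding hom_mod_def gtot_def by simp_all
  let ?U = "\<Union> {N. N \<subseteq> mcarrier (hom_mod P V) \<and> cat_obj UNIV UNIV (restrict_mod (hom_mod P V) N)}"
  have sub: "ten_hom P \<subseteq> gtot (hom_gr P V)" unfolding ten_hom_def by blast
  have "cat_obj UNIV UNIV (Mod V (ten_hom P))"
    unfolding cat_obj_Mod using gsubm_ten_hom[OF pc] tensor_space_WF unfolding ten_hom_def by blast
  then have 1: "ten_hom P \<subseteq> ?U"
    using sub restrict_hom_mod[OF pc sub] unfolding mc by (intro Union_upper) simp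
  have 2: "?U \<subseteq> ten_hom P"
  proof (rule Union_least)
    fix N assume "N \<in> {N. N \<subseteq> mcarrier (hom_mod P V) \<and> cat_obj UNIV UNIV (restrict_mod (hom_mod P V) N)}"
    then have N: "N \<subseteq> gtot (hom_gr P V)" "cat_obj UNIV UNIV (restrict_mod (hom_mod P V) N)" unfolding mc by blast+
    then have "gsubm N" "N \<subseteq> fv.span WF" unfolding restrict_hom_mod[OF pc N(1)] cat_obj_Mod by blast+
    then show "N \<subseteq> ten_hom P" using gsubm_tensor_space N(1) unfolding ten_hom_def by blast
  qed
  have "fv.span (ten_hom P) = ten_hom P"
    using gsubmD(1)[OF gsubm_ten_hom[OF pc]] by (rule fv.span_eq_iff[THEN iffD2])
  then have "module.span (mscale (hom_mod P V)) ?U = ten_hom P"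
    using subset_antisym[OF 2 1] unfolding mc by (simp only:)
  then show ?thesis unfolding ind_obj_def using restrict_hom_mod[OF pc sub] by (simp only:)
qed

end

section \<open>The functor \<open>\<Gamma>\<close>\<close>

text \<open>An additive map that agrees with \<open>\<phi> \<otimes> T\<close> on pure tensors certifies that the value of
  \<^const>\<open>tensor_map\<close> does not depend on the chosen expansion.\<close>

lemma (in gmod) tensor_map_eval:
  fixes W :: "('m, 'n, 'w::ab_group_add) smod"
  assumes z: "\<zeta> \<in> tensor_space V"
    and pure: "\<And>s \<xi> f. \<xi> \<in> G s \<Longrightarrow> f \<in> coord_alg \<Longrightarrow>
      ksign (d * s) (pure_tensor (mscale W) (\<phi> \<xi>) (T f)) = \<Psi> (pure \<xi> f)"
    and add: "\<And>a b. a \<in> tensor_space V \<Longrightarrow> b \<in> tensor_space V \<Longrightarrow> \<Psi> (a + b) = \<Psi> a + \<Psi> b"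
    and zero: "\<Psi> 0 = 0"
  shows "tensor_map V W \<phi> d T \<zeta> = \<Psi> \<zeta>"
proof -
  define good where "good ts \<longleftrightarrow> (\<forall>(s, \<xi>, f)\<in>set ts. \<xi> \<in> G s \<and> f \<in> coord_alg)" for ts :: "(bit \<times> 'v \<times> (('m, 'n) uq \<Rightarrow> Cq)) list"
  define src where "src ts = (\<Sum>(s, \<xi>, f)\<leftarrow>ts. pure \<xi> f)" for ts :: "(bit \<times> 'v \<times> (('m, 'n) uq \<Rightarrow> Cq)) list"
  define tgt where "tgt ts = (\<Sum>(s, \<xi>, f)\<leftarrow>ts. ksign (d * s) (pure_tensor (mscale W) (\<phi> \<xi>) (T f)))"
    for ts :: "(bit \<times> 'v \<times> (('m, 'n) uq \<Rightarrow> Cq)) list"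
  have ev: "tgt ts = \<Psi> (src ts) \<and> src ts \<in> tensor_space V" if "good ts" for ts
    using that
  proof (induction ts)
    case Nil
    show ?case using zero fv.subspace_0[OF subspace_tensor_space] unfolding src_def tgt_def
      by (simp only: list.map sum_list.Nil simp_thms)
  next
    case (Cons p ts)
    obtain s \<xi> f where p: "p = (s, \<xi>, f)" by (cases p)
    have g: "\<xi> \<in> G s" "f \<in> coord_alg" "good ts" using Cons.prems unfolding good_def p by simp_all
    have e: "src (p # ts) = pure \<xi> f + src ts"
      "tgt (p # ts) = ksign (d * s) (pure_tensor (mscale W) (\<phi> \<xi>) (T f)) + tgt ts"
      unfolding src_def tgt_def p by (simp_all only: list.map sum_list.Cons prod.case)
    have t: "pure \<xi> f \<in> tensor_space V" by (rule pure_tensor_space[OF gtot_gr[OF grading_G g(1)] g(2)])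
    show ?case unfolding e pure[OF g(1,2)]
      using Cons.IH[OF g(3)] add[OF t, of "src ts"] fv.subspace_add[OF subspace_tensor_space t, of "src ts"]
      by (simp only: simp_thms)
  qed
  have ex: "\<exists>ts. good ts \<and> \<zeta> = src ts" using z
  proof (induction \<zeta> rule: tensor_induct)
    case (pure s \<xi> f)
    then show ?case by (intro exI[of _ "[(s, \<xi>, f)]"]) (simp add: good_def src_def)
  next
    case (add a b)
    then obtain ts us where "good ts" "a = src ts" "good us" "b = src us" by blast
    then show ?case by (intro exI[of _ "ts @ us"]) (auto simp: good_def src_def)
  qed
  have "tensor_map V W \<phi> d T \<zeta> = (THE \<eta>. \<exists>ts. good ts \<and> \<zeta> = src ts \<and> \<eta> = tgt ts)"
    unfolding tensor_map_def good_def src_def tgt_def ..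
  also have "\<dots> = \<Psi> \<zeta>"
  proof (rule the_equality)
    obtain ts where ts: "good ts" "\<zeta> = src ts" using ex by blast
    have "\<Psi> \<zeta> = tgt ts" using ev[OF ts(1)] ts(2) by simp
    with ts show "\<exists>ts. good ts \<and> \<zeta> = src ts \<and> \<Psi> \<zeta> = tgt ts" by blast
  next
    fix \<eta> assume "\<exists>ts. good ts \<and> \<zeta> = src ts \<and> \<eta> = tgt ts"
    then obtain ts where ts: "good ts" "\<zeta> = src ts" "\<eta> = tgt ts" by blast
    show "\<eta> = \<Psi> \<zeta>" using ev[OF ts(1)] ts(2,3) by simp
  qed
  finally show ?thesis .
qed

lemma ksign_apply: "ksign s f y = ksign s (f y)"
  by (simp add: ksign_def)

context gmod
begin

text \<open>\<open>dR\<close> contributes the sign for \<open>s\<close>, and moving it past the left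
  factor contributes the sign for \<open>s\<close> times the degree of that factor. The latter is
  the twist of the value, as in \<open>act\<close>.\<close>

lemma id_dR_eq:
  assumes z: "\<zeta> \<in> tensor_space V" shows "id_dR V x \<zeta> = act V x \<zeta>"
proof -
  have e: "tensor_map V V id s (dR (hcomp uq_gr s x)) \<zeta> = (\<lambda>y. ksign s (gtw G s (\<zeta> (y * hcomp uq_gr s x))))" for s
  proof (rule tensor_map_eval[OF z, where \<Psi> = "\<lambda>\<zeta> y. ksign s (gtw G s (\<zeta> (y * hcomp uq_gr s x)))"])
    fix p \<xi> and f :: "('m, 'n) uq \<Rightarrow> Cq" assume \<xi>: "\<xi> \<in> G p" and f: "f \<in> coord_alg"
    show "ksign (s * p) (pure (id \<xi>) (dR (hcomp uq_gr s x) f)) = (\<lambda>y. ksign s (gtw G s (pure \<xi> f (y * hcomp uq_gr s x))))"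
    proof (rule ext)
      fix y
      have "dR (hcomp uq_gr s x) f y = ksign s (f (y * hcomp uq_gr s x))"
        unfolding dR_def bit_sum uq_hcomp_gr[OF uq_hcomp_in]
        by (cases s rule: bit_exh) (simp_all add: coord_alg_linD[OF f])
      then have "ksign (s * p) (pure (id \<xi>) (dR (hcomp uq_gr s x) f)) y = ksign (s * p) (scl (ksign s (f (y * hcomp uq_gr s x))) \<xi>)"
        by (simp only: ksign_apply pure_apply id_apply)
      also have "\<dots> = ksign s (ksign (s * p) (scl (f (y * hcomp uq_gr s x)) \<xi>))"
        by (simp add: ksign_def)
      finally show "ksign (s * p) (pure (id \<xi>) (dR (hcomp uq_gr s x) f)) y = ksign s (gtw G s (pure \<xi> f (y * hcomp uq_gr s x)))"
        using gtw_gr[OF grading_G scl_gr[OF \<xi>], of s] by (simp only: pure_apply)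
    qed
  next
    fix a b assume "a \<in> tensor_space V" "b \<in> tensor_space V"
    then have "a \<in> HL" "b \<in> HL" by (simp_all only: tensor_space_HL)
    then show "(\<lambda>y. ksign s (gtw G s ((a + b) (y * hcomp uq_gr s x)))) =
      (\<lambda>y. ksign s (gtw G s (a (y * hcomp uq_gr s x)))) + (\<lambda>y. ksign s (gtw G s (b (y * hcomp uq_gr s x))))"
      by (intro ext) (simp only: plus_fun_apply gtw_add[OF grading_G] HL_D(3) ksign_add)
  qed (simp add: gtw_0_right[OF grading_G] zero_fun_def)
  show ?thesis unfolding id_dR_def act_def e bit_sum by (simp add: plus_fun_def)
qed

text \<open>The two signs involve the parities of the left factor and of the functional. The first
  is read off the value, the second off the argument \<open>?z s y\<close>; on a homogeneous part of
  \<open>\<zeta>\<close> they combine to the total degree \<open>r\<close>.\<close>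

lemma id_dL_eq:
  assumes z: "\<zeta> \<in> tensor_space V"
  shows "id_dL V x \<zeta> y = (\<Sum>s\<in>{0, 1}. \<Sum>r\<in>{0, 1}. ksign (s * r) (hcomp H r \<zeta> (S_uq (hcomp uq_gr s x) * y)))"
proof -
  let ?z = "\<lambda>s y. S_uq (hcomp uq_gr s x) * y"
  define \<Psi> where "\<Psi> s \<zeta> = (\<lambda>y. \<Sum>t\<in>{0, 1}. ksign (s * t) (gtw G s (\<zeta> (hcomp uq_gr t (?z s y)))))"
    for s and \<zeta> :: "('m, 'n) uq \<Rightarrow> 'v"
  have e: "tensor_map V V id s (dL (hcomp uq_gr s x)) \<zeta> = \<Psi> s \<zeta>" for s
  proof (rule tensor_map_eval[OF z])
    fix p \<xi> and f :: "('m, 'n) uq \<Rightarrow> Cq" assume \<xi>: "\<xi> \<in> G p" and f: "f \<in> coord_alg"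
    show "ksign (s * p) (pure (id \<xi>) (dL (hcomp uq_gr s x) f)) = \<Psi> s (pure \<xi> f)"
    proof (rule ext)
      fix y
      have 1: "dL (hcomp uq_gr s x) f y = (\<Sum>t\<in>{0, 1}. ksign (s * t) (f (hcomp uq_gr t (?z s y))))"
        unfolding dL_def antipode_eq bit_sum uq_hcomp_gr[OF uq_hcomp_in] hcomp_dual_gr[OF coord_alg_lin[OF f]]
        by (cases s rule: bit_exh) (simp_all add: S_uq_0 uq_hcomp_0 coord_alg_linD[OF f])
      have 2: "scl (ksign t c) \<xi> = ksign t (scl c \<xi>)" for t c by (simp add: ksign_def)
      have "ksign (s * p) (pure (id \<xi>) (dL (hcomp uq_gr s x) f)) y =
          ksign (s * p) (scl (dL (hcomp uq_gr s x) f y) \<xi>)"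
        by (simp only: ksign_apply pure_apply id_apply)
      also have "\<dots> = (\<Sum>t\<in>{0, 1}. ksign (s * t) (ksign (s * p) (scl (f (hcomp uq_gr t (?z s y))) \<xi>)))"
        unfolding 1 bit_sum vs.scale_left_distrib 2 ksign_add ksign_ksign by (simp only: ac_simps)
      finally show "ksign (s * p) (pure (id \<xi>) (dL (hcomp uq_gr s x) f)) y = \<Psi> s (pure \<xi> f) y"
        unfolding \<Psi>_def pure_apply gtw_gr[OF grading_G scl_gr[OF \<xi>]] .
    qed
  next
    fix a b assume "a \<in> tensor_space V" "b \<in> tensor_space V"
    then have ab: "a \<in> HL" "b \<in> HL" by (simp_all only: tensor_space_HL)
    show "\<Psi> s (a + b) = \<Psi> s a + \<Psi> s b"
    proof (rule ext)
      fix y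
      show "\<Psi> s (a + b) y = (\<Psi> s a + \<Psi> s b) y"
        unfolding \<Psi>_def bit_sum plus_fun_apply gtw_add[OF grading_G HL_D(3)[OF ab(1)] HL_D(3)[OF ab(2)]] ksign_add
        by (simp only: ac_simps)
    qed
  qed (simp add: \<Psi>_def gtw_0_right[OF grading_G] zero_fun_def)
  have h: "hcomp H r \<zeta> \<in> H r" for r by (rule hcomp_in[OF grading_H tensor_space_Tot[OF z]])
  note hL = hom_gr_HL[OF h]
  have s1: "ksign (s * t) (gtw G s (hcomp H r \<zeta> u)) = ksign (s * r) (hcomp H r \<zeta> u)" if u: "u \<in> uq_gr t" for s t r u
  proof -
    \<comment> \<open>\<open>t\<close> is the parity of the functional, seen at the argument, and
      \<open>t + r\<close> the degree of the value.\<close>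
    have "s * t + s * (t + r) = s * r"
      by (cases s rule: bit_exh; cases t rule: bit_exh; cases r rule: bit_exh) simp_all
    then show ?thesis by (simp only: gtw_gr[OF grading_G hom_gr_val[OF h u]] ksign_ksign)
  qed
  have s2: "\<zeta> u = hcomp H 0 \<zeta> u + hcomp H 1 \<zeta> u" for u
    using fun_cong[OF hcomp_split[OF grading_H tensor_space_Tot[OF z], of 0], of u] by simp
  have s3: "\<Psi> s \<zeta> y = (\<Sum>r\<in>{0, 1}. ksign (s * r) (hcomp H r \<zeta> (?z s y)))" for s y
  proof -
    have s4: "hcomp H r \<zeta> u = hcomp H r \<zeta> (hcomp uq_gr 0 u) + hcomp H r \<zeta> (hcomp uq_gr 1 u)" for r u
      using HL_split[OF hL, of r u 0] by simp
    have "\<Psi> s \<zeta> y = (\<Sum>t\<in>{0, 1}. ksign (s * 0) (hcomp H 0 \<zeta> (hcomp uq_gr t (?z s y))) +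
        ksign (s * 1) (hcomp H 1 \<zeta> (hcomp uq_gr t (?z s y))))"
      unfolding \<Psi>_def by (simp only: s2 gtw_add[OF grading_G HL_D(3)[OF hL] HL_D(3)[OF hL]] ksign_add s1[OF uq_hcomp_in])
    then show ?thesis
      unfolding bit_sum s4[of _ "?z s y"] ksign_add by (simp only: ac_simps)
  qed
  show ?thesis unfolding id_dL_def e bit_sum plus_fun_apply s3 ..
qed

lemma tensor_map_apply:
  fixes W :: "('m, 'n, 'w::ab_group_add) smod"
  assumes z: "\<zeta> \<in> tensor_space V" and l: "lin_on (gtot G) scl (mscale W) \<phi>" and W: "vector_space (mscale W)"
  shows "tensor_map V W \<phi> 0 id \<zeta> = (\<lambda>y. \<phi> (\<zeta> y))"
proof (rule tensor_map_eval[OF z, where \<Psi> = "\<lambda>\<zeta> y. \<phi> (\<zeta> y)"])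
  fix s \<xi> and f :: "('m, 'n) uq \<Rightarrow> Cq" assume "\<xi> \<in> G s"
  then have \<xi>: "\<xi> \<in> gtot G" by (rule gtot_gr[OF grading_G])
  show "ksign (0 * s) (pure_tensor (mscale W) (\<phi> \<xi>) (id f)) = (\<lambda>y. \<phi> (pure \<xi> f y))"
    unfolding pure_apply lin_onD(2)[OF l \<xi>] by (simp add: pure_tensor_def)
next
  fix a b assume "a \<in> tensor_space V" "b \<in> tensor_space V"
  then have ab: "a \<in> HL" "b \<in> HL" by (simp_all only: tensor_space_HL)
  show "(\<lambda>y. \<phi> ((a + b) y)) = (\<lambda>y. \<phi> (a y)) + (\<lambda>y. \<phi> (b y))"
    by (rule ext) (simp only: plus_fun_apply lin_onD(1)[OF l HL_D(3)[OF ab(1)] HL_D(3)[OF ab(2)]])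
next
  show "(\<lambda>y. \<phi> ((0 :: ('m, 'n) uq \<Rightarrow> 'v) y)) = 0"
    using lin_on_0[OF l vs W gtot_0[OF grading_G]] by (simp add: zero_fun_def)
qed

end

text \<open>The condition is one equation for the sum of the even and the odd part of
  \<open>\<zeta>\<close>. Evaluated at homogeneous elements, the contributions of the two parts have
  different degrees, so the equation separates into one for each part.\<close>

lemma gamma_condition:
  fixes V :: "('m::finite, 'n::finite, 'v::ab_group_add) smod"
  assumes sm: "super_module P V"
    and A: "A \<subseteq> idxJ CARD('m) CARD('n)" and B: "B \<subseteq> idxJ CARD('m) CARD('n)" and P: "P = uq_sub A B"
    and z: "\<zeta> \<in> tensor_space V"
  shows "(\<forall>x\<in>P. id_dL V x \<zeta> = tensor_map V V (mact V (antipode x)) 0 id \<zeta>) \<longleftrightarrow> \<zeta> \<in> gtot (hom_gr P V)"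
proof -
  interpret gmod V by (rule gmod_super_module[OF sm])
  note pc = pcompat_super_module[OF sm] and grP = grading_hom_gr[OF pcompat_super_module[OF sm]]
  have lin: "lin_on (gtot G) scl scl (mact V x)" if "x \<in> P" for x
    using sm that unfolding super_module_def carrier by blast
  have lin': "lin_on P uq_scale scl (\<lambda>x. mact V x v)" if "v \<in> gtot G" for v
    using sm that unfolding super_module_def carrier by blast
  have SP: "S_uq x \<in> P" if "x \<in> P" for x using S_uq_sub[OF A B] that unfolding P by blast
  have hP: "hcomp uq_gr s x \<in> P" if "x \<in> P" for s x using uq_sub_hcomp[OF A B] that unfolding P by blast
  let ?h = "\<lambda>r. hcomp H r \<zeta>"
  have h: "?h r \<in> H r" for r by (rule hcomp_in[OF grading_H tensor_space_Tot[OF z]])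
  note hL = hom_gr_HL[OF h]
  have zs: "\<zeta> = ?h 0 + ?h 1" using hcomp_split[OF grading_H tensor_space_Tot[OF z], of 0] by simp
  have rhs: "tensor_map V V (mact V (antipode x)) 0 id \<zeta> y = mact V (S_uq x) (?h 0 y) + mact V (S_uq x) (?h 1 y)"
    if "x \<in> P" for x y
  proof -
    note l = lin[OF SP[OF that]]
    have "tensor_map V V (mact V (antipode x)) 0 id \<zeta> y = mact V (S_uq x) (\<zeta> y)"
      unfolding antipode_eq tensor_map_apply[OF z l vs] ..
    also have "\<zeta> y = ?h 0 y + ?h 1 y" using fun_cong[OF zs, of y] by (simp only: plus_fun_apply)
    finally show ?thesis by (simp only: lin_onD(1)[OF l HL_D(3)[OF hL] HL_D(3)[OF hL]])
  qed
  show ?thesis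
  proof
    assume c: "\<forall>x\<in>P. id_dL V x \<zeta> = tensor_map V V (mact V (antipode x)) 0 id \<zeta>"
    have eq: "?h 0 (p * y) = mact V p (?h 0 y) \<and> ?h 1 (p * y) = ksign s (mact V p (?h 1 y))"
      if p: "p \<in> P" "p \<in> uq_gr s" for s p y
    proof (induction y rule: uq_gr_induct)
      case (gr t y)
      \<comment> \<open>The condition at \<open>x\<close> is the homomorphism rule at
        \<open>p\<close>; equal parity makes the sign for \<open>s\<close> the right one.\<close>
      obtain x where x: "x \<in> P" "x \<in> uq_gr s" "S_uq x = p" using S_uq_surj[OF A B] p unfolding P by blast
      have "id_dL V x \<zeta> y = ?h 0 (p * y) + ksign s (?h 1 (p * y))"
        unfolding id_dL_eq[OF z] bit_sum uq_hcomp_gr[OF x(2)]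
        by (cases s rule: bit_exh) (simp_all add: x(3) S_uq_0 HL_D(4)[OF hL])
      then have e: "?h 0 (p * y) + ksign s (?h 1 (p * y)) = mact V p (?h 0 y) + mact V p (?h 1 y)"
        using c x(1) rhs[OF x(1), of y] unfolding x(3) by simp
      have g: "mact V p u \<in> G (s + (t + r))" if "u \<in> G (t + r)" for u r
        using pc p that unfolding pcompat_def by blast
      have m: "mact V p (?h r y) \<in> G (s + t + r)" "?h r (p * y) \<in> G (s + t + r)" for r
        using g[OF hom_gr_val[OF h gr]] hom_gr_val[OF h uq_gr_mult[OF p(2) gr]] by (simp_all only: ac_simps)
      \<comment> \<open>In \<open>e\<close> the even part contributes in degree
        \<open>s + t\<close>, the odd part in degree \<open>s + t + 1\<close>.\<close>
      have 1: "?h 0 (p * y) = mact V p (?h 0 y)" and 2: "ksign s (?h 1 (p * y)) = mact V p (?h 1 y)"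
        by (rule gr_unique[OF grading_G m(2)[of 0, unfolded add_0_right] gr_ksign[OF grading_G m(2)[of 1]]
            m(1)[of 0, unfolded add_0_right] m(1)[of 1] e])+
      have "ksign s (ksign s (?h 1 (p * y))) = ?h 1 (p * y)"
        by (simp only: ksign_ksign bit_double ksign_0)
      then show ?case using 1 arg_cong[OF 2, of "ksign s"] by (simp only: simp_thms)
    next
      case (add x y)
      then show ?case
        by (simp only: distrib_left HL_D(1)[OF hL] lin_onD(1)[OF lin[OF p(1)] HL_D(3)[OF hL] HL_D(3)[OF hL]]
            ksign_add simp_thms)
    qed
    have "?h r \<in> hom_gr P V r" for r
    proof -
      have "?h r (p * y) = ksign (s * r) (mact V p (?h r y))" if "p \<in> P \<inter> uq_gr s" for s p y
        using eq[of p s y] that by (cases r rule: bit_exh) simp_all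
      then show ?thesis using h[of r] unfolding hom_gr_def by blast
    qed
    then show "\<zeta> \<in> gtot (hom_gr P V)" using zs unfolding gtot_def by blast
  next
    assume "\<zeta> \<in> gtot (hom_gr P V)"
    then obtain u w where u: "\<zeta> = u + w" "u \<in> hom_gr P V 0" "w \<in> hom_gr P V 1" unfolding gtot_def by blast
    have "?h 0 = u" by (rule hcomp_eq[OF grading_H]) (use u hom_gr_mono in auto)
    moreover have "?h 1 = w" by (rule hcomp_eq[OF grading_H]) (use u hom_gr_mono in auto)
    ultimately have hr: "?h r \<in> hom_gr P V r" for r using u by (cases r rule: bit_exh) simp_all
    show "\<forall>x\<in>P. id_dL V x \<zeta> = tensor_map V V (mact V (antipode x)) 0 id \<zeta>"
    proof (intro ballI ext)
      fix x y assume x: "x \<in> P"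
      have 1: "ksign (s * r) (?h r (S_uq (hcomp uq_gr s x) * y)) = mact V (S_uq (hcomp uq_gr s x)) (?h r y)" for s r
      proof -
        have "S_uq (hcomp uq_gr s x) \<in> P \<inter> uq_gr s" using SP hP x S_uq_gr uq_hcomp_in by blast
        then have "?h r (S_uq (hcomp uq_gr s x) * y) = ksign (s * r) (mact V (S_uq (hcomp uq_gr s x)) (?h r y))"
          using hr[of r] unfolding hom_gr_def by blast
        then show ?thesis by (simp only: ksign_ksign bit_double ksign_0)
      qed
      have 2: "mact V (S_uq x) v = mact V (S_uq (hcomp uq_gr 0 x)) v + mact V (S_uq (hcomp uq_gr 1 x)) v"
        if v: "v \<in> gtot G" for v
      proof -
        have "x = hcomp uq_gr 0 x + hcomp uq_gr 1 x" using uq_hcomp_split[of x 0] by simp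
        then have "S_uq x = S_uq (hcomp uq_gr 0 x) + S_uq (hcomp uq_gr 1 x)" by (metis S_uq_add)
        then show ?thesis using lin_onD(1)[OF lin'[OF v] SP[OF hP[OF x]] SP[OF hP[OF x]]] by (simp only:)
      qed
      show "id_dL V x \<zeta> y = tensor_map V V (mact V (antipode x)) 0 id \<zeta> y"
        unfolding id_dL_eq[OF z] rhs[OF x] 1 2[OF HL_D(3)[OF hL]] bit_sum by (simp only: ac_simps)
    qed
  qed
qed

lemma gamma_obj_eq:
  fixes V :: "('m::finite, 'n::finite, 'v::ab_group_add) smod"
  assumes sm: "super_module P V"
    and AB: "A \<subseteq> idxJ CARD('m) CARD('n)" "B \<subseteq> idxJ CARD('m) CARD('n)" "P = uq_sub A B"
  shows "gamma_obj P V = Mod V (gmod.ten_hom V P)"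
proof -
  interpret gmod V by (rule gmod_super_module[OF sm])
  have C: "{\<zeta> \<in> tensor_space V. \<forall>x\<in>P. id_dL V x \<zeta> = tensor_map V V (mact V (antipode x)) 0 id \<zeta>} = ten_hom P"
    using gamma_condition[OF sm AB] unfolding ten_hom_def by blast
  have T: "ten_hom P \<subseteq> tensor_space V" unfolding ten_hom_def by blast
  \<comment> \<open>A tensor that is homogeneous as a linear map equals its own component, which
    \<open>tensor_hcomp\<close> places in \<open>tensor_gr\<close>.\<close>
  have "ten_hom P \<inter> tensor_gr V s = ten_hom P \<inter> H s" for s
  proof (intro equalityI subsetI)
    fix \<zeta> assume "\<zeta> \<in> ten_hom P \<inter> tensor_gr V s"
    then show "\<zeta> \<in> ten_hom P \<inter> H s" using tensor_gr_hom by blast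
  next
    fix \<zeta> assume \<zeta>: "\<zeta> \<in> ten_hom P \<inter> H s"
    then have "hcomp H s \<zeta> = \<zeta>" by (intro hcomp_same[OF grading_H]) blast
    moreover have "hcomp H s \<zeta> \<in> tensor_gr V s" by (rule tensor_hcomp) (use \<zeta> T in blast)
    ultimately show "\<zeta> \<in> ten_hom P \<inter> tensor_gr V s" using \<zeta> by simp
  qed
  moreover have "restrict (id_dR V x) (ten_hom P) = restrict (act V x) (ten_hom P)" for x
    using id_dR_eq T by (intro restrict_ext) blast
  ultimately show ?thesis unfolding gamma_obj_def restrict_mod_def Mod_def C by simp
qed

theorem corollary5p1:
  fixes L P :: "('m::finite, 'n::finite) uq set"
  assumes "reductive L"
    and "parabolic_levi P L"
    and "uq_bbar \<subseteq> P"
  shows "(\<forall>\<Xi> :: ('m, 'n, 'v::ab_group_add) smod. cat_obj P L \<Xi> \<longrightarrow> gamma_obj P \<Xi> = ind_obj P \<Xi>) \<and>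
    (\<forall>(\<Xi> :: ('m, 'n, 'v) smod) (\<Xi>' :: ('m, 'n, 'w::ab_group_add) smod) \<phi>.
       cat_obj P L \<Xi> \<and> cat_obj P L \<Xi>' \<and> cat_mor P \<Xi> \<Xi>' \<phi> \<longrightarrow>
       gamma_mor P \<Xi> \<Xi>' \<phi> = ind_mor P \<Xi> \<phi>)"
proof -
  obtain A B where AB: "A \<subseteq> idxJ CARD('m) CARD('n)" "B \<subseteq> idxJ CARD('m) CARD('n)" "P = uq_sub A B"
    using assms(2) unfolding parabolic_levi_def by blast
  have obj: "gamma_obj P \<Xi> = Mod \<Xi> (gmod.ten_hom \<Xi> P)" "ind_obj P \<Xi> = Mod \<Xi> (gmod.ten_hom \<Xi> P)"
    if "cat_obj P L \<Xi>" for \<Xi> :: "('m, 'n, 'v) smod"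
  proof -
    note sm = cat_obj_super_module[OF that]
    show "gamma_obj P \<Xi> = Mod \<Xi> (gmod.ten_hom \<Xi> P)" by (rule gamma_obj_eq[OF sm AB])
    show "ind_obj P \<Xi> = Mod \<Xi> (gmod.ten_hom \<Xi> P)"
      by (rule gmod.ind_obj_eq[OF gmod_super_module[OF sm] pcompat_super_module[OF sm]])
  qed
  have "gamma_mor P \<Xi> \<Xi>' \<phi> = ind_mor P \<Xi> \<phi>"
    if \<Xi>: "cat_obj P L \<Xi>" and \<Xi>': "cat_obj P L \<Xi>'" and \<phi>: "cat_mor P \<Xi> \<Xi>' \<phi>"
    for \<Xi> :: "('m, 'n, 'v) smod" and \<Xi>' :: "('m, 'n, 'w) smod" and \<phi>
  proof -
    interpret gmod \<Xi> by (rule gmod_super_module[OF cat_obj_super_module[OF \<Xi>]])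
    have W: "vector_space (mscale \<Xi>')"
      using cat_obj_super_module[OF \<Xi>'] unfolding super_module_def by blast
    have l: "lin_on (gtot G) scl (mscale \<Xi>') \<phi>" using \<phi> unfolding cat_mor_def carrier by blast
    \<comment> \<open>By linearity of \<open>\<phi>\<close> on the carrier, \<open>\<phi>\<close>
      tensored with the identity is composition with \<open>\<phi>\<close>. Both morphism maps are
      restricted to the same carrier.\<close>
    have "tensor_map \<Xi> \<Xi>' \<phi> 0 id \<zeta> = \<phi> \<circ> \<zeta>" if "\<zeta> \<in> ten_hom P" for \<zeta>
      using tensor_map_apply[OF _ l W, of \<zeta>] that unfolding ten_hom_def comp_def by blast
    then show ?thesis
      unfolding gamma_mor_def ind_mor_def obj[OF \<Xi>] Mod_simps by (intro restrict_ext)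
  qed
  then show ?thesis using obj by simp
qed

end
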